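(* Let $\Gamma$ be a countable discrete group, and let $m_\Gamma\in\ell^1(\Gamma)$, $m_{\mathbb{Z}}\in\ell^1(\mathbb{Z})$ be finite complex measures such that the convolution operators $A=L_{m_\Gamma}$ on $\ell^2(\Gamma)$ and $B=L_{m_{\mathbb{Z}}}$ on $\ell^2(\mathbb{Z})$ are self-adjoint. Let $M=L_{m_{\mathbb{Z}\wr\Gamma}}$ on $\ell^2(\mathbb{Z}\wr\Gamma)$ with $m_{\mathbb{Z}\wr\Gamma}=\hat m_\Gamma+\hat m_{\mathbb{Z}}$. Let $\Omega=[0,1]^\Gamma$ with $\mathbb{P}$ the uniform product measure, and for $\omega=(\omega_x)_{x\in\Gamma}\in\Omega$ let $$H(\omega)=A+\operatorname{Diag}(v(x,\omega))_{x\in\Gamma},\qquad v(x,\omega)=V_{m_{\mathbb{Z}}}(\omega_x),\qquad V_{m_{\mathbb{Z}}}(u)=\sum_{n\in\mathbb{Z}}m_{\mathbb{Z}}(n)e^{2\pi i nu}.$$ Then for any smooth bounded function $f:\Sigma(M)\to\mathbb{C}$ on the spectrum $\Sigma(M)$ of $M$ and $g\in\Gamma$, the following identity holds in $L^2(\Omega,\mathbb{P})$: $$\langle\delta_{e_\Gamma},f(H(\omega))\delta_g\rangle=\sum_{l\in\bigoplus_\Gamma\mathbb{Z}}\langle\delta_{e_{\mathbb{Z}\wr\Gamma}},f(M)\delta_{(l,g)}\rangle\,e^{2\pi i\,l\cdot\omega},$$ where $l\cdot\omega=\sum_{x\in\Gamma}l(x)\omega_x$. In particular, the Parseval identity applies: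 $$\mathbb{E}\,\bigl|\langle\delta_{e_\Gamma},f(H(\omega))\delta_g\rangle\bigr|^2=\sum_{l\in\bigoplus_\Gamma\mathbb{Z}}\bigl|\langle\delta_{e_{\mathbb{Z}\wr\Gamma}},f(M)\delta_{(l,g)}\rangle\bigr|^2 .$$
   Context: For a countable discrete group $G$ with identity $e_G$, $\delta_x$ ($x\in G$) is the canonical basis of $\ell^2(G)$; inner products are linear in the second argument. The left regular representation is $(L_xf)(y)=f(x^{-1}y)$. For $m\in\ell^1(G)$, the convolution operator is $L_m=\sum_{x\in G}m(x)L_x$; it is self-adjoint iff $m(g^{-1})=\overline{m(g)}$ for all $g$. $\operatorname{Diag}(v_x)_{x\in\Gamma}$ is the multiplication operator $\delta_x\mapsto v_x\delta_x$. $f(M)$ and $f(H(\omega))$ are defined by functional calculus, and $\mathbb{E}$ is the expectation with respect to $\mathbb{P}$. In this setting the direct integral of $H(\omega)$ over $(\Omega,\mathbb{P})$, that is, the operator $\varphi\mapsto(\omega\mapsto H(\omega)\varphi(\omega))$ on $L^2(\Omega,\mathbb{P};\ell^2(\Gamma))$, is unitarily equivalent to $M$. Wreath product: $\mathbb{Z}\wr\Gamma=(\bigoplus_\Gamma\mathbb{Z})\rtimes\Gamma$ is the set of pairs $(l,g)$ with $g\in\Gamma$ and $l:\Gamma\to\mathbb{Z}$ finitely supported, with product $(l,g)(l',g')=(l+l'\circ g^{-1},gg')$, where $(l'\circ g^{-1})(h)=l'(g^{-1}h)$. The groups embed by $\Gamma\ni g\mapsto\hat g=(0,g)$ and $\mathbb{Z}\ni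 n\mapsto\hat n=(1_n,e_\Gamma)$, with $1_n(e_\Gamma)=n$ and $1_n(x)=0$ for $x\neq e_\Gamma$. For a measure $m$ on $\Gamma$ or $\mathbb{Z}$, $\hat m$ denotes its push-forward to $\mathbb{Z}\wr\Gamma$ under the corresponding embedding.
   Formalization: The Fourier mode e^{2πi l·ω} is replaced by exp(−2πi Σ_x l(x) ω_{x^{-1}g}): with left regular representations the printed identity fails, e.g. for Γ trivial, m_Γ=0, m_Z(1)=i, m_Z(−1)=−i, f(t)=t. *)

theory Defs
  imports "HOL-Probability.Probability" "HOL-Library.Poly_Mapping"
    "HOL-Computational_Algebra.Polynomial"
begin

text \<open>
  Countable discrete groups are types of class \<^class>\<open>group_add\<close> and \<^class>\<open>countable\<close>.
  The class \<^class>\<open>group_add\<close> is not commutative; only the notation is additive: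
  \<open>x + y\<close>, \<open>- x\<close> and \<open>0\<close> are the product, the inverse and the identity of the group.
\<close>

section \<open>The Hilbert space of square-summable functions\<close>

typedef 'a ell2 = "{u :: 'a \<Rightarrow> complex. (\<lambda>x. (norm (u x))\<^sup>2) summable_on UNIV}"
  by (rule exI[of _ "\<lambda>_. 0"]) simp

setup_lifting type_definition_ell2

lemma ell2_bound_summable:
  fixes u :: "'a \<Rightarrow> complex" and w :: "'a \<Rightarrow> real"
  assumes "w summable_on UNIV" "\<And>x. (norm (u x))\<^sup>2 \<le> w x"
  shows "(\<lambda>x. (norm (u x))\<^sup>2) summable_on UNIV"
  by (rule summable_on_comparison_test[OF assms(1)]) (use assms(2) in auto)

lemma ell2_add_summable:
  fixes u v :: "'a \<Rightarrow> complex"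
  assumes "(\<lambda>x. (norm (u x))\<^sup>2) summable_on UNIV" "(\<lambda>x. (norm (v x))\<^sup>2) summable_on UNIV"
  shows "(\<lambda>x. (norm (u x + v x))\<^sup>2) summable_on UNIV"
proof (rule ell2_bound_summable)
  show "(\<lambda>x. 2 * ((norm (u x))\<^sup>2 + (norm (v x))\<^sup>2)) summable_on UNIV"
    by (intro summable_on_cmult_right summable_on_add assms)
  fix x
  have "(norm (u x + v x))\<^sup>2 \<le> (norm (u x) + norm (v x))\<^sup>2"
    by (simp add: norm_triangle_ineq power_mono)
  also have "\<dots> \<le> 2 * ((norm (u x))\<^sup>2 + (norm (v x))\<^sup>2)"
    using sum_squares_bound[of "norm (u x)" "norm (v x)"] by (simp add: power2_sum)
  finally show "(norm (u x + v x))\<^sup>2 \<le> 2 * ((norm (u x))\<^sup>2 + (norm (v x))\<^sup>2)" .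
qed

lemma ell2_cmult_summable:
  fixes u :: "'a \<Rightarrow> complex"
  assumes "(\<lambda>x. (norm (u x))\<^sup>2) summable_on UNIV"
  shows "(\<lambda>x. (norm (c * u x))\<^sup>2) summable_on UNIV"
  using summable_on_cmult_right[OF assms, of "(norm c)\<^sup>2"]
  by (simp add: norm_mult power_mult_distrib)

instantiation ell2 :: (type) real_vector
begin

lift_definition zero_ell2 :: "'a ell2" is "\<lambda>_. 0" by simp
lift_definition plus_ell2 :: "'a ell2 \<Rightarrow> 'a ell2 \<Rightarrow> 'a ell2" is "\<lambda>u v x. u x + v x"
  by (simp add: ell2_add_summable)
lift_definition uminus_ell2 :: "'a ell2 \<Rightarrow> 'a ell2" is "\<lambda>u x. - u x" by simp
lift_definition minus_ell2 :: "'a ell2 \<Rightarrow> 'a ell2 \<Rightarrow> 'a ell2" is "\<lambda>u v x. u x - v x"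
  using ell2_add_summable[of _ "\<lambda>x. - _ x"] by simp
lift_definition scaleR_ell2 :: "real \<Rightarrow> 'a ell2 \<Rightarrow> 'a ell2" is "\<lambda>r u x. complex_of_real r * u x"
  using ell2_cmult_summable by blast

instance
  by standard (transfer; simp add: algebra_simps)+

end

lemma ell2_inner_summable:
  fixes u v :: "'a \<Rightarrow> complex"
  assumes "(\<lambda>x. (norm (u x))\<^sup>2) summable_on UNIV" "(\<lambda>x. (norm (v x))\<^sup>2) summable_on UNIV"
  shows "(\<lambda>x. u x \<bullet> v x) summable_on UNIV"
proof -
  have "(\<lambda>x. (norm (u x + v x))\<^sup>2 - (norm (u x))\<^sup>2 - (norm (v x))\<^sup>2) summable_on UNIV"
    using summable_on_add[OF ell2_add_summable[OF assms]
        summable_on_add[OF assms, THEN summable_on_cmult_right[of _ _ "-1"]]]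
    by (simp add: algebra_simps)
  then have "(\<lambda>x. (1/2) * ((norm (u x + v x))\<^sup>2 - (norm (u x))\<^sup>2 - (norm (v x))\<^sup>2)) summable_on UNIV"
    by (rule summable_on_cmult_right)
  moreover have "(1/2) * ((norm (u x + v x))\<^sup>2 - (norm (u x))\<^sup>2 - (norm (v x))\<^sup>2) = u x \<bullet> v x" for x
    by (simp add: power2_norm_eq_inner inner_add_left inner_add_right inner_commute)
  ultimately show ?thesis by simp
qed

text \<open>
  The real inner product below is the real part of the complex one. It gives the norm
  \<open>norm u = sqrt (\<Sum>\<^sub>x \<bar>u x\<bar>\<^sup>2)\<close> and makes the bounded operators a type of
  \<^typ>\<open>'a ell2 \<Rightarrow>\<^sub>L 'a ell2\<close>.
\<close>

instantiation ell2 :: (type) real_inner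
begin

lift_definition inner_ell2 :: "'a ell2 \<Rightarrow> 'a ell2 \<Rightarrow> real" is "\<lambda>u v. \<Sum>\<^sub>\<infinity>x. u x \<bullet> v x" .
definition norm_ell2 :: "'a ell2 \<Rightarrow> real" where "norm_ell2 u = sqrt (u \<bullet> u)"
definition sgn_ell2 :: "'a ell2 \<Rightarrow> 'a ell2" where "sgn_ell2 u = u /\<^sub>R norm u"
definition dist_ell2 :: "'a ell2 \<Rightarrow> 'a ell2 \<Rightarrow> real" where "dist_ell2 u v = norm (u - v)"
definition uniformity_ell2 :: "('a ell2 \<times> 'a ell2) filter" where
  "uniformity_ell2 = (INF e\<in>{0 <..}. principal {(x, y). dist x y < e})"
definition open_ell2 :: "'a ell2 set \<Rightarrow> bool" where
  "open_ell2 S = (\<forall>x\<in>S. \<forall>\<^sub>F (x', y) in uniformity. x' = x \<longrightarrow> y \<in> S)"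

instance
proof
  fix u v w :: "'a ell2" and r :: real
  show "u \<bullet> v = v \<bullet> u"
    by transfer (simp add: inner_commute)
  show "(u + v) \<bullet> w = u \<bullet> w + v \<bullet> w"
    by transfer (simp add: inner_add_left infsum_add ell2_inner_summable)
  have "(complex_of_real s * a) \<bullet> b = s * (a \<bullet> b)" for s a b
    by (metis inner_scaleR_left scaleR_conv_of_real)
  then show "(r *\<^sub>R u) \<bullet> v = r * (u \<bullet> v)"
    by transfer (simp add: infsum_cmult_right')
  show "0 \<le> u \<bullet> u"
    by transfer (simp add: infsum_nonneg)
  show "(u \<bullet> u = 0) = (u = 0)"
  proof (transfer, standard)
    fix u :: "'a \<Rightarrow> complex"
    assume u: "(\<lambda>x. (norm (u x))\<^sup>2) summable_on UNIV" and z: "(\<Sum>\<^sub>\<infinity>x. u x \<bullet> u x) = 0"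
    have "u x \<bullet> u x = 0" for x
      by (rule nonneg_infsum_le_0D[where A = UNIV])
        (use u z in \<open>auto intro: ell2_inner_summable\<close>)
    then show "u = (\<lambda>_. 0)" by auto
  qed simp
  show "norm u = sqrt (u \<bullet> u)" by (rule norm_ell2_def)
  show "dist u v = norm (u - v)" by (rule dist_ell2_def)
  show "sgn u = u /\<^sub>R norm u" by (rule sgn_ell2_def)
  show "uniformity = (INF e\<in>{0 <..}. principal {(x :: 'a ell2, y). dist x y < e})"
    by (rule uniformity_ell2_def)
  show "open S = (\<forall>x\<in>S. \<forall>\<^sub>F (x', y) in uniformity. x' = x \<longrightarrow> y \<in> S)" for S :: "'a ell2 set"
    by (rule open_ell2_def)
qed

end

lemma norm_ell2_eq: "norm u = sqrt (\<Sum>\<^sub>\<infinity>x. (norm (Rep_ell2 u x))\<^sup>2)"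
  by (simp add: norm_ell2_def inner_ell2.rep_eq power2_norm_eq_inner)

text \<open>The complex inner product is linear in its second argument.\<close>

definition cip :: "'a ell2 \<Rightarrow> 'a ell2 \<Rightarrow> complex" where
  "cip u v = (\<Sum>\<^sub>\<infinity>x. cnj (Rep_ell2 u x) * Rep_ell2 v x)"

lift_definition delta :: "'a \<Rightarrow> 'a ell2" is "\<lambda>x y. if y = x then 1 else 0"
proof -
  fix x :: 'a
  have "(\<lambda>y. (norm (if y = x then 1 else 0 :: complex))\<^sup>2) summable_on {x}" by simp
  then show "(\<lambda>y. (norm (if y = x then 1 else 0 :: complex))\<^sup>2) summable_on UNIV"
    by (subst summable_on_cong_neutral[where T = "{x}"]) auto
qed

section \<open>Operators\<close>

text \<open>
  The type \<^typ>\<open>'a ell2 \<Rightarrow>\<^sub>L 'a ell2\<close> consists of the bounded real-linear operators. All operators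
  built below are complex-linear, and a bounded inverse of a complex-linear operator is
  complex-linear.
\<close>

lemma bounded_range_iff: "bounded (range v) \<longleftrightarrow> (\<exists>K. \<forall>x. norm (v x) \<le> K)"
  by (auto simp: bounded_iff)

text \<open>Multiplication by an unbounded \<open>v\<close> is given the junk value \<open>0\<close>.\<close>

lift_definition ell2_mult :: "('a \<Rightarrow> complex) \<Rightarrow> 'a ell2 \<Rightarrow> 'a ell2"
  is "\<lambda>v u x. if bounded (range v) then v x * u x else 0"
proof -
  fix v u :: "'a \<Rightarrow> complex"
  assume u: "(\<lambda>x. (norm (u x))\<^sup>2) summable_on UNIV"
  show "(\<lambda>x. (norm (if bounded (range v) then v x * u x else 0))\<^sup>2) summable_on UNIV"
  proof (cases "bounded (range v)")
    case True
    then obtain K where K: "\<And>x. norm (v x) \<le> K" unfolding bounded_range_iff by blast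
    have "(\<lambda>x. K\<^sup>2 * (norm (u x))\<^sup>2) summable_on UNIV"
      using u by (intro summable_on_cmult_right) simp
    then have "(\<lambda>x. (norm (v x * u x))\<^sup>2) summable_on UNIV"
      by (rule ell2_bound_summable)
        (use K in \<open>simp add: norm_mult power_mult_distrib mult_right_mono power_mono\<close>)
    then show ?thesis using True by simp
  qed simp
qed

lift_definition Diag :: "('a \<Rightarrow> complex) \<Rightarrow> ('a ell2 \<Rightarrow>\<^sub>L 'a ell2)" is ell2_mult
proof -
  fix v :: "'a \<Rightarrow> complex"
  obtain K where K: "K \<ge> 0" "bounded (range v) \<Longrightarrow> norm (v x) \<le> K" for x
  proof (cases "bounded (range v)")
    case True
    then obtain K where "\<And>x. norm (v x) \<le> K" unfolding bounded_range_iff by blast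
    then show ?thesis using that[of K] norm_ge_zero order_trans by metis
  next
    case False
    then show ?thesis using that[of 0] by auto
  qed
  show "bounded_linear (ell2_mult v)"
  proof (rule bounded_linear_intro)
    show "ell2_mult v (u + w) = ell2_mult v u + ell2_mult v w" for u w
      by transfer (auto simp: algebra_simps)
    show "ell2_mult v (r *\<^sub>R u) = r *\<^sub>R ell2_mult v u" for r u
      by transfer (auto simp: algebra_simps)
    show "norm (ell2_mult v u) \<le> norm u * K" for u
    proof -
      have s: "(\<lambda>x. (norm (Rep_ell2 w x))\<^sup>2) summable_on UNIV" for w :: "'a ell2"
        using Rep_ell2[of w] by simp
      have "(norm (Rep_ell2 (ell2_mult v u) x))\<^sup>2 \<le> K\<^sup>2 * (norm (Rep_ell2 u x))\<^sup>2" for x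
        using K(1) K(2)[of x]
        by (auto simp: ell2_mult.rep_eq norm_mult power_mult_distrib intro!: mult_right_mono power_mono)
      then have "(\<Sum>\<^sub>\<infinity>x. (norm (Rep_ell2 (ell2_mult v u) x))\<^sup>2) \<le> (\<Sum>\<^sub>\<infinity>x. K\<^sup>2 * (norm (Rep_ell2 u x))\<^sup>2)"
        by (intro infsum_mono s summable_on_cmult_right)
      also have "\<dots> = K\<^sup>2 * (\<Sum>\<^sub>\<infinity>x. (norm (Rep_ell2 u x))\<^sup>2)" by (simp add: infsum_cmult_right')
      finally have "norm (ell2_mult v u) \<le> sqrt (K\<^sup>2 * (\<Sum>\<^sub>\<infinity>x. (norm (Rep_ell2 u x))\<^sup>2))"
        unfolding norm_ell2_eq by (rule real_sqrt_le_mono)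
      also have "\<dots> = norm u * K" using K(1) by (simp add: norm_ell2_eq real_sqrt_mult)
      finally show ?thesis .
    qed
  qed
qed

lemma Diag_apply: "bounded (range v) \<Longrightarrow> Rep_ell2 (Diag v u) x = v x * Rep_ell2 u x"
  by (simp add: Diag.rep_eq ell2_mult.rep_eq)

abbreviation scalar :: "complex \<Rightarrow> ('a ell2 \<Rightarrow>\<^sub>L 'a ell2)" where
  "scalar c \<equiv> Diag (\<lambda>_. c)"

lift_definition ell2_translate :: "'g::group_add \<Rightarrow> 'g ell2 \<Rightarrow> 'g ell2"
  is "\<lambda>x u y. u (- x + y)"
proof -
  fix x :: 'g and u :: "'g \<Rightarrow> complex"
  assume u: "(\<lambda>x. (norm (u x))\<^sup>2) summable_on UNIV"
  have "bij (\<lambda>y. - x + y)" by (rule bij_betw_byWitness[where f' = "\<lambda>y. x + y"]) (auto simp: add.assoc[symmetric])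
  then show "(\<lambda>y. (norm (u (- x + y)))\<^sup>2) summable_on UNIV"
    using summable_on_reindex_bij_betw[of "\<lambda>y. - x + y" UNIV UNIV "\<lambda>x. (norm (u x))\<^sup>2"] u by simp
qed

text \<open>The left regular representation: \<open>(L\<^sub>x u)(y) = u(x\<inverse>y)\<close>.\<close>

lift_definition left_regular :: "'g::group_add \<Rightarrow> ('g ell2 \<Rightarrow>\<^sub>L 'g ell2)" is ell2_translate
proof -
  fix x :: 'g
  have bij: "bij (\<lambda>y. - x + y)" by (rule bij_betw_byWitness[where f' = "\<lambda>y. x + y"]) (auto simp: add.assoc[symmetric])
  show "bounded_linear (ell2_translate x)"
  proof (rule bounded_linear_intro)
    show "ell2_translate x (u + w) = ell2_translate x u + ell2_translate x w" for u w
      by transfer simp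
    show "ell2_translate x (r *\<^sub>R u) = r *\<^sub>R ell2_translate x u" for r u
      by transfer simp
    show "norm (ell2_translate x u) \<le> norm u * 1" for u
      using infsum_reindex_bij_betw[OF bij, of "\<lambda>y. (norm (Rep_ell2 u y))\<^sup>2"]
      by (simp add: norm_ell2_eq ell2_translate.rep_eq)
  qed
qed

text \<open>The series converges absolutely in operator norm if \<open>m\<close> is summable.\<close>

definition convolution_op :: "('g::group_add \<Rightarrow> complex) \<Rightarrow> ('g ell2 \<Rightarrow>\<^sub>L 'g ell2)" where
  "convolution_op m = (\<Sum>\<^sub>\<infinity>x. scalar (m x) o\<^sub>L left_regular x)"

definition self_adjoint :: "('a ell2 \<Rightarrow>\<^sub>L 'a ell2) \<Rightarrow> bool" where
  "self_adjoint T \<longleftrightarrow> (\<forall>u v. cip (T u) v = cip u (T v))"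

definition spectrum :: "('a ell2 \<Rightarrow>\<^sub>L 'a ell2) \<Rightarrow> complex set" where
  "spectrum T = {z. \<not> (\<exists>S. S o\<^sub>L (T - scalar z) = id_blinfun \<and> (T - scalar z) o\<^sub>L S = id_blinfun)}"

definition poly_op :: "complex poly \<Rightarrow> ('a ell2 \<Rightarrow>\<^sub>L 'a ell2) \<Rightarrow> ('a ell2 \<Rightarrow>\<^sub>L 'a ell2)" where
  "poly_op p T = (\<Sum>i\<le>degree p. scalar (coeff p i) o\<^sub>L ((\<lambda>S. T o\<^sub>L S) ^^ i) id_blinfun)"

text \<open>
  Continuous functional calculus of a bounded self-adjoint operator \<open>T\<close>: \<open>f(T)\<close> is the limit in
  operator norm of \<open>p\<^sub>n(T)\<close> for polynomials \<open>p\<^sub>n\<close> converging to \<open>f\<close> uniformly on the spectrum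
  of \<open>T\<close>. Such polynomials exist and the limit does not depend on their choice as soon as \<open>f\<close> is
  continuous on the spectrum, and only the values of \<open>f\<close> on the spectrum matter.
\<close>

definition fun_calc :: "(complex \<Rightarrow> complex) \<Rightarrow> ('a ell2 \<Rightarrow>\<^sub>L 'a ell2) \<Rightarrow> ('a ell2 \<Rightarrow>\<^sub>L 'a ell2)" where
  "fun_calc f T = (THE S. \<exists>p :: nat \<Rightarrow> complex poly.
     uniform_limit (spectrum T) (\<lambda>n. poly (p n)) f sequentially \<and>
     (\<lambda>n. poly_op (p n) T) \<longlonglongrightarrow> S)"

text \<open>
  Smoothness of a function on a set of real numbers (regarded as complex numbers): it is the
  restriction of an infinitely differentiable function \<open>\<real> \<Rightarrow> \<complex>\<close>, whose successive derivatives
  are \<open>D k\<close>. It is used for the spectrum of a self-adjoint operator, which is real.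
\<close>

definition smooth_on_spectrum :: "(complex \<Rightarrow> complex) \<Rightarrow> complex set \<Rightarrow> bool" where
  "smooth_on_spectrum f \<Sigma> \<longleftrightarrow> (\<exists>D :: nat \<Rightarrow> real \<Rightarrow> complex.
     (\<forall>k t. (D k has_vector_derivative D (Suc k) t) (at t)) \<and>
     (\<forall>t. complex_of_real t \<in> \<Sigma> \<longrightarrow> f (complex_of_real t) = D 0 t))"

section \<open>The wreath product\<close>

text \<open>The pair \<open>(l, g)\<close> with \<open>l\<close> finitely supported is \<open>Wr l g\<close>.\<close>

datatype 'g wreath = Wr (lamps: "'g \<Rightarrow>\<^sub>0 int") (position: 'g)

text \<open>\<open>l \<circ> g\<inverse>\<close>, that is, \<open>h \<mapsto> l(g\<inverse>h)\<close>.\<close>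

definition lamp_shift :: "'g::group_add \<Rightarrow> ('g \<Rightarrow>\<^sub>0 int) \<Rightarrow> ('g \<Rightarrow>\<^sub>0 int)" where
  "lamp_shift g l = Poly_Mapping.map_key (\<lambda>h. - g + h) l"

lemma lookup_lamp_shift: "Poly_Mapping.lookup (lamp_shift g l) h = Poly_Mapping.lookup l (- g + h)"
  by (simp add: lamp_shift_def map_key.rep_eq inj_def)

lemma lamp_shift_simps:
  "lamp_shift g (l + l') = lamp_shift g l + lamp_shift g l'"
  "lamp_shift g (- l) = - lamp_shift g l"
  "lamp_shift g 0 = 0"
  "lamp_shift 0 l = l"
  "lamp_shift g (lamp_shift h l) = lamp_shift (g + h) l"
  by (auto intro!: poly_mapping_eqI simp: lookup_lamp_shift lookup_add minus_add
      add.assoc[symmetric] simp del: add_uminus_conv_diff)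

instantiation wreath :: (group_add) group_add
begin

definition zero_wreath :: "'a wreath" where "0 = Wr 0 0"
definition plus_wreath :: "'a wreath \<Rightarrow> 'a wreath \<Rightarrow> 'a wreath" where
  "a + b = Wr (lamps a + lamp_shift (position a) (lamps b)) (position a + position b)"
definition uminus_wreath :: "'a wreath \<Rightarrow> 'a wreath" where
  "- a = Wr (lamp_shift (- position a) (- lamps a)) (- position a)"
definition minus_wreath :: "'a wreath \<Rightarrow> 'a wreath \<Rightarrow> 'a wreath" where
  "a - b = a + - (b :: 'a wreath)"

instance
  by standard
    (auto simp: zero_wreath_def plus_wreath_def uminus_wreath_def minus_wreath_def
      lamp_shift_simps add.assoc)

end

definition embed_base :: "'g \<Rightarrow> 'g::group_add wreath" where
  "embed_base g = Wr 0 g"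

definition embed_lamp :: "int \<Rightarrow> 'g::group_add wreath" where
  "embed_lamp n = Wr (Poly_Mapping.single 0 n) 0"

definition pushforward :: "('a \<Rightarrow> 'b) \<Rightarrow> ('a \<Rightarrow> complex) \<Rightarrow> 'b \<Rightarrow> complex" where
  "pushforward \<iota> m w = (\<Sum>\<^sub>\<infinity>x\<in>\<iota> -` {w}. m x)"

definition wreath_measure :: "('g::group_add \<Rightarrow> complex) \<Rightarrow> (int \<Rightarrow> complex) \<Rightarrow> 'g wreath \<Rightarrow> complex" where
  "wreath_measure m\<^sub>\<Gamma> m\<^sub>Z w = pushforward embed_base m\<^sub>\<Gamma> w + pushforward embed_lamp m\<^sub>Z w"

section \<open>The random operator\<close>

text \<open>The underlying space is exactly the set of functions from the group to the unit interval.\<close>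

definition uniform_product :: "('g \<Rightarrow> real) measure" where
  "uniform_product = (\<Pi>\<^sub>M x\<in>UNIV. restrict_space lborel {0..1})"

definition potential :: "(int \<Rightarrow> complex) \<Rightarrow> real \<Rightarrow> complex" where
  "potential m u = (\<Sum>\<^sub>\<infinity>n. m n * exp (2 * of_real pi * \<i> * of_int n * of_real u))"

definition random_hamiltonian ::
  "('g::group_add \<Rightarrow> complex) \<Rightarrow> (int \<Rightarrow> complex) \<Rightarrow> ('g \<Rightarrow> real) \<Rightarrow> ('g ell2 \<Rightarrow>\<^sub>L 'g ell2)" where
  "random_hamiltonian m\<^sub>\<Gamma> m\<^sub>Z \<omega> = convolution_op m\<^sub>\<Gamma> + Diag (\<lambda>x. potential m\<^sub>Z (\<omega> x))"

definition lamp_pairing :: "('g \<Rightarrow>\<^sub>0 int) \<Rightarrow> ('g \<Rightarrow> real) \<Rightarrow> real" where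
  "lamp_pairing l \<omega> = (\<Sum>x\<in>Poly_Mapping.keys l. of_int (Poly_Mapping.lookup l x) * \<omega> x)"

text \<open>
  With left regular representations throughout, the map
  \<open>\<delta>\<^bsub>(l,h)\<^esub> \<mapsto> exp(2\<pi>i \<Sum>\<^sub>x l(x) \<omega>(x\<inverse>h)) \<otimes> \<delta>\<^sub>h\<close> is unitary onto \<open>L\<^sup>2(\<Omega>; \<ell>\<^sup>2(\<Gamma>))\<close> and
  intertwines \<open>M\<close> with the direct integral of \<open>H(\<omega>)\<close>. So the Fourier mode that goes with the
  matrix element of \<open>f(M)\<close> at \<open>\<delta>\<^sub>e\<close> and \<open>\<delta>\<^bsub>(l,g)\<^esub>\<close> is \<open>exp(- 2\<pi>i \<Sum>\<^sub>x l(x) \<omega>(x\<inverse>g))\<close>.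
  The mode \<open>exp(2\<pi>i l\<cdot>\<omega>)\<close> belongs to right regular representations. For left ones it
  already fails for the trivial group, \<open>f(t) = t\<close> and \<open>m\<^sub>Z(1) = i = - m\<^sub>Z(-1)\<close>, and for the
  symmetric group on three letters even with real symmetric \<open>m\<^sub>Z\<close> and \<open>f(t) = t\<^sup>3\<close>.
\<close>

section \<open>Expansions in the space of square-integrable functions\<close>

definition square_integrable :: "'a measure \<Rightarrow> ('a \<Rightarrow> complex) \<Rightarrow> bool" where
  "square_integrable P X \<longleftrightarrow> X \<in> borel_measurable P \<and> integrable P (\<lambda>\<omega>. (norm (X \<omega>))\<^sup>2)"

text \<open>\<open>X = \<Sum>\<^bsub>i\<in>I\<^esub> F i\<close> with unconditional convergence in \<open>L\<^sup>2(P)\<close>.\<close>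

definition has_L2_sum :: "'a measure \<Rightarrow> ('i \<Rightarrow> 'a \<Rightarrow> complex) \<Rightarrow> ('a \<Rightarrow> complex) \<Rightarrow> 'i set \<Rightarrow> bool" where
  "has_L2_sum P F X I \<longleftrightarrow>
     square_integrable P X \<and> (\<forall>i\<in>I. square_integrable P (F i)) \<and>
     ((\<lambda>J. \<integral>\<omega>. (norm (X \<omega> - (\<Sum>i\<in>J. F i \<omega>)))\<^sup>2 \<partial>P) \<longlongrightarrow> 0) (finite_subsets_at_top I)"

end

theory Submission
  imports Defs "HOL-Computational_Algebra.Fundamental_Theorem_Algebra"
begin

text \<open>
  Both \<open>M\<close> and \<open>H(\<omega>)\<close> are images of the same \<open>\<ell>\<^sup>1\<close> element of the wreath product: \<open>M\<close>
  under the left regular representation, and \<open>H(\<omega>)\<close> under the representation \<open>\<pi>\<^sub>\<omega>\<close>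
  (\<open>wreath_rep\<close>) on \<open>\<ell>\<^sup>2(\<Gamma>)\<close> that is induced from the character
  \<open>l \<mapsto> exp(2\<pi>i \<Sum>\<^sub>x l(x) \<omega>(x\<inverse>))\<close> of the lamp group. For a single group element \<open>w\<close>, the
  matrix element of \<open>\<pi>\<^sub>\<omega>(w)\<close> at \<open>\<delta>\<^sub>e\<close> and \<open>\<delta>\<^sub>g\<close> is either zero or one Fourier mode in \<open>\<omega>\<close>,
  and the expansion can be read off (\<open>group_algebra_pair_matrix_element\<close>). By linearity it
  holds as a finite sum on the group algebra. The rest of the proof carries it to norm
  limits, and shows that \<open>f(M)\<close> and \<open>f(H(\<omega>))\<close> are such limits.

  The key estimate is that \<open>\<pi>\<^sub>\<omega>\<close> is dominated by the regular representation:
  \<open>\<parallel>\<pi>\<^sub>\<omega>(a)\<parallel> \<le> \<parallel>L\<^sub>a\<parallel>\<close> for every element \<open>a\<close> of the group algebra and every \<open>\<omega>\<close>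
  (\<open>group_algebra_pair_norm_le\<close>). It holds because the lamp group is amenable: an almost
  invariant unit vector \<open>\<xi>\<close> on it, twisted by the character, gives an isometry \<open>\<phi> \<mapsto> \<xi> \<otimes> \<phi>\<close>
  of \<open>\<ell>\<^sup>2(\<Gamma>)\<close> that nearly intertwines the two representations. The direct integral
  decomposition of \<open>M\<close> would give the estimate for almost every \<open>\<omega>\<close> only.

  A self-adjoint \<open>T\<close> satisfies \<open>\<parallel>p(T)\<parallel> = \<bar>p(z)\<bar>\<close> for some \<open>z\<close> in its spectrum, for each
  polynomial \<open>p\<close> (\<open>norm_poly_op_attained\<close>). With the key estimate this shows that the
  spectrum of every \<open>H(\<omega>)\<close> lies in that of \<open>M\<close> (\<open>spectrum_mono\<close>). So polynomials that
  converge to \<open>f\<close> uniformly on the spectrum of \<open>M\<close> compute \<open>f(M)\<close> and all \<open>f(H(\<omega>))\<close>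
  simultaneously, and one element of the group algebra approximates \<open>f(M)\<close> and, uniformly
  in \<open>\<omega>\<close>, \<open>f(H(\<omega>))\<close>. The matrix element of \<open>f(H(\<omega>))\<close> is therefore a uniform limit of
  trigonometric polynomials with the coefficients of \<open>f(M)\<close> in the limit, and since the
  modes are orthonormal, this gives both the expansion in \<open>L\<^sup>2\<close> and the Parseval identity
  (\<open>L2_expansion\<close>).
\<close>

section \<open>Square-summable functions\<close>

lemma ell2_summable: "(\<lambda>x. (norm (Rep_ell2 u x))\<^sup>2) summable_on UNIV"
  using Rep_ell2[of u] by simp

lemma norm_ell2_has_sum: "((\<lambda>x. (norm (Rep_ell2 u x))\<^sup>2) has_sum (norm u)\<^sup>2) UNIV"
  using has_sum_infsum[OF ell2_summable[of u]] by (simp add: norm_ell2_eq infsum_nonneg)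

lemma Rep_ell2_add: "Rep_ell2 (u + v) x = Rep_ell2 u x + Rep_ell2 v x"
  by (simp add: plus_ell2.rep_eq)

lemma Rep_ell2_diff: "Rep_ell2 (u - v) x = Rep_ell2 u x - Rep_ell2 v x"
  by (simp add: minus_ell2.rep_eq)

lemma Rep_ell2_zero: "Rep_ell2 0 x = 0"
  by (simp add: zero_ell2.rep_eq)

lemma Rep_ell2_scaleR: "Rep_ell2 (r *\<^sub>R u) x = r *\<^sub>R Rep_ell2 u x"
  by (simp add: scaleR_ell2.rep_eq scaleR_conv_of_real)

lemma Rep_ell2_sum: "Rep_ell2 (sum f F) x = (\<Sum>i\<in>F. Rep_ell2 (f i) x)"
  by (induction F rule: infinite_finite_induct) (auto simp: Rep_ell2_add Rep_ell2_zero)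

lemma ell2_eqI: "(\<And>x. Rep_ell2 u x = Rep_ell2 v x) \<Longrightarrow> u = v"
  by (metis Rep_ell2_inject ext)

lemma norm_Rep_ell2_le: "norm (Rep_ell2 u x) \<le> norm u"
proof -
  have "(\<Sum>y\<in>{x}. (norm (Rep_ell2 u y))\<^sup>2) \<le> (\<Sum>\<^sub>\<infinity>y. (norm (Rep_ell2 u y))\<^sup>2)"
    by (rule finite_sum_le_infsum) (auto simp: ell2_summable)
  also have "\<dots> = (norm u)\<^sup>2" using norm_ell2_has_sum infsumI by blast
  finally show ?thesis by (simp add: power2_le_iff_abs_le)
qed

lemma bounded_linear_Rep_ell2: "bounded_linear (\<lambda>u. Rep_ell2 u x)"
  by (rule bounded_linear_intro[where K = 1])
    (auto simp: Rep_ell2_add Rep_ell2_scaleR norm_Rep_ell2_le)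

lemma norm_ell2_bound:
  assumes "\<And>F. finite F \<Longrightarrow> (\<Sum>x\<in>F. (norm (Rep_ell2 u x))\<^sup>2) \<le> e\<^sup>2" "e \<ge> 0"
  shows "norm u \<le> e"
proof -
  have "(norm u)\<^sup>2 \<le> e\<^sup>2"
    using norm_ell2_has_sum[of u] assms(1) by (rule has_sum_le_finite_sums)
  then show ?thesis using assms(2) by (simp add: power2_le_iff_abs_le)
qed

text \<open>
  Completeness is what makes the bounded operators a Banach space, hence what makes
  geometric series of operators and limits of polynomials in an operator exist.
\<close>

instance ell2 :: (type) banach
proof
  fix X :: "nat \<Rightarrow> 'a ell2"
  assume X: "Cauchy X"
  have "Cauchy (\<lambda>n. Rep_ell2 (X n) x)" for x
    by (rule bounded_linear.Cauchy[OF bounded_linear_Rep_ell2 X])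
  then have "\<forall>x. \<exists>L. (\<lambda>n. Rep_ell2 (X n) x) \<longlonglongrightarrow> L"
    by (simp add: Cauchy_convergent_iff convergent_def)
  then have "\<exists>L. \<forall>x. (\<lambda>n. Rep_ell2 (X n) x) \<longlonglongrightarrow> L x"
    by (rule choice)
  then obtain L where L: "\<And>x. (\<lambda>n. Rep_ell2 (X n) x) \<longlonglongrightarrow> L x" by blast
  have key: "\<exists>N. \<forall>n\<ge>N. \<forall>F. finite F \<longrightarrow> (\<Sum>x\<in>F. (norm (Rep_ell2 (X n) x - L x))\<^sup>2) \<le> e\<^sup>2"
    if "e > 0" for e
  proof -
    obtain N where N: "\<And>m n. m \<ge> N \<Longrightarrow> n \<ge> N \<Longrightarrow> norm (X n - X m) < e"
      using X \<open>e > 0\<close> unfolding Cauchy_iff by blast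
    have "(\<Sum>x\<in>F. (norm (Rep_ell2 (X n) x - L x))\<^sup>2) \<le> e\<^sup>2" if n: "n \<ge> N" and F: "finite F" for n F
    proof (rule LIMSEQ_le_const2)
      show "(\<lambda>m. \<Sum>x\<in>F. (norm (Rep_ell2 (X n) x - Rep_ell2 (X m) x))\<^sup>2)
          \<longlonglongrightarrow> (\<Sum>x\<in>F. (norm (Rep_ell2 (X n) x - L x))\<^sup>2)"
        by (intro tendsto_intros L)
      have "(\<Sum>x\<in>F. (norm (Rep_ell2 (X n) x - Rep_ell2 (X m) x))\<^sup>2) \<le> e\<^sup>2" if "m \<ge> N" for m
      proof -
        have "(\<Sum>x\<in>F. (norm (Rep_ell2 (X n) x - Rep_ell2 (X m) x))\<^sup>2) \<le> (norm (X n - X m))\<^sup>2"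
          using finite_sum_le_infsum[OF ell2_summable F, of "X n - X m"]
            infsumI[OF norm_ell2_has_sum, of "X n - X m"] by (simp add: Rep_ell2_diff)
        also have "\<dots> \<le> e\<^sup>2" using N[OF that n] by (intro power_mono) auto
        finally show ?thesis .
      qed
      then show "\<exists>N. \<forall>m\<ge>N. (\<Sum>x\<in>F. (norm (Rep_ell2 (X n) x - Rep_ell2 (X m) x))\<^sup>2) \<le> e\<^sup>2" by blast
    qed
    then show ?thesis by blast
  qed
  have "(\<lambda>x. (norm (L x))\<^sup>2) summable_on UNIV"
  proof -
    obtain N where N: "\<And>F. finite F \<Longrightarrow> (\<Sum>x\<in>F. (norm (Rep_ell2 (X N) x - L x))\<^sup>2) \<le> 1\<^sup>2"
      using key[of 1] by force
    have "(\<lambda>x. (norm (Rep_ell2 (X N) x - L x))\<^sup>2) summable_on UNIV"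
      by (rule nonneg_bdd_above_summable_on) (use N in \<open>auto intro!: bdd_aboveI2\<close>)
    from ell2_add_summable[OF ell2_summable[of "X N"] ell2_cmult_summable[OF this, of "-1"]]
    show ?thesis by simp
  qed
  then have RL: "Rep_ell2 (Abs_ell2 L) = L" by (simp add: Abs_ell2_inverse)
  have "X \<longlonglongrightarrow> Abs_ell2 L"
  proof (rule LIMSEQ_I)
    fix e :: real assume "e > 0"
    then obtain N where N: "\<And>n F. n \<ge> N \<Longrightarrow> finite F \<Longrightarrow>
        (\<Sum>x\<in>F. (norm (Rep_ell2 (X n) x - L x))\<^sup>2) \<le> (e/2)\<^sup>2"
      using key[of "e/2"] by (metis half_gt_zero)
    have "norm (X n - Abs_ell2 L) < e" if "n \<ge> N" for n
    proof -
      have "norm (X n - Abs_ell2 L) \<le> e/2"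
        by (rule norm_ell2_bound) (use N[OF that] \<open>e > 0\<close> in \<open>auto simp: Rep_ell2_diff RL\<close>)
      then show ?thesis using \<open>e > 0\<close> by simp
    qed
    then show "\<exists>N. \<forall>n\<ge>N. norm (X n - Abs_ell2 L) < e" by blast
  qed
  then show "convergent X" by (auto simp: convergent_def)
qed

lemma scalar_apply: "Rep_ell2 (scalar c u) x = c * Rep_ell2 u x"
  by (simp add: Diag_apply)

lemma scalar_mult: "scalar c (scalar d u) = scalar (c * d) u"
  by (rule ell2_eqI) (simp add: scalar_apply)

lemma scalar_add: "scalar (c + d) = scalar c + scalar d"
  by (rule blinfun_eqI, rule ell2_eqI)
    (simp add: scalar_apply blinfun.add_left Rep_ell2_add algebra_simps)

lemma scalar_of_real: "scalar (complex_of_real r) u = r *\<^sub>R u"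
  by (rule ell2_eqI) (simp add: scalar_apply Rep_ell2_scaleR scaleR_conv_of_real)

lemma scalar_0: "scalar 0 = 0"
  by (rule blinfun_eqI, rule ell2_eqI) (simp add: scalar_apply Rep_ell2_zero)

lemma scalar_1: "scalar 1 = id_blinfun"
  by (rule blinfun_eqI, rule ell2_eqI) (simp add: scalar_apply)

lemma norm_scalar_apply: "norm (scalar c u) = norm c * norm u"
proof -
  have "((\<lambda>x. (norm (Rep_ell2 (scalar c u) x))\<^sup>2) has_sum (norm c)\<^sup>2 * (norm u)\<^sup>2) UNIV"
    using has_sum_cmult_right[OF norm_ell2_has_sum[of u], of "(norm c)\<^sup>2"]
    by (simp add: scalar_apply norm_mult power_mult_distrib)
  then have "(norm (scalar c u))\<^sup>2 = (norm c * norm u)\<^sup>2"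
    using has_sum_unique[OF norm_ell2_has_sum[of "scalar c u"]] by (simp add: power_mult_distrib)
  then show ?thesis by simp
qed

lemma norm_scalar_le: "norm (scalar c :: 'a ell2 \<Rightarrow>\<^sub>L 'a ell2) \<le> norm c"
  by (rule norm_blinfun_bound) (auto simp: norm_scalar_apply)

lemma Rep_delta: "Rep_ell2 (delta x) y = (if y = x then 1 else 0)"
  by (simp add: delta.rep_eq)

lemma norm_delta: "norm (delta x) = 1"
proof -
  have "((\<lambda>y. (norm (Rep_ell2 (delta x) y))\<^sup>2) has_sum 1) UNIV"
    by (rule has_sum_finite_neutralI[where B = "{x}"]) (auto simp: Rep_delta)
  then have "(norm (delta x))\<^sup>2 = 1"
    using has_sum_unique[OF norm_ell2_has_sum[of "delta x"]] by simp
  then show ?thesis by (metis norm_ge_zero power2_eq_1_iff le_minus_one_simps(3))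
qed

lemma norm_scalar: "norm (scalar c :: 'a ell2 \<Rightarrow>\<^sub>L 'a ell2) = norm c"
proof (rule antisym[OF norm_scalar_le])
  fix x :: 'a
  show "norm c \<le> norm (scalar c :: 'a ell2 \<Rightarrow>\<^sub>L 'a ell2)"
    using norm_blinfun[of "scalar c" "delta x"] by (simp add: norm_scalar_apply norm_delta)
qed

text \<open>
  The real inner product determines the complex one: its imaginary part is obtained by
  rotating the first argument by \<open>\<i>\<close>. So everything about the complex structure can be
  said with the real inner product and commutation with scalars.
\<close>

lemma cip_eq: "cip u v = Complex (u \<bullet> v) (scalar \<i> u \<bullet> v)"
proof -
  have s: "((\<lambda>x. Rep_ell2 u x \<bullet> Rep_ell2 v x) has_sum u \<bullet> v) UNIV" for u v :: "'a ell2"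
    unfolding inner_ell2.rep_eq by (intro has_sum_infsum ell2_inner_summable ell2_summable)
  have "((\<lambda>x. Complex (Rep_ell2 u x \<bullet> Rep_ell2 v x) (Rep_ell2 (scalar \<i> u) x \<bullet> Rep_ell2 v x))
      has_sum Complex (u \<bullet> v) (scalar \<i> u \<bullet> v)) UNIV"
    using has_sum_add[OF has_sum_of_real[OF s[of u v]]
        has_sum_cmult_right[OF has_sum_of_real[OF s[of "scalar \<i> u" v]], of \<i>]]
    by (simp add: complex_eq_iff Complex_eq)
  moreover have "Complex (Rep_ell2 u x \<bullet> Rep_ell2 v x) (Rep_ell2 (scalar \<i> u) x \<bullet> Rep_ell2 v x)
      = cnj (Rep_ell2 u x) * Rep_ell2 v x" for x
    by (simp add: complex_eq_iff scalar_apply inner_complex_def)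
  ultimately show ?thesis unfolding cip_def by (simp add: infsumI)
qed

lemma Re_cip: "Re (cip u v) = u \<bullet> v"
  by (simp add: cip_eq)

lemma cip_add_right: "cip u (v + w) = cip u v + cip u w"
  by (simp add: cip_eq inner_add_right complex_eq_iff)

lemma cip_delta_left: "cip (delta x) v = Rep_ell2 v x"
proof -
  have "((\<lambda>y. cnj (Rep_ell2 (delta x) y) * Rep_ell2 v y) has_sum Rep_ell2 v x) UNIV"
    by (rule has_sum_finite_neutralI[where B = "{x}"]) (auto simp: Rep_delta)
  then show ?thesis by (simp add: cip_def infsumI)
qed

lemma cip_delta_right: "cip v (delta x) = cnj (Rep_ell2 v x)"
proof -
  have "((\<lambda>y. cnj (Rep_ell2 v y) * Rep_ell2 (delta x) y) has_sum cnj (Rep_ell2 v x)) UNIV"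
    by (rule has_sum_finite_neutralI[where B = "{x}"]) (auto simp: Rep_delta)
  then show ?thesis by (simp add: cip_def infsumI)
qed

lemma inner_scalar: "scalar c u \<bullet> v = u \<bullet> scalar (cnj c) v"
  unfolding inner_ell2.rep_eq
  by (rule infsum_cong) (simp add: scalar_apply inner_complex_def algebra_simps)

lemma cip_scalar_left: "cip (scalar c u) v = cnj c * cip u v"
  unfolding cip_def scalar_apply
  by (simp add: mult.assoc infsum_cmult_right')

lemma ell2_finite_approx:
  assumes "e > 0"
  obtains F where "finite F" "norm (u - (\<Sum>x\<in>F. scalar (Rep_ell2 u x) (delta x))) < e"
proof -
  define s where "s F = (\<Sum>x\<in>F. (norm (Rep_ell2 u x))\<^sup>2)" for F
  have "(s \<longlongrightarrow> (norm u)\<^sup>2) (finite_subsets_at_top UNIV)"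
    using norm_ell2_has_sum[of u] unfolding has_sum_def s_def .
  then have "\<forall>\<^sub>F F in finite_subsets_at_top UNIV. s F > (norm u)\<^sup>2 - e\<^sup>2"
    by (rule order_tendstoD) (use assms in auto)
  moreover have "\<forall>\<^sub>F F in finite_subsets_at_top UNIV. finite F"
    by (rule eventually_finite_subsets_at_top_weakI) auto
  ultimately have "\<forall>\<^sub>F F in finite_subsets_at_top UNIV. finite F \<and> s F > (norm u)\<^sup>2 - e\<^sup>2"
    by (rule eventually_elim2) auto
  then obtain F where F: "finite F" "s F > (norm u)\<^sup>2 - e\<^sup>2"
    using eventually_happens' finite_subsets_at_top_neq_bot by blast
  define v where "v = (\<Sum>x\<in>F. scalar (Rep_ell2 u x) (delta x))"
  have v: "Rep_ell2 v y = (if y \<in> F then Rep_ell2 u y else 0)" for y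
    using F(1) by (simp add: v_def Rep_ell2_sum scalar_apply Rep_delta if_distrib[of "\<lambda>t. _ * t"]
        sum.delta cong: if_cong)
  have "((\<lambda>x. if x \<in> F then (norm (Rep_ell2 u x))\<^sup>2 else 0) has_sum s F) UNIV"
    by (rule has_sum_finite_neutralI[OF F(1)]) (auto simp: s_def)
  then have "((\<lambda>x. - (if x \<in> F then (norm (Rep_ell2 u x))\<^sup>2 else 0)) has_sum - s F) UNIV"
    by (simp only: has_sum_uminus minus_minus)
  from has_sum_add[OF norm_ell2_has_sum[of u] this]
  have "((\<lambda>x. (norm (Rep_ell2 (u - v) x))\<^sup>2) has_sum (norm u)\<^sup>2 + - s F) UNIV"
    by (rule back_subst[of "\<lambda>f. (f has_sum _) _"]) (auto simp: Rep_ell2_diff v)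
  then have "(norm (u - v))\<^sup>2 = (norm u)\<^sup>2 - s F"
    using has_sum_unique[OF norm_ell2_has_sum] by fastforce
  also have "\<dots> < e\<^sup>2" using F by simp
  finally have "norm (u - v) < e" using assms power_less_imp_less_base[of "norm (u - v)" 2 e] by simp
  then show ?thesis using that F(1) v_def by blast
qed

text \<open>
  Multiples of basis vectors span a dense subspace, so that a property which survives
  sums and norm limits need only be checked on them.
\<close>

lemma ell2_dense_induct [case_names delta add closed]:
  assumes "\<And>c x. P (scalar c (delta x))" "\<And>u v. P u \<Longrightarrow> P v \<Longrightarrow> P (u + v)"
    and "\<And>u. (\<And>e. e > 0 \<Longrightarrow> \<exists>v. P v \<and> norm (u - v) < e) \<Longrightarrow> P u"
  shows "P u"
proof (rule assms(3))
  fix e :: real assume "e > 0"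
  then obtain F where F: "finite F" "norm (u - (\<Sum>x\<in>F. scalar (Rep_ell2 u x) (delta x))) < e"
    by (rule ell2_finite_approx)
  have "P 0" using assms(1)[of 0] by (simp add: scalar_0)
  with F(1) have "P (\<Sum>x\<in>F. scalar (Rep_ell2 u x) (delta x))"
    by (induction F rule: finite_induct) (auto intro!: assms(1,2))
  then show "\<exists>v. P v \<and> norm (u - v) < e" using F(2) by blast
qed

section \<open>Invertible operators and polynomials in an operator\<close>

definition complex_linear :: "('a ell2 \<Rightarrow>\<^sub>L 'b ell2) \<Rightarrow> bool" where
  "complex_linear T \<longleftrightarrow> (\<forall>c u. T (scalar c u) = scalar c (T u))"

definition op_invertible :: "('a ell2 \<Rightarrow>\<^sub>L 'a ell2) \<Rightarrow> bool" where
  "op_invertible T \<longleftrightarrow> (\<exists>S. S o\<^sub>L T = id_blinfun \<and> T o\<^sub>L S = id_blinfun)"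

lemma spectrum_iff: "z \<in> spectrum T \<longleftrightarrow> \<not> op_invertible (T - scalar z)"
  by (simp add: spectrum_def op_invertible_def)

lemma op_invertibleI:
  fixes S T :: "'a ell2 \<Rightarrow>\<^sub>L 'a ell2"
  assumes "\<And>u. S (T u) = u" "\<And>u. T (S u) = u"
  shows "op_invertible T"
  unfolding op_invertible_def by (intro exI[of _ S] conjI blinfun_eqI) (use assms in auto)

lemma op_invertibleE:
  fixes T :: "'a ell2 \<Rightarrow>\<^sub>L 'a ell2"
  assumes "op_invertible T"
  obtains S :: "'a ell2 \<Rightarrow>\<^sub>L 'a ell2" where "\<And>u. S (T u) = u" "\<And>u. T (S u) = u"
  using assms unfolding op_invertible_def
  by (metis blinfun_apply_blinfun_compose blinfun_apply_id_blinfun id_apply)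

lemma op_invertible_compose:
  fixes A B :: "'a ell2 \<Rightarrow>\<^sub>L 'a ell2"
  assumes "op_invertible A" "op_invertible B"
  shows "op_invertible (A o\<^sub>L B)"
proof -
  obtain R :: "'a ell2 \<Rightarrow>\<^sub>L 'a ell2" where R: "\<And>u. R (A u) = u" "\<And>u. A (R u) = u"
    using assms(1) by (rule op_invertibleE) blast
  obtain S :: "'a ell2 \<Rightarrow>\<^sub>L 'a ell2" where S: "\<And>u. S (B u) = u" "\<And>u. B (S u) = u"
    using assms(2) by (rule op_invertibleE) blast
  show ?thesis by (rule op_invertibleI[of "S o\<^sub>L R"]) (simp_all add: R S)
qed

lemma op_invertible_scalar: "c \<noteq> 0 \<Longrightarrow> op_invertible (scalar c)"
  by (rule op_invertibleI[of "scalar (1 / c)"]) (simp_all add: scalar_mult scalar_1)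

lemma op_invertible_commuting_factor:
  fixes A B :: "'a ell2 \<Rightarrow>\<^sub>L 'a ell2"
  assumes "op_invertible (A o\<^sub>L B)" "\<And>u. A (B u) = B (A u)"
  shows "op_invertible A"
proof -
  obtain S :: "'a ell2 \<Rightarrow>\<^sub>L 'a ell2" where "\<And>u. S ((A o\<^sub>L B) u) = u" "\<And>u. (A o\<^sub>L B) (S u) = u"
    using assms(1) by (rule op_invertibleE) blast
  then have S: "\<And>u. S (A (B u)) = u" "\<And>u. A (B (S u)) = u"
    by simp_all
  have "B (S (A u)) = u" for u
  proof -
    \<comment> \<open>The left inverse \<open>SB\<close> and the right inverse \<open>BS\<close> agree.\<close>
    have "B (S (A u)) = S (A (B (B (S (A u)))))" by (simp add: S)
    also have "\<dots> = S (B (A (B (S (A u)))))" by (simp add: assms(2))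
    also have "\<dots> = u" by (simp add: S assms(2)[symmetric])
    finally show ?thesis .
  qed
  then show ?thesis by (intro op_invertibleI[of "B o\<^sub>L S"]) (auto simp: S)
qed

text \<open>The inverse is the Neumann series \<open>\<Sum>\<^sub>n Q\<^sup>n\<close>.\<close>

lemma op_invertible_id_minus:
  fixes Q :: "'a ell2 \<Rightarrow>\<^sub>L 'a ell2"
  assumes "norm Q < 1"
  shows "op_invertible (id_blinfun - Q)"
proof -
  define P where "P n = ((\<lambda>S. Q o\<^sub>L S) ^^ n) id_blinfun" for n
  have P: "P 0 = id_blinfun" "P (Suc n) = Q o\<^sub>L P n" for n
    by (simp_all add: P_def)
  have P': "P (Suc n) = P n o\<^sub>L Q" for n
  proof (rule blinfun_eqI)
    fix u :: "'a ell2"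
    have "Q (P n u) = P n (Q u)" by (induction n) (auto simp: P)
    then show "P (Suc n) u = (P n o\<^sub>L Q) u" by (simp add: P)
  qed
  have "norm (P n) \<le> norm Q ^ n" for n
  proof (induction n)
    case 0
    show ?case unfolding P by (rule norm_blinfun_bound) auto
  next
    case (Suc n)
    have "norm (P (Suc n)) \<le> norm Q * norm (P n)" unfolding P by (rule norm_blinfun_compose)
    also have "\<dots> \<le> norm Q * norm Q ^ n" by (intro mult_left_mono Suc) auto
    finally show ?case by simp
  qed
  then have "summable (\<lambda>n. norm (P n))"
    using assms by (intro summable_comparison_test'[OF summable_geometric[of "norm Q"]]) auto
  then have sP: "summable P" by (rule summable_norm_cancel)
  define S where "S = suminf P"
  have shift: "suminf (\<lambda>n. P (Suc n)) = S - id_blinfun"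
    using suminf_split_head[OF sP] by (simp add: S_def P)
  have "Q o\<^sub>L S = S - id_blinfun"
    using bounded_linear.suminf[OF bounded_bilinear.bounded_linear_right[OF
          bounded_bilinear_blinfun_compose, of Q] sP] shift by (simp add: S_def P)
  moreover have "S o\<^sub>L Q = S - id_blinfun"
    using bounded_linear.suminf[OF bounded_bilinear.bounded_linear_left[OF
          bounded_bilinear_blinfun_compose, of Q] sP] shift by (simp add: S_def P')
  ultimately have "Q (S u) = S u - u" "S (Q u) = S u - u" for u
    by (metis blinfun_apply_blinfun_compose blinfun.diff_left blinfun_apply_id_blinfun id_apply)+
  then show ?thesis
    by (intro op_invertibleI[of S]) (simp_all add: blinfun.bilinear_simps)
qed

lemma poly_op_eq:
  assumes "degree p \<le> n"
  shows "poly_op p T = (\<Sum>i\<le>n. scalar (coeff p i) o\<^sub>L ((\<lambda>S. T o\<^sub>L S) ^^ i) id_blinfun)"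
  unfolding poly_op_def
  by (rule sum.mono_neutral_left) (use assms in \<open>auto simp: coeff_eq_0 scalar_0\<close>)

lemma poly_op_0: "poly_op 0 T = 0"
  by (simp add: poly_op_def scalar_0)

lemma poly_op_pCons:
  fixes T :: "'a ell2 \<Rightarrow>\<^sub>L 'a ell2"
  assumes "complex_linear T"
  shows "poly_op (pCons a p) T u = scalar a u + T (poly_op p T u)"
proof -
  have "poly_op (pCons a p) T = (\<Sum>i\<le>Suc (degree p). scalar (coeff (pCons a p) i) o\<^sub>L ((\<lambda>S. T o\<^sub>L S) ^^ i) id_blinfun)"
    by (rule poly_op_eq) (simp add: degree_pCons_le)
  also have "\<dots> u = scalar a u + (\<Sum>i\<le>degree p. scalar (coeff p i) (T ((((\<lambda>S. T o\<^sub>L S) ^^ i) id_blinfun) u)))"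
    by (subst sum.atMost_Suc_shift) (simp add: blinfun.bilinear_simps blinfun.sum_left)
  also have "(\<Sum>i\<le>degree p. scalar (coeff p i) (T ((((\<lambda>S. T o\<^sub>L S) ^^ i) id_blinfun) u))) = T (poly_op p T u)"
    using assms by (simp add: poly_op_def blinfun.sum_left blinfun.sum_right complex_linear_def)
  finally show ?thesis .
qed

lemma poly_op_const:
  fixes T :: "'a ell2 \<Rightarrow>\<^sub>L 'a ell2"
  assumes "complex_linear T"
  shows "poly_op [:a:] T = scalar a"
  by (rule blinfun_eqI) (simp add: poly_op_pCons[OF assms] poly_op_0)

lemma poly_op_linear:
  fixes T :: "'a ell2 \<Rightarrow>\<^sub>L 'a ell2"
  assumes "complex_linear T"
  shows "poly_op [:- z, 1:] T = T - scalar z"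
proof (rule blinfun_eqI)
  fix u :: "'a ell2"
  have "scalar (- z) u = - scalar z u"
    by (rule ell2_eqI) (simp add: scalar_apply uminus_ell2.rep_eq)
  then show "poly_op [:- z, 1:] T u = (T - scalar z) u"
    by (simp add: poly_op_pCons[OF assms] poly_op_0 blinfun.bilinear_simps scalar_1)
qed

lemma poly_op_commute:
  fixes T :: "'a ell2 \<Rightarrow>\<^sub>L 'a ell2"
  assumes "complex_linear T"
  shows "poly_op p T (T u) = T (poly_op p T u)"
  by (induction p)
    (use assms in \<open>auto simp: poly_op_pCons poly_op_0 blinfun.bilinear_simps complex_linear_def\<close>)

lemma poly_op_add:
  fixes T :: "'a ell2 \<Rightarrow>\<^sub>L 'a ell2"
  assumes "complex_linear T"
  shows "poly_op (p + q) T = poly_op p T + poly_op q T"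
proof (rule blinfun_eqI)
  fix u :: "'a ell2"
  show "poly_op (p + q) T u = (poly_op p T + poly_op q T) u"
  proof (induction p q rule: poly_induct2)
    case 0
    then show ?case by (simp add: poly_op_0)
  next
    case (pCons a p b q)
    then show ?case
      by (simp add: poly_op_pCons[OF assms] blinfun.bilinear_simps scalar_add algebra_simps)
  qed
qed

lemma poly_op_smult:
  fixes T :: "'a ell2 \<Rightarrow>\<^sub>L 'a ell2"
  assumes "complex_linear T"
  shows "poly_op (smult c p) T u = scalar c (poly_op p T u)"
  by (induction p)
    (use assms in \<open>auto simp: poly_op_pCons poly_op_0 blinfun.bilinear_simps complex_linear_def
      scalar_mult\<close>)

lemma poly_op_diff:
  fixes T :: "'a ell2 \<Rightarrow>\<^sub>L 'a ell2"
  assumes "complex_linear T"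
  shows "poly_op (p - q) T = poly_op p T - poly_op q T"
  using poly_op_add[OF assms, of "p - q" q] by (simp add: algebra_simps)

lemma poly_op_mult:
  fixes T :: "'a ell2 \<Rightarrow>\<^sub>L 'a ell2"
  assumes "complex_linear T"
  shows "poly_op (p * q) T u = poly_op p T (poly_op q T u)"
  by (induction p)
    (auto simp: poly_op_pCons[OF assms] poly_op_0 poly_op_add[OF assms] poly_op_smult[OF assms]
      blinfun.bilinear_simps scalar_0)

section \<open>Functions of a self-adjoint operator\<close>

lemma self_adjoint_iff:
  fixes T :: "'a ell2 \<Rightarrow>\<^sub>L 'a ell2"
  shows "self_adjoint T \<longleftrightarrow> (\<forall>u v. T u \<bullet> v = u \<bullet> T v) \<and> complex_linear T"
proof
  assume T: "self_adjoint T"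
  then have sym: "T u \<bullet> v = u \<bullet> T v" for u v
    by (metis Re_cip self_adjoint_def)
  have "T (scalar c u) = scalar c (T u)" for c u
  proof -
    have "T (scalar c u) \<bullet> v = scalar c (T u) \<bullet> v" for v
    proof -
      have "cip (T (scalar c u)) v = cip (scalar c (T u)) v"
        using T by (simp add: self_adjoint_def cip_scalar_left)
      then show ?thesis by (metis Re_cip)
    qed
    from this[of "T (scalar c u) - scalar c (T u)"]
    have "(T (scalar c u) - scalar c (T u)) \<bullet> (T (scalar c u) - scalar c (T u)) = 0"
      by (simp only: inner_diff_left)
    then show ?thesis by simp
  qed
  then show "(\<forall>u v. T u \<bullet> v = u \<bullet> T v) \<and> complex_linear T"
    using sym by (simp add: complex_linear_def)
next
  assume T: "(\<forall>u v. T u \<bullet> v = u \<bullet> T v) \<and> complex_linear T"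
  then show "self_adjoint T"
    unfolding self_adjoint_def cip_eq complex_linear_def by metis
qed

lemma poly_op_adjoint:
  fixes T :: "'a ell2 \<Rightarrow>\<^sub>L 'a ell2"
  assumes "self_adjoint T"
  shows "poly_op p T u \<bullet> v = u \<bullet> poly_op (map_poly cnj p) T v"
proof -
  have lin: "complex_linear T" and sym: "\<And>u v. T u \<bullet> v = u \<bullet> T v"
    using assms by (auto simp: self_adjoint_iff)
  show ?thesis
    by (induction p arbitrary: u v)
      (simp_all add: poly_op_pCons[OF lin] poly_op_0 map_poly_pCons inner_add_left inner_add_right
        inner_scalar sym poly_op_commute[OF lin])
qed

text \<open>
  The polynomial splits into linear factors, and each of them gives an invertible
  operator \<open>T - z\<close>.
\<close>

lemma poly_op_invertible:
  assumes T: "complex_linear T" and "q \<noteq> 0" "\<And>z. poly q z = 0 \<Longrightarrow> z \<notin> spectrum T"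
  shows "op_invertible (poly_op q T)"
  using assms(2,3)
proof (induction "degree q" arbitrary: q)
  case 0
  then obtain a where a: "q = [:a:]" using degree_eq_zeroE[of q] by auto
  then have "a \<noteq> 0" using 0(2) by auto
  then show ?case unfolding a poly_op_const[OF T] by (rule op_invertible_scalar)
next
  case (Suc n)
  then have "\<not> constant (poly q)" using constant_degree[of q] by simp
  then obtain z where z: "poly q z = 0" using fundamental_theorem_of_algebra by blast
  then obtain r where r: "q = [:- z, 1:] * r" using poly_eq_0_iff_dvd by (metis dvdE)
  have "degree q = Suc (degree r)"
    using r Suc.prems(1) degree_mult_eq[of "[:- z, 1:]" r] by (cases "r = 0") auto
  then have "op_invertible (poly_op r T)"
    using Suc r by (intro Suc.hyps(1)) auto
  moreover have "op_invertible (T - scalar z)"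
    using Suc.prems(2)[OF z] by (simp add: spectrum_iff)
  moreover have "poly_op q T = (T - scalar z) o\<^sub>L poly_op r T"
    unfolding r by (rule blinfun_eqI) (simp only: poly_op_mult[OF T] poly_op_linear[OF T] blinfun_apply_blinfun_compose)
  ultimately show ?case by (simp add: op_invertible_compose)
qed

text \<open>
  For \<open>z = a + ib\<close> and \<open>B = T - a\<close> one has \<open>(T - z)(T - cnj z) = B\<^sup>2 + b\<^sup>2\<close>. If \<open>b \<noteq> 0\<close>
  then a multiple of this positive operator is at distance less than \<open>1\<close> from the
  identity, so that it is invertible by a Neumann series.
\<close>

lemma spectrum_self_adjoint_real:
  fixes T :: "'a ell2 \<Rightarrow>\<^sub>L 'a ell2"
  assumes "self_adjoint T" "z \<in> spectrum T"
  shows "Im z = 0"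
proof (rule ccontr)
  assume b: "Im z \<noteq> 0"
  have lin: "complex_linear T" and sym: "\<And>u v. T u \<bullet> v = u \<bullet> T v"
    using assms by (auto simp: self_adjoint_iff)
  define B where "B = T - Re z *\<^sub>R id_blinfun"
  \<comment> \<open>\<open>K\<close> bounds the norm of \<open>B\<^sup>2 + b\<^sup>2\<close>, and \<open>1 - c = b\<^sup>2/K\<close>.\<close>
  define K where "K = (norm B)\<^sup>2 + (Im z)\<^sup>2"
  define c where "c = (norm B)\<^sup>2 / K"
  have K: "K > 0" using b by (simp add: K_def add_nonneg_pos)
  have c: "0 \<le> c" "c < 1" using K b by (auto simp: c_def K_def)
  have symB: "B u \<bullet> v = u \<bullet> B v" for u v
    by (simp add: B_def blinfun.bilinear_simps inner_diff_left inner_diff_right sym)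
  define Q where "Q = c *\<^sub>R id_blinfun - (1 / K) *\<^sub>R (B o\<^sub>L B)"
  have "norm (Q u) \<le> c * norm u" for u
  proof -
    have Qu: "Q u = c *\<^sub>R u - (1 / K) *\<^sub>R B (B u)"
      by (simp add: Q_def blinfun.bilinear_simps)
    have "Q u \<bullet> Q u = c * c * (u \<bullet> u) - 2 * c / K * (u \<bullet> B (B u)) + (B (B u) \<bullet> B (B u)) / (K * K)"
      unfolding Qu by (simp add: inner_diff_left inner_diff_right inner_commute)
    then have "(norm (Q u))\<^sup>2 = c\<^sup>2 * (norm u)\<^sup>2 - 2 * c / K * (norm (B u))\<^sup>2 + (norm (B (B u)))\<^sup>2 / K\<^sup>2"
      unfolding power2_norm_eq_inner by (simp add: symB[symmetric] power2_eq_square)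
    also have "(norm (B (B u)))\<^sup>2 \<le> (norm B * norm (B u))\<^sup>2"
      by (intro power_mono norm_blinfun) auto
    also have "(norm B * norm (B u))\<^sup>2 = c * K * (norm (B u))\<^sup>2"
      using K by (simp add: c_def power_mult_distrib)
    also have "c\<^sup>2 * (norm u)\<^sup>2 - 2 * c / K * (norm (B u))\<^sup>2 + c * K * (norm (B u))\<^sup>2 / K\<^sup>2
        = c\<^sup>2 * (norm u)\<^sup>2 - c / K * (norm (B u))\<^sup>2"
      using K by (simp add: field_simps power2_eq_square)
    also have "\<dots> \<le> c\<^sup>2 * (norm u)\<^sup>2" using K c by simp
    finally have "(norm (Q u))\<^sup>2 \<le> (c * norm u)\<^sup>2"
      using K by (simp add: power_mult_distrib divide_right_mono)
    then show ?thesis using c by (simp add: power2_le_iff_abs_le)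
  qed
  then have "norm Q \<le> c" using c by (intro norm_blinfun_bound) (auto simp: mult.commute)
  then have "op_invertible (scalar (of_real K) o\<^sub>L (id_blinfun - Q))"
    using c K by (intro op_invertible_compose op_invertible_scalar op_invertible_id_minus) auto
  moreover have "scalar (of_real K) o\<^sub>L (id_blinfun - Q) = (T - scalar z) o\<^sub>L (T - scalar (cnj z))"
  proof (rule blinfun_eqI)
    fix u :: "'a ell2"
    have "scalar z (scalar (cnj z) u) = scalar (of_real ((norm z)\<^sup>2)) u"
      by (simp only: scalar_mult complex_norm_square)
    then have "scalar z (scalar (cnj z) u) = (norm z)\<^sup>2 *\<^sub>R u"
      by (simp only: scalar_of_real)
    moreover have "scalar z u + scalar (cnj z) u = (2 * Re z) *\<^sub>R u"
      by (simp add: scalar_of_real[symmetric] scalar_mult scalar_add[symmetric]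
          blinfun.add_left[symmetric] complex_add_cnj)
    moreover have "K *\<^sub>R (id_blinfun - Q) u = (Im z)\<^sup>2 *\<^sub>R u + B (B u)"
    proof -
      have "K * c = (norm B)\<^sup>2" using K by (simp add: c_def)
      then have Kc: "K * (1 - c) = (Im z)\<^sup>2" by (simp add: right_diff_distrib) (simp add: K_def)
      have "(id_blinfun - Q) u = (1 - c) *\<^sub>R u + (1 / K) *\<^sub>R B (B u)"
        by (simp add: Q_def blinfun.bilinear_simps algebra_simps)
      then have "K *\<^sub>R (id_blinfun - Q) u = (K * (1 - c)) *\<^sub>R u + B (B u)"
        using K by (simp add: scaleR_add_right)
      then show ?thesis by (simp only: Kc)
    qed
    moreover have "T (scalar (cnj z) u) = scalar (cnj z) (T u)"
      using lin by (simp add: complex_linear_def)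
    moreover have "scalar z (T u) + scalar (cnj z) (T u) = (2 * Re z) *\<^sub>R T u"
      by (simp add: scalar_of_real[symmetric] scalar_add[symmetric]
          blinfun.add_left[symmetric] complex_add_cnj)
    moreover have "norm z * norm z = Im z * Im z + Re z * Re z"
      using cmod_power2[of z] by (simp add: power2_eq_square)
    ultimately show "(scalar (of_real K) o\<^sub>L (id_blinfun - Q)) u = ((T - scalar z) o\<^sub>L (T - scalar (cnj z))) u"
      by (simp add: scalar_of_real B_def blinfun.bilinear_simps algebra_simps
          power2_eq_square scaleR_2 flip: scaleR_add_left)
  qed
  ultimately have "op_invertible ((T - scalar z) o\<^sub>L (T - scalar (cnj z)))" by simp
  then have "op_invertible (T - scalar z)"
    by (rule op_invertible_commuting_factor)
      (use lin in \<open>simp add: blinfun.bilinear_simps complex_linear_def scalar_mult mult.commute\<close>)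
  then show False using assms(2) by (simp add: spectrum_iff)
qed

text \<open>
  For a polynomial \<open>P = p(T)\<close> with norm \<open>N\<close>, the operator \<open>P\<^sup>*P - N\<^sup>2\<close> is not bounded
  below, because it is small on vectors on which \<open>P\<close> nearly attains its norm. It is the
  polynomial \<open>cnj p p - N\<^sup>2\<close> of \<open>T\<close>, so some root of this polynomial is in the spectrum.
  That root \<open>z\<close> is real, whence \<open>\<bar>p(z)\<bar>\<^sup>2 = N\<^sup>2\<close>.
\<close>

theorem norm_poly_op_attained:
  fixes T :: "'a ell2 \<Rightarrow>\<^sub>L 'a ell2"
  assumes T: "self_adjoint T"
  shows "\<exists>z\<in>spectrum T. norm (poly_op p T) = norm (poly p z)"
proof -
  have lin: "complex_linear T" using T by (simp add: self_adjoint_iff)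
  have nonconst: "\<exists>z\<in>spectrum T. norm (poly_op p T) = norm (poly p z)"
    if ne: "map_poly cnj p * p \<noteq> [:of_real ((norm (poly_op p T))\<^sup>2):]" for p
  proof -
    define N where "N = norm (poly_op p T)"
    define q where "q = map_poly cnj p * p - [:of_real (N\<^sup>2):]"
    define P where "P = poly_op p T"
    define P' where "P' = poly_op (map_poly cnj p) T"
    have q: "q \<noteq> 0" using ne by (auto simp: q_def N_def)
    have qT: "poly_op q T u = P' (P u) - N\<^sup>2 *\<^sub>R u" for u
      by (simp add: q_def poly_op_diff[OF lin] poly_op_const[OF lin] poly_op_mult[OF lin]
          blinfun.bilinear_simps P_def P'_def scalar_of_real del: of_real_power)
    have adj: "P u \<bullet> v = u \<bullet> P' v" for u v
      unfolding P_def P'_def by (rule poly_op_adjoint[OF T])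
    have PN: "norm (P u) \<le> N * norm u" for u
      unfolding P_def N_def by (rule norm_blinfun)
    have P'N: "norm (P' v) \<le> N * norm v" for v
    proof -
      have "norm (P' v) * norm (P' v) = P (P' v) \<bullet> v"
        by (simp add: adj power2_norm_eq_inner[symmetric] power2_eq_square)
      also have "\<dots> \<le> norm (P (P' v)) * norm v" by (rule norm_cauchy_schwarz)
      also have "\<dots> \<le> N * norm (P' v) * norm v" by (intro mult_right_mono PN) auto
      finally have "norm (P' v) * norm (P' v) \<le> (N * norm v) * norm (P' v)" by (simp add: ac_simps)
      moreover have "N * norm v \<ge> 0" by (simp add: N_def)
      ultimately show ?thesis
        by (cases "norm (P' v) = 0") (auto simp: mult_le_cancel_right)
    qed
    have "\<not> op_invertible (poly_op q T)"
    proof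
      assume "op_invertible (poly_op q T)"
      then obtain S :: "'a ell2 \<Rightarrow>\<^sub>L 'a ell2" where S: "\<And>u. S (poly_op q T u) = u" by (metis op_invertibleE)
      define C where "C = (norm S)\<^sup>2 * N\<^sup>2 + 1"
      have C: "C > 0" by (simp add: C_def add_nonneg_pos)
      have bd: "(norm u)\<^sup>2 \<le> C * (N\<^sup>2 * (norm u)\<^sup>2 - (norm (P u))\<^sup>2)" for u
      proof -
        have pos: "(norm (P u))\<^sup>2 \<le> N\<^sup>2 * (norm u)\<^sup>2"
          using power_mono[OF PN, of u 2] by (simp add: power_mult_distrib)
        have "(norm (poly_op q T u))\<^sup>2 = (norm (P' (P u)))\<^sup>2 - 2 * N\<^sup>2 * (P' (P u) \<bullet> u) + N\<^sup>2 * N\<^sup>2 * (norm u)\<^sup>2"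
          unfolding qT by (simp add: power2_norm_eq_inner inner_diff_left inner_diff_right inner_commute)
        also have "P' (P u) \<bullet> u = (norm (P u))\<^sup>2"
          using adj[of u "P u"] by (simp add: power2_norm_eq_inner inner_commute)
        also have "(norm (P' (P u)))\<^sup>2 \<le> N\<^sup>2 * (norm (P u))\<^sup>2"
          using power_mono[OF P'N, of "P u" 2] by (simp add: power_mult_distrib)
        finally have "(norm (poly_op q T u))\<^sup>2 \<le> N\<^sup>2 * (N\<^sup>2 * (norm u)\<^sup>2 - (norm (P u))\<^sup>2)"
          by (simp add: algebra_simps)
        moreover have "(norm u)\<^sup>2 \<le> (norm S)\<^sup>2 * (norm (poly_op q T u))\<^sup>2"
          using power_mono[OF norm_blinfun[of S "poly_op q T u"], of 2] S by (simp add: power_mult_distrib)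
        ultimately have "(norm u)\<^sup>2 \<le> (norm S)\<^sup>2 * (N\<^sup>2 * (N\<^sup>2 * (norm u)\<^sup>2 - (norm (P u))\<^sup>2))"
          by (meson mult_left_mono order_trans zero_le_power2)
        also have "\<dots> \<le> C * (N\<^sup>2 * (norm u)\<^sup>2 - (norm (P u))\<^sup>2)"
          using pos by (simp add: C_def algebra_simps)
        finally show ?thesis .
      qed
      have N2: "N\<^sup>2 - 1 / C \<ge> 0"
      proof -
        have "1 \<le> C * (N\<^sup>2 - (norm (P (delta undefined)))\<^sup>2)"
          using bd[of "delta undefined"] by (simp add: norm_delta)
        also have "\<dots> \<le> C * N\<^sup>2" using C by (intro mult_left_mono) auto
        finally show ?thesis using C by (simp add: field_simps)
      qed
      have "norm (P u) \<le> sqrt (N\<^sup>2 - 1 / C) * norm u" for u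
      proof -
        have "(norm (P u))\<^sup>2 \<le> (N\<^sup>2 - 1 / C) * (norm u)\<^sup>2" using bd[of u] C by (simp add: field_simps)
        also have "\<dots> = (sqrt (N\<^sup>2 - 1 / C) * norm u)\<^sup>2" using N2 by (simp add: power_mult_distrib)
        finally show ?thesis using N2 by (simp add: power2_le_iff_abs_le)
      qed
      then have "N \<le> sqrt (N\<^sup>2 - 1 / C)"
        unfolding N_def P_def[symmetric] using N2 by (intro norm_blinfun_bound) (auto simp: mult.commute N_def P_def)
      then have "N\<^sup>2 \<le> N\<^sup>2 - 1 / C"
        using N2 power_mono[of N "sqrt (N\<^sup>2 - 1 / C)" 2] by (simp add: N_def)
      then show False using C by simp
    qed
    then obtain z where z: "poly q z = 0" "z \<in> spectrum T"
      using poly_op_invertible[OF lin q] by blast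
    have "cnj z = z" using spectrum_self_adjoint_real[OF T z(2)] by (simp add: complex_eq_iff)
    then have "cnj (poly p z) * poly p z = of_real (N\<^sup>2)" using z(1) by (simp add: q_def)
    then have "complex_of_real ((norm (poly p z))\<^sup>2) = of_real (N\<^sup>2)"
      by (simp only: complex_norm_square mult.commute)
    then have "(norm (poly p z))\<^sup>2 = N\<^sup>2" by (simp only: of_real_eq_iff)
    then have "norm (poly p z) = N" by (simp add: N_def)
    with z(2) show ?thesis by (intro bexI[of _ z]) (simp_all add: N_def)
  qed
  show ?thesis
  proof (cases "map_poly cnj p * p = [:of_real ((norm (poly_op p T))\<^sup>2):]")
    case True
    \<comment> \<open>Then \<open>p\<close> is constant, and any point of the spectrum will do.\<close>
    have "degree (map_poly cnj p) = degree p" by (rule degree_map_poly) simp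
    then have "degree p = 0"
      using True degree_mult_eq[of "map_poly cnj p" p] by (cases "p = 0") (auto simp: map_poly_eq_0_iff)
    then obtain a where a: "p = [:a:]" by (rule degree_eq_zeroE)
    have "map_poly cnj [:0, 1:] * [:0, 1:] \<noteq> [:of_real ((norm (poly_op [:0, 1:] T))\<^sup>2):]"
      by (simp add: map_poly_pCons)
    then obtain z where "z \<in> spectrum T" using nonconst by blast
    then show ?thesis using a by (auto simp: poly_op_const[OF lin] norm_scalar)
  next
    case False
    then show ?thesis by (rule nonconst)
  qed
qed

lemma spectrum_norm_le:
  assumes "self_adjoint T" "z \<in> spectrum T"
  shows "norm z \<le> norm T"
proof (rule ccontr)
  assume z: "\<not> norm z \<le> norm T"
  then have z0: "z \<noteq> 0" by auto
  define Q where "Q = scalar (1 / z) o\<^sub>L T"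
  have "norm Q \<le> norm T / norm z"
    unfolding Q_def using norm_blinfun_compose[of "scalar (1 / z)" T] by (simp add: norm_scalar norm_divide)
  also have "\<dots> < 1" using z z0 by simp
  finally have "op_invertible (scalar (- z) o\<^sub>L (id_blinfun - Q))"
    using z0 by (intro op_invertible_compose op_invertible_scalar op_invertible_id_minus) auto
  moreover have "scalar (- z) o\<^sub>L (id_blinfun - Q) = T - scalar z"
    by (rule blinfun_eqI, rule ell2_eqI)
      (use z0 in \<open>simp add: Q_def blinfun.bilinear_simps Rep_ell2_diff scalar_apply\<close>)
  ultimately show False using assms(2) by (simp add: spectrum_iff)
qed

text \<open>
  If polynomials of \<open>S\<close> are dominated in norm by those of \<open>T\<close>, then \<open>S\<close> has the smaller
  spectrum: for real \<open>a\<close> outside the spectrum of \<open>T\<close>, the polynomial \<open>1 - (x - a)\<^sup>2/K\<close>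
  with large \<open>K\<close> has values in \<open>[0, 1)\<close> on that spectrum, so it has norm less than \<open>1\<close> at
  \<open>T\<close>, hence at \<open>S\<close>, and \<open>(S - a)\<^sup>2\<close> is invertible by a Neumann series.
\<close>

lemma spectrum_mono:
  assumes T: "self_adjoint T" and S: "self_adjoint S"
    and le: "\<And>p. norm (poly_op p S) \<le> norm (poly_op p T)"
  shows "spectrum S \<subseteq> spectrum T"
proof
  fix z assume z: "z \<in> spectrum S"
  have linT: "complex_linear T" and linS: "complex_linear S"
    using T S by (auto simp: self_adjoint_iff)
  have "z = of_real (Re z)" using spectrum_self_adjoint_real[OF S z] by (simp add: complex_eq_iff)
  then obtain a where a: "z = of_real a" by blast
  show "z \<in> spectrum T"
  proof (rule ccontr)
    assume zT: "z \<notin> spectrum T"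
    define K where "K = (norm T + \<bar>a\<bar>)\<^sup>2 + 1"
    have K: "K > 0" by (simp add: K_def add_nonneg_pos)
    define q where "q = 1 - smult (of_real (1 / K)) ([:- z, 1:] * [:- z, 1:])"
    obtain t where t: "t \<in> spectrum T" "norm (poly_op q T) = norm (poly q t)"
      using norm_poly_op_attained[OF T] by blast
    have "t = of_real (Re t)" using spectrum_self_adjoint_real[OF T t(1)] by (simp add: complex_eq_iff)
    then obtain s where s: "t = of_real s" by blast
    have "s \<noteq> a" using s a t(1) zT by auto
    have "\<bar>s\<bar> \<le> norm T" using spectrum_norm_le[OF T t(1)] by (simp add: s)
    then have "\<bar>s - a\<bar> \<le> norm T + \<bar>a\<bar>" by linarith
    then have "\<bar>s - a\<bar>\<^sup>2 \<le> (norm T + \<bar>a\<bar>)\<^sup>2" by (rule power_mono) simp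
    then have "(s - a)\<^sup>2 < K" by (simp add: K_def)
    moreover have "(s - a)\<^sup>2 > 0" using \<open>s \<noteq> a\<close> by simp
    moreover have "poly q t = of_real (1 - (s - a)\<^sup>2 / K)"
      using K by (simp add: q_def s a power2_eq_square field_simps)
    ultimately have "norm (poly q t) < 1"
      using K by (simp only: norm_of_real) (simp add: abs_less_iff pos_divide_less_eq)
    then have "norm (poly_op q S) < 1" using le[of q] t(2) by linarith
    then have inv: "op_invertible (id_blinfun - poly_op q S)" by (rule op_invertible_id_minus)
    have q1: "1 - q = smult (of_real (1 / K)) ([:- z, 1:] * [:- z, 1:])" by (simp add: q_def)
    have "id_blinfun - poly_op q S = poly_op (1 - q) S"
      by (simp add: poly_op_diff[OF linS] one_pCons poly_op_const[OF linS] scalar_1)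
    also have "\<dots> = (S - scalar z) o\<^sub>L (scalar (of_real (1 / K)) o\<^sub>L (S - scalar z))"
      unfolding q1 using linS
      by (intro blinfun_eqI) (simp add: poly_op_smult[OF linS] poly_op_mult[OF linS] poly_op_linear[OF linS]
          blinfun.bilinear_simps complex_linear_def scalar_mult mult.commute del: mult_pCons_left mult_pCons_right)
    finally have "op_invertible ((S - scalar z) o\<^sub>L (scalar (of_real (1 / K)) o\<^sub>L (S - scalar z)))"
      using inv by simp
    then have "op_invertible (S - scalar z)"
      by (rule op_invertible_commuting_factor)
        (use linS in \<open>simp add: blinfun.bilinear_simps complex_linear_def scalar_mult mult.commute\<close>)
    then show False using z by (simp add: spectrum_iff)
  qed
qed

lemma poly_op_uniform_close:
  assumes T: "self_adjoint T"
    and p: "uniform_limit (spectrum T) (\<lambda>n. poly (p n)) f sequentially"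
    and q: "uniform_limit (spectrum T) (\<lambda>n. poly (q n)) f sequentially"
    and "e > 0"
  shows "\<exists>N. \<forall>m\<ge>N. \<forall>n\<ge>N. norm (poly_op (p m) T - poly_op (q n) T) < e"
proof -
  have lin: "complex_linear T" using T by (simp add: self_adjoint_iff)
  obtain N1 where N1: "\<And>n z. n \<ge> N1 \<Longrightarrow> z \<in> spectrum T \<Longrightarrow> dist (poly (p n) z) (f z) < e/2"
    using uniform_limitD[OF p, of "e/2"] \<open>e > 0\<close> by (auto simp: eventually_sequentially)
  obtain N2 where N2: "\<And>n z. n \<ge> N2 \<Longrightarrow> z \<in> spectrum T \<Longrightarrow> dist (poly (q n) z) (f z) < e/2"
    using uniform_limitD[OF q, of "e/2"] \<open>e > 0\<close> by (auto simp: eventually_sequentially)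
  have "norm (poly_op (p m) T - poly_op (q n) T) < e" if mn: "m \<ge> N1" "n \<ge> N2" for m n
  proof -
    obtain z where z: "z \<in> spectrum T" "norm (poly_op (p m - q n) T) = norm (poly (p m - q n) z)"
      using norm_poly_op_attained[OF T] by blast
    have "norm (poly (p m - q n) z) < e"
      using N1[OF mn(1) z(1)] N2[OF mn(2) z(1)] dist_triangle_half_l[of "poly (p m) z" "f z" e "poly (q n) z"]
      by (simp add: dist_norm dist_commute norm_minus_commute)
    then show ?thesis using z(2) by (simp add: poly_op_diff[OF lin])
  qed
  then show ?thesis by (intro exI[of _ "max N1 N2"]) auto
qed

text \<open>
  Since the norm of \<open>p(T)\<close> is at most the supremum of \<open>\<bar>p\<bar>\<close> on the spectrum, uniform
  convergence there forces convergence of the operators, and to a limit that does not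
  depend on the polynomials. So the description in the definition of the functional
  calculus is met by exactly one operator.
\<close>

lemma fun_calc_tendsto:
  assumes T: "self_adjoint T"
    and p: "uniform_limit (spectrum T) (\<lambda>n. poly (p n)) f sequentially"
  shows "(\<lambda>n. poly_op (p n) T) \<longlonglongrightarrow> fun_calc f T"
proof -
  have "Cauchy (\<lambda>n. poly_op (p n) T)"
    unfolding Cauchy_iff using poly_op_uniform_close[OF T p p] by blast
  then obtain S where S: "(\<lambda>n. poly_op (p n) T) \<longlonglongrightarrow> S"
    using Cauchy_convergent_iff convergent_def by blast
  have "S' = S" if q: "uniform_limit (spectrum T) (\<lambda>n. poly (q n)) f sequentially"
    and S': "(\<lambda>n. poly_op (q n) T) \<longlonglongrightarrow> S'" for q S'
  proof -
    have "(\<lambda>n. poly_op (q n) T - poly_op (p n) T) \<longlonglongrightarrow> 0"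
    proof (rule LIMSEQ_I)
      fix e :: real assume "e > 0"
      from poly_op_uniform_close[OF T q p this]
      show "\<exists>N. \<forall>n\<ge>N. norm (poly_op (q n) T - poly_op (p n) T - 0) < e" by fastforce
    qed
    with tendsto_diff[OF S' S] have "S' - S = 0" using LIMSEQ_unique by blast
    then show ?thesis by simp
  qed
  then have "fun_calc f T = S"
    unfolding fun_calc_def using p S by (intro the_equality) blast+
  then show ?thesis using S by simp
qed

lemma real_polynomial_function_poly:
  assumes "real_polynomial_function (h :: real \<Rightarrow> real)"
  shows "\<exists>p :: complex poly. \<forall>t. poly p (of_real t) = of_real (h t)"
proof -
  obtain a n where "h = (\<lambda>x. \<Sum>i\<le>n. a i * x ^ i)"
    using assms real_polynomial_function_iff_sum by blast
  then have "\<forall>t. poly (\<Sum>i\<le>n. monom (of_real (a i)) i) (of_real t) = complex_of_real (h t)"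
    by (simp add: poly_sum poly_monom)
  then show ?thesis by blast
qed

text \<open>
  The spectrum is a subset of the interval \<open>[- norm T, norm T]\<close>, on which Weierstrass
  approximation applies to the real and imaginary parts of a smooth extension.
\<close>

lemma smooth_on_spectrum_approx:
  assumes T: "self_adjoint T" and f: "smooth_on_spectrum f (spectrum T)"
  obtains p where "uniform_limit (spectrum T) (\<lambda>n. poly (p n)) f sequentially"
proof -
  obtain D :: "nat \<Rightarrow> real \<Rightarrow> complex" where
    D: "\<And>k t. (D k has_vector_derivative D (Suc k) t) (at t)"
      "\<And>t. complex_of_real t \<in> spectrum T \<Longrightarrow> f (complex_of_real t) = D 0 t"
    using f unfolding smooth_on_spectrum_def by blast
  define I where "I = {- norm T..norm T}"
  have "continuous_on I (D 0)"
    by (intro continuous_at_imp_continuous_on ballI has_vector_derivative_continuous[OF D(1)])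
  then have "\<exists>g. polynomial_function g \<and> (\<forall>x\<in>I. norm (D 0 x - g x) < e)" if "e > 0" for e
    using that by (intro Stone_Weierstrass_polynomial_function) (auto simp: I_def)
  moreover have "\<exists>p. \<forall>t. poly p (of_real t) = g t" if "polynomial_function g" for g :: "real \<Rightarrow> complex"
  proof -
    have re: "real_polynomial_function (\<lambda>x. Re (g x))" and im: "real_polynomial_function (\<lambda>x. Im (g x))"
      using that bounded_linear_Re bounded_linear_Im unfolding polynomial_function_def o_def by blast+
    obtain p where "\<forall>t. poly p (of_real t) = complex_of_real (Re (g t))"
      using real_polynomial_function_poly[OF re] by (rule exE)
    moreover obtain q where "\<forall>t. poly q (of_real t) = complex_of_real (Im (g t))"
      using real_polynomial_function_poly[OF im] by (rule exE)
    ultimately have "\<forall>t. poly (p + smult \<i> q) (of_real t) = g t" by (simp add: complex_eq_iff)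
    then show ?thesis by blast
  qed
  ultimately have "\<exists>p. \<forall>t\<in>I. norm (D 0 t - poly p (of_real t)) < e" if "e > 0" for e
    using that by metis
  then have "\<forall>n. \<exists>p. \<forall>t\<in>I. norm (D 0 t - poly p (of_real t)) < 1 / real (Suc n)" by simp
  then have "\<exists>p. \<forall>n. \<forall>t\<in>I. norm (D 0 t - poly (p n) (of_real t)) < 1 / real (Suc n)"
    by (rule choice)
  then obtain p where p: "\<And>n t. t \<in> I \<Longrightarrow> norm (D 0 t - poly (p n) (of_real t)) < 1 / real (Suc n)"
    by blast
  have "uniform_limit (spectrum T) (\<lambda>n. poly (p n)) f sequentially"
  proof (rule uniform_limitI)
    fix e :: real assume "e > 0"
    then obtain N where N: "1 / real (Suc N) < e" using nat_approx_posE by blast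
    have "dist (poly (p n) z) (f z) < e" if "n \<ge> N" "z \<in> spectrum T" for n z
    proof -
      have z: "z = of_real (Re z)"
        using spectrum_self_adjoint_real[OF T that(2)] by (simp add: complex_eq_iff)
      have "\<bar>Re z\<bar> \<le> norm T"
        using spectrum_norm_le[OF T that(2)] abs_Re_le_cmod[of z] by linarith
      then have "norm (D 0 (Re z) - poly (p n) z) < 1 / real (Suc n)"
        using p[of "Re z" n] z by (simp add: I_def abs_le_iff)
      also have "\<dots> \<le> 1 / real (Suc N)" using that(1) by (simp add: frac_le)
      finally show ?thesis using D(2)[of "Re z"] that(2) z N by (simp add: dist_norm norm_minus_commute)
    qed
    then show "\<forall>\<^sub>F n in sequentially. \<forall>x\<in>spectrum T. dist (poly (p n) x) (f x) < e"
      unfolding eventually_sequentially by blast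
  qed
  then show ?thesis by (rule that)
qed

section \<open>The representations of the wreath product on functions on the base group\<close>

lemma lamp_pairing_eq:
  assumes "finite S" "Poly_Mapping.keys l \<subseteq> S"
  shows "lamp_pairing l \<omega> = (\<Sum>x\<in>S. of_int (Poly_Mapping.lookup l x) * \<omega> x)"
  unfolding lamp_pairing_def
  by (rule sum.mono_neutral_left) (use assms in \<open>auto simp: in_keys_iff\<close>)

lemma lamp_pairing_add: "lamp_pairing (l + l') \<omega> = lamp_pairing l \<omega> + lamp_pairing l' \<omega>"
proof -
  define S where "S = Poly_Mapping.keys l \<union> Poly_Mapping.keys l'"
  have "Poly_Mapping.keys (l + l') \<subseteq> S" using Poly_Mapping.keys_add[of l l'] by (simp add: S_def)
  then show ?thesis
    by (simp add: lamp_pairing_eq[of S] S_def lookup_add sum.distrib algebra_simps)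
qed

lemma lamp_pairing_uminus: "lamp_pairing (- l) \<omega> = - lamp_pairing l \<omega>"
  by (simp add: lamp_pairing_def sum_negf)

lemma lamp_pairing_single: "lamp_pairing (Poly_Mapping.single x n) \<omega> = of_int n * \<omega> x"
  by (simp add: lamp_pairing_def)

lemma lamp_pairing_shift:
  "lamp_pairing (lamp_shift g l) \<omega> = lamp_pairing l (\<lambda>x. \<omega> (g + x))"
proof -
  have inj: "inj_on ((+) g) A" for A by (simp add: inj_on_def)
  have "Poly_Mapping.keys (lamp_shift g l) \<subseteq> (+) g ` Poly_Mapping.keys l"
  proof
    fix y assume "y \<in> Poly_Mapping.keys (lamp_shift g l)"
    then have "- g + y \<in> Poly_Mapping.keys l" by (simp add: in_keys_iff lookup_lamp_shift)
    moreover have "y = g + (- g + y)" by (simp add: add.assoc[symmetric])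
    ultimately show "y \<in> (+) g ` Poly_Mapping.keys l" by blast
  qed
  then have "lamp_pairing (lamp_shift g l) \<omega>
      = (\<Sum>y\<in>(+) g ` Poly_Mapping.keys l. of_int (Poly_Mapping.lookup (lamp_shift g l) y) * \<omega> y)"
    by (intro lamp_pairing_eq) auto
  also have "\<dots> = lamp_pairing l (\<lambda>x. \<omega> (g + x))"
    by (simp add: sum.reindex[OF inj] lookup_lamp_shift lamp_pairing_def add.assoc[symmetric])
  finally show ?thesis .
qed

definition lamp_phase :: "('g::group_add \<Rightarrow> real) \<Rightarrow> ('g \<Rightarrow>\<^sub>0 int) \<Rightarrow> 'g \<Rightarrow> complex" where
  "lamp_phase \<omega> l h = exp (2 * of_real pi * \<i> * of_real (lamp_pairing l (\<lambda>x. \<omega> (- x + h))))"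

lemma norm_lamp_phase [simp]: "norm (lamp_phase \<omega> l h) = 1"
  by (simp add: lamp_phase_def norm_exp_eq_Re)

lemma lamp_phase_0: "lamp_phase \<omega> 0 h = 1"
  by (simp add: lamp_phase_def lamp_pairing_def)

lemma lamp_phase_add: "lamp_phase \<omega> (l + l') h = lamp_phase \<omega> l h * lamp_phase \<omega> l' h"
  by (simp add: lamp_phase_def lamp_pairing_add ring_distribs exp_add)

lemma lamp_phase_uminus: "lamp_phase \<omega> (- l) h = cnj (lamp_phase \<omega> l h)"
  by (simp add: lamp_phase_def lamp_pairing_uminus exp_cnj)

lemma lamp_phase_shift: "lamp_phase \<omega> (lamp_shift g l) h = lamp_phase \<omega> l (- g + h)"
  by (simp add: lamp_phase_def lamp_pairing_shift minus_add add.assoc del: add_uminus_conv_diff)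

text \<open>
  The representation of the wreath product induced from the character of the lamp group
  that is given by \<open>\<omega>\<close>. It sends the two embedded groups to the translations and to the
  phases out of which \<open>H(\<omega>)\<close> is built, as the regular representation does for \<open>M\<close>.
\<close>

definition wreath_rep :: "('g::group_add \<Rightarrow> real) \<Rightarrow> 'g wreath \<Rightarrow> 'g ell2 \<Rightarrow>\<^sub>L 'g ell2" where
  "wreath_rep \<omega> w = Diag (lamp_phase \<omega> (lamps w)) o\<^sub>L left_regular (position w)"

lemma left_regular_apply: "Rep_ell2 (left_regular x u) y = Rep_ell2 u (- x + y)"
  by (simp add: left_regular.rep_eq ell2_translate.rep_eq)

lemma wreath_rep_apply:
  "Rep_ell2 (wreath_rep \<omega> w u) h = lamp_phase \<omega> (lamps w) h * Rep_ell2 u (- position w + h)"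
proof -
  have "bounded (range (lamp_phase \<omega> (lamps w)))"
    by (auto simp: bounded_iff intro!: exI[of _ 1])
  then show ?thesis by (simp add: wreath_rep_def Diag_apply left_regular_apply)
qed

lemma left_regular_add: "left_regular (x + y) u = left_regular x (left_regular y u)"
  by (rule ell2_eqI) (simp add: left_regular_apply minus_add add.assoc del: add_uminus_conv_diff)

lemma wreath_rep_add: "wreath_rep \<omega> (v + w) u = wreath_rep \<omega> v (wreath_rep \<omega> w u)"
  by (rule ell2_eqI)
    (simp add: wreath_rep_apply plus_wreath_def lamp_phase_add lamp_phase_shift minus_add add.assoc
      del: add_uminus_conv_diff)

lemma left_regular_scalar: "left_regular x (scalar c u) = scalar c (left_regular x u)"
  by (rule ell2_eqI) (simp add: left_regular_apply scalar_apply)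

lemma wreath_rep_scalar: "wreath_rep \<omega> w (scalar c u) = scalar c (wreath_rep \<omega> w u)"
  by (rule ell2_eqI) (simp add: wreath_rep_apply scalar_apply)

text \<open>
  The images of one element of the complex group algebra of the wreath product, under the
  regular representation and under all the representations above.
\<close>

inductive group_algebra_pair ::
    "('g::group_add wreath ell2 \<Rightarrow>\<^sub>L 'g wreath ell2) \<Rightarrow> (('g \<Rightarrow> real) \<Rightarrow> 'g ell2 \<Rightarrow>\<^sub>L 'g ell2) \<Rightarrow> bool" where
  gen: "group_algebra_pair (scalar c o\<^sub>L left_regular w) (\<lambda>\<omega>. scalar c o\<^sub>L wreath_rep \<omega> w)"
| add: "group_algebra_pair T S \<Longrightarrow> group_algebra_pair T' S' \<Longrightarrow> group_algebra_pair (T + T') (\<lambda>\<omega>. S \<omega> + S' \<omega>)"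

lemma group_algebra_pair_gen_compose:
  assumes "group_algebra_pair T S"
  shows "group_algebra_pair ((scalar c o\<^sub>L left_regular w) o\<^sub>L T) (\<lambda>\<omega>. (scalar c o\<^sub>L wreath_rep \<omega> w) o\<^sub>L S \<omega>)"
  using assms
proof induction
  case (gen d v)
  have "(scalar c o\<^sub>L left_regular w) o\<^sub>L (scalar d o\<^sub>L left_regular v) = scalar (c * d) o\<^sub>L left_regular (w + v)"
    by (rule blinfun_eqI) (simp add: left_regular_scalar scalar_mult left_regular_add)
  moreover have "(scalar c o\<^sub>L wreath_rep \<omega> w) o\<^sub>L (scalar d o\<^sub>L wreath_rep \<omega> v) = scalar (c * d) o\<^sub>L wreath_rep \<omega> (w + v)" for \<omega>
    by (rule blinfun_eqI) (simp add: wreath_rep_scalar scalar_mult wreath_rep_add)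
  ultimately show ?case by (simp add: group_algebra_pair.gen)
next
  case (add T S T' S')
  then show ?case
    by (simp add: bounded_bilinear.add_right[OF bounded_bilinear_blinfun_compose] group_algebra_pair.add)
qed

lemma group_algebra_pair_compose:
  assumes "group_algebra_pair T S" "group_algebra_pair T' S'"
  shows "group_algebra_pair (T o\<^sub>L T') (\<lambda>\<omega>. S \<omega> o\<^sub>L S' \<omega>)"
  using assms(1)
proof induction
  case (gen c w)
  then show ?case by (rule group_algebra_pair_gen_compose[OF assms(2)])
next
  case (add T S T1 S1)
  then show ?case
    by (simp add: bounded_bilinear.add_left[OF bounded_bilinear_blinfun_compose] group_algebra_pair.add)
qed

section \<open>Almost invariant vectors of the lamp group\<close>

definition lamp_size :: "('g \<Rightarrow>\<^sub>0 int) \<Rightarrow> real" where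
  "lamp_size k = (\<Sum>x\<in>Poly_Mapping.keys k. \<bar>of_int (Poly_Mapping.lookup k x)\<bar>)"

lemma lamp_size_eq:
  assumes "finite S" "Poly_Mapping.keys k \<subseteq> S"
  shows "lamp_size k = (\<Sum>x\<in>S. \<bar>of_int (Poly_Mapping.lookup k x)\<bar>)"
  unfolding lamp_size_def
  by (rule sum.mono_neutral_left) (use assms in \<open>auto simp: in_keys_iff\<close>)

lemma lamp_size_add: "lamp_size (k + l) \<le> lamp_size k + lamp_size l"
proof -
  define S where "S = Poly_Mapping.keys k \<union> Poly_Mapping.keys l"
  have "Poly_Mapping.keys (k + l) \<subseteq> S" using Poly_Mapping.keys_add[of k l] by (simp add: S_def)
  then show ?thesis
    by (simp add: lamp_size_eq[of S] S_def lookup_add sum.distrib[symmetric] sum_mono abs_triangle_ineq)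
qed

lemma lamp_size_uminus: "lamp_size (- k) = lamp_size k"
  by (simp add: lamp_size_def)

lemma lamp_size_diff: "\<bar>lamp_size (k - l) - lamp_size k\<bar> \<le> lamp_size l"
  using lamp_size_add[of "k - l" l] lamp_size_add[of k "- l"] by (simp add: lamp_size_uminus)

lemma sum_exp_int_le:
  fixes B :: "int set" and a :: real
  assumes "finite B" "a > 0"
  shows "(\<Sum>n\<in>B. exp (- a * \<bar>of_int n\<bar>)) \<le> 2 / (1 - exp (- a))"
proof -
  define q where "q = exp (- a)"
  have q: "0 < q" "q < 1" using assms by (auto simp: q_def)
  have geo: "(\<Sum>n\<in>N. q ^ n) \<le> 1 / (1 - q)" if "finite N" for N
    using sum_le_suminf[of "\<lambda>n. q ^ n" N] q that suminf_geometric[of q] summable_geometric[of q] by simp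
  have e: "exp (- a * \<bar>of_int n\<bar>) = q ^ nat \<bar>n\<bar>" for n
    by (simp add: q_def exp_of_nat_mult[symmetric] mult.commute)
  have "(\<Sum>n\<in>B. exp (- a * \<bar>of_int n\<bar>)) = (\<Sum>n\<in>B \<inter> {0..}. q ^ nat \<bar>n\<bar>) + (\<Sum>n\<in>B - {0..}. q ^ nat \<bar>n\<bar>)"
    unfolding e by (rule sum.Int_Diff[OF assms(1)])
  also have "(\<Sum>n\<in>B \<inter> {0..}. q ^ nat \<bar>n\<bar>) = (\<Sum>m\<in>(\<lambda>n. nat \<bar>n\<bar>) ` (B \<inter> {0..}). q ^ m)"
    by (subst sum.reindex) (auto simp: inj_on_def)
  also have "\<dots> \<le> 1 / (1 - q)" using assms by (intro geo) auto
  also have "(\<Sum>n\<in>B - {0..}. q ^ nat \<bar>n\<bar>) = (\<Sum>m\<in>(\<lambda>n. nat \<bar>n\<bar>) ` (B - {0..}). q ^ m)"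
    by (subst sum.reindex) (auto simp: inj_on_def)
  also have "\<dots> \<le> 1 / (1 - q)" using assms by (intro geo) auto
  finally show ?thesis by (simp add: q_def)
qed

lemma summable_exp_lamp_size:
  fixes E :: "'g set"
  assumes E: "finite E" and a: "a > 0"
  shows "(\<lambda>k. if Poly_Mapping.keys k \<subseteq> E then exp (- a * lamp_size k) else 0) summable_on UNIV"
    (is "?w summable_on _")
proof (rule nonneg_bdd_above_summable_on)
  define C where "C = (2 / (1 - exp (- a))) ^ card E"
  have "sum ?w F \<le> C" if F: "finite F" for F
  proof -
    define G where "G = {k \<in> F. Poly_Mapping.keys k \<subseteq> E}"
    define B where "B = (\<Union>k\<in>G. Poly_Mapping.lookup k ` E)"
    define \<phi> where "\<phi> k = restrict (Poly_Mapping.lookup k) E" for k :: "'g \<Rightarrow>\<^sub>0 int"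
    have fin: "finite G" "finite B" using F E by (auto simp: G_def B_def)
    have inj: "inj_on \<phi> G"
    proof (rule inj_onI)
      fix k l assume k: "k \<in> G" "l \<in> G" "\<phi> k = \<phi> l"
      have "Poly_Mapping.lookup k x = Poly_Mapping.lookup l x" for x
      proof (cases "x \<in> E")
        case True
        then show ?thesis using fun_cong[OF k(3), of x] by (simp add: \<phi>_def)
      next
        case False
        then have "x \<notin> Poly_Mapping.keys k" "x \<notin> Poly_Mapping.keys l" using k by (auto simp: G_def)
        then show ?thesis by (simp add: in_keys_iff)
      qed
      then show "k = l" by (rule poly_mapping_eqI)
    qed
    have "sum ?w F = (\<Sum>k\<in>G. exp (- a * lamp_size k))"
      unfolding G_def by (rule sum.inter_filter[OF F, symmetric])
    also have "\<dots> = (\<Sum>k\<in>G. \<Prod>x\<in>E. exp (- a * \<bar>of_int (\<phi> k x)\<bar>))"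
    proof (rule sum.cong)
      fix k assume "k \<in> G"
      then have "lamp_size k = (\<Sum>x\<in>E. \<bar>of_int (Poly_Mapping.lookup k x)\<bar>)"
        using E by (intro lamp_size_eq) (auto simp: G_def)
      then show "exp (- a * lamp_size k) = (\<Prod>x\<in>E. exp (- a * \<bar>of_int (\<phi> k x)\<bar>))"
        using E by (simp add: sum_distrib_left exp_sum \<phi>_def flip: sum_negf)
    qed simp
    also have "\<dots> = (\<Sum>f\<in>\<phi> ` G. \<Prod>x\<in>E. exp (- a * \<bar>of_int (f x)\<bar>))"
      by (simp add: sum.reindex[OF inj])
    also have "\<dots> \<le> (\<Sum>f\<in>PiE E (\<lambda>_. B). \<Prod>x\<in>E. exp (- a * \<bar>of_int (f x)\<bar>))"
      using fin E by (intro sum_mono2 finite_PiE) (auto simp: \<phi>_def B_def intro!: prod_nonneg)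
    also have "\<dots> = (\<Prod>x\<in>E. \<Sum>n\<in>B. exp (- a * \<bar>of_int n\<bar>))"
      using fin E by (intro prod_sum_PiE[symmetric])
    also have "\<dots> \<le> (\<Prod>x\<in>E. 2 / (1 - exp (- a)))"
    proof (rule prod_mono)
      fix x
      show "0 \<le> (\<Sum>n\<in>B. exp (- a * \<bar>real_of_int n\<bar>)) \<and>
          (\<Sum>n\<in>B. exp (- a * \<bar>real_of_int n\<bar>)) \<le> 2 / (1 - exp (- a))"
        using sum_exp_int_le[OF fin(2) a] by (simp add: sum_nonneg)
    qed
    finally show ?thesis by (simp add: C_def)
  qed
  then show "bdd_above (sum ?w ` {F. F \<subseteq> UNIV \<and> finite F})" by (intro bdd_aboveI2) auto
qed auto

text \<open>
  The lamp group is amenable: \<open>exp (- \<epsilon> size)\<close>, cut off to lamps in a finite set, changes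
  under translation by an element with lamps in that set only by a factor close to \<open>1\<close>, if
  \<open>\<epsilon>\<close> is small. Both parameters depend on \<open>j\<close>, so that in the limit every translation is
  covered.
\<close>

lemma lamp_almost_invariant:
  obtains \<xi> :: "nat \<Rightarrow> ('g::countable \<Rightarrow>\<^sub>0 int) \<Rightarrow> real"
  where "\<And>j k. \<xi> j k \<ge> 0" "\<And>j. ((\<lambda>k. (\<xi> j k)\<^sup>2) has_sum 1) UNIV"
    "\<And>\<kappa> e. e > 0 \<Longrightarrow> \<forall>\<^sub>F j in sequentially. \<forall>k. \<bar>\<xi> j (k - \<kappa>) - \<xi> j k\<bar> \<le> e * \<xi> j k"
proof -
  define E where "E j = {x :: 'g. to_nat x < j}" for j
  have finE: "finite (E j)" for j
  proof (rule finite_imageD)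
    show "finite (to_nat ` E j)" by (rule finite_subset[of _ "{..<j}"]) (auto simp: E_def)
  qed (auto simp: inj_on_def)
  define w where "w j k = (if Poly_Mapping.keys k \<subseteq> E j then exp (- (1 / real (Suc j)) * lamp_size k) else 0)" for j k
  have w2: "(w j k)\<^sup>2 = (if Poly_Mapping.keys k \<subseteq> E j then exp (- (2 / real (Suc j)) * lamp_size k) else 0)" for j k
    by (simp add: w_def power2_eq_square exp_add[symmetric])
  have w0: "w j k \<ge> 0" for j k by (simp add: w_def)
  have sum: "(\<lambda>k. (w j k)\<^sup>2) summable_on UNIV" for j
    unfolding w2 by (rule summable_exp_lamp_size[OF finE]) simp
  define Z where "Z j = (\<Sum>\<^sub>\<infinity>k. (w j k)\<^sup>2)" for j
  have Z: "Z j > 0" for j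
  proof -
    have "(\<Sum>k\<in>{0}. (w j k)\<^sup>2) \<le> Z j"
      unfolding Z_def by (rule finite_sum_le_infsum[OF sum]) auto
    then show ?thesis by (simp add: w_def lamp_size_def)
  qed
  show ?thesis
  proof (rule that[of "\<lambda>j k. w j k / sqrt (Z j)"])
    show "w j k / sqrt (Z j) \<ge> 0" for j k using w0 Z[of j] by simp
    show "((\<lambda>k. (w j k / sqrt (Z j))\<^sup>2) has_sum 1) UNIV" for j
      using has_sum_cmult_right[OF has_sum_infsum[OF sum[of j]], of "1 / Z j"] Z[of j]
      by (simp add: power_divide Z_def)
    fix \<kappa> :: "'g \<Rightarrow>\<^sub>0 int" and e :: real assume e: "e > 0"
    have "(\<lambda>j. exp (1 / real (Suc j) * lamp_size \<kappa>) - 1) \<longlonglongrightarrow> exp (0 * lamp_size \<kappa>) - 1"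
      by (intro tendsto_intros LIMSEQ_Suc lim_1_over_n)
    then have ev1: "\<forall>\<^sub>F j in sequentially. exp (1 / real (Suc j) * lamp_size \<kappa>) - 1 < e"
      using e by (intro order_tendstoD(2)) auto
    have "Poly_Mapping.keys \<kappa> \<subseteq> E j" if "j \<ge> Suc (Max (to_nat ` Poly_Mapping.keys \<kappa>))" for j
    proof
      fix x assume "x \<in> Poly_Mapping.keys \<kappa>"
      then have "to_nat x \<le> Max (to_nat ` Poly_Mapping.keys \<kappa>)" by (intro Max_ge) auto
      then show "x \<in> E j" using that by (simp add: E_def)
    qed
    then have "\<exists>J. \<forall>j\<ge>J. Poly_Mapping.keys \<kappa> \<subseteq> E j" by blast
    then have ev2: "\<forall>\<^sub>F j in sequentially. Poly_Mapping.keys \<kappa> \<subseteq> E j" by (simp add: eventually_sequentially)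
    show "\<forall>\<^sub>F j in sequentially. \<forall>k. \<bar>w j (k - \<kappa>) / sqrt (Z j) - w j k / sqrt (Z j)\<bar> \<le> e * (w j k / sqrt (Z j))"
      using ev1 ev2
    proof eventually_elim
      case (elim j)
      define t where "t = 1 / real (Suc j)"
      have t: "t > 0" by (simp add: t_def)
      have "\<bar>w j (k - \<kappa>) - w j k\<bar> \<le> e * w j k" for k
      proof (cases "Poly_Mapping.keys k \<subseteq> E j")
        case True
        have "Poly_Mapping.keys (k - \<kappa>) \<subseteq> E j"
          using True elim(2) Poly_Mapping.keys_diff[of k \<kappa>] by blast
        then have "w j (k - \<kappa>) - w j k = exp (- t * lamp_size (k - \<kappa>)) - exp (- t * lamp_size k)"
          using True by (simp add: w_def t_def)
        also have "\<dots> = (exp (t * (lamp_size k - lamp_size (k - \<kappa>))) - 1) * exp (- t * lamp_size k)"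
          by (simp add: left_diff_distrib exp_add[symmetric] algebra_simps)
        finally have eq: "w j (k - \<kappa>) - w j k = (exp (t * (lamp_size k - lamp_size (k - \<kappa>))) - 1) * w j k"
          using True by (simp add: w_def t_def)
        define d where "d = t * (lamp_size k - lamp_size (k - \<kappa>))"
        define c where "c = t * lamp_size \<kappa>"
        have "\<bar>d\<bar> \<le> c" using lamp_size_diff[of k \<kappa>] t by (simp add: d_def c_def abs_mult abs_minus_commute)
        then have d: "- c \<le> d" "d \<le> c" "0 \<le> c" by linarith+
        have "1 \<le> exp c" "exp (- c) * exp c = 1" using d by (simp_all add: exp_add[symmetric])
        then have "2 \<le> exp (- c) + exp c"
          using zero_le_power2[of "exp c - 1"] mult_left_mono[of 2 "exp (-c) + exp c" "exp c"]
          by (smt (verit) exp_ge_add_one_self)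
        moreover have "exp (- c) \<le> exp d" "exp d \<le> exp c" using d by simp_all
        ultimately have "\<bar>exp d - 1\<bar> \<le> exp c - 1" by linarith
        also have "exp c - 1 \<le> e" using elim(1) by (simp add: c_def t_def)
        finally show ?thesis
          unfolding eq d_def[symmetric] abs_mult using w0[of j k] by (simp add: mult_right_mono)
      next
        case False
        have "k = (k - \<kappa>) + \<kappa>" by simp
        then have "\<not> Poly_Mapping.keys (k - \<kappa>) \<subseteq> E j"
          using False elim(2) Poly_Mapping.keys_add[of "k - \<kappa>" \<kappa>] by auto
        then show ?thesis using False by (simp add: w_def)
      qed
      then have "\<bar>w j (k - \<kappa>) - w j k\<bar> / sqrt (Z j) \<le> e * w j k / sqrt (Z j)" for k
        using Z[of j] by (intro divide_right_mono) auto
      then show ?case using Z[of j] by (simp add: abs_divide flip: diff_divide_distrib)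
    qed
  qed
qed

section \<open>The induced representations are dominated by the regular one\<close>

lemma norm_ell2_le_cmult:
  assumes "\<And>x. norm (Rep_ell2 u x) \<le> e * norm (Rep_ell2 v x)" "e \<ge> 0"
  shows "norm u \<le> e * norm v"
proof -
  have "(norm u)\<^sup>2 \<le> e\<^sup>2 * (norm v)\<^sup>2"
  proof (rule has_sum_mono[OF norm_ell2_has_sum[of u] has_sum_cmult_right[OF norm_ell2_has_sum[of v]]])
    fix x
    show "(norm (Rep_ell2 u x))\<^sup>2 \<le> e\<^sup>2 * (norm (Rep_ell2 v x))\<^sup>2"
      using power_mono[OF assms(1)[of x], of 2] by (simp add: power_mult_distrib)
  qed
  then have "(norm u)\<^sup>2 \<le> (e * norm v)\<^sup>2" by (simp add: power_mult_distrib)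
  then show ?thesis using assms(2) by (simp add: power2_le_iff_abs_le)
qed

text \<open>
  In the coordinates \<open>(k, h)\<close> with \<open>k = l \<circ> h\<close> for the element \<open>(l, h)\<close>, this is the map
  \<open>\<phi> \<mapsto> \<xi> \<otimes> \<phi>\<close> twisted by the character given by \<open>\<omega>\<close>. Left multiplication by \<open>(l', g)\<close>
  translates \<open>k\<close> by the amount \<open>l' \<circ> gh\<close>, so that an almost invariant \<open>\<xi>\<close> makes the map an
  approximate intertwiner.
\<close>

definition twisted_tensor ::
    "('g::group_add \<Rightarrow> real) \<Rightarrow> (('g \<Rightarrow>\<^sub>0 int) \<Rightarrow> real) \<Rightarrow> 'g ell2 \<Rightarrow> 'g wreath ell2" where
  "twisted_tensor \<omega> \<xi> u = Abs_ell2 (\<lambda>w. of_real (\<xi> (lamp_shift (- position w) (lamps w))) *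
     cnj (lamp_phase \<omega> (lamps w) (position w)) * Rep_ell2 u (position w))"

lemma twisted_tensor_has_sum:
  fixes u :: "'g::group_add ell2"
  assumes "((\<lambda>k. (\<xi> k)\<^sup>2) has_sum 1) UNIV"
  shows "((\<lambda>w. (norm (of_real (\<xi> (lamp_shift (- position w) (lamps w))) *
     cnj (lamp_phase \<omega> (lamps w) (position w)) * Rep_ell2 u (position w)))\<^sup>2) has_sum (norm u)\<^sup>2) UNIV"
    (is "(?f has_sum _) _")
proof -
  define \<phi> where "\<phi> = (\<lambda>(h :: 'g, k). Wr (lamp_shift h k) h)"
  have bij: "bij_betw \<phi> (UNIV \<times> UNIV) UNIV"
    by (rule bij_betw_byWitness[where f' = "\<lambda>w. (position w, lamp_shift (- position w) (lamps w))"])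
      (auto simp: \<phi>_def lamp_shift_simps)
  have f: "?f (\<phi> (h, k)) = (norm (Rep_ell2 u h))\<^sup>2 * (\<xi> k)\<^sup>2" for h k
    by (simp add: \<phi>_def norm_mult power_mult_distrib lamp_shift_simps)
  have inner: "((\<lambda>k. ?f (\<phi> (h, k))) has_sum (norm (Rep_ell2 u h))\<^sup>2) UNIV" for h
    unfolding f using has_sum_cmult_right[OF assms, of "(norm (Rep_ell2 u h))\<^sup>2"] by simp
  have "((\<lambda>p. ?f (\<phi> p)) has_sum (norm u)\<^sup>2) (UNIV \<times> UNIV)"
  proof (rule has_sum_SigmaI)
    show "(\<lambda>p. ?f (\<phi> p)) summable_on UNIV \<times> UNIV"
      by (rule summable_on_SigmaI[OF inner ell2_summable]) auto
  qed (use inner norm_ell2_has_sum in auto)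
  then show ?thesis using has_sum_reindex_bij_betw[OF bij, of ?f] by simp
qed

context
  fixes \<xi> :: "('g::group_add \<Rightarrow>\<^sub>0 int) \<Rightarrow> real"
  assumes \<xi>: "((\<lambda>k. (\<xi> k)\<^sup>2) has_sum 1) UNIV"
begin

lemma Rep_twisted_tensor:
  "Rep_ell2 (twisted_tensor \<omega> \<xi> u) w = of_real (\<xi> (lamp_shift (- position w) (lamps w))) *
     cnj (lamp_phase \<omega> (lamps w) (position w)) * Rep_ell2 u (position w)"
proof -
  have "(\<lambda>w. (norm (of_real (\<xi> (lamp_shift (- position w) (lamps w))) *
     cnj (lamp_phase \<omega> (lamps w) (position w)) * Rep_ell2 u (position w)))\<^sup>2) summable_on UNIV"
    using twisted_tensor_has_sum[OF \<xi>] by (rule has_sum_imp_summable)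
  then show ?thesis by (simp add: twisted_tensor_def Abs_ell2_inverse)
qed

lemma norm_twisted_tensor: "norm (twisted_tensor \<omega> \<xi> u) = norm u"
proof -
  have "((\<lambda>w. (norm (Rep_ell2 (twisted_tensor \<omega> \<xi> u) w))\<^sup>2) has_sum (norm u)\<^sup>2) UNIV"
    unfolding Rep_twisted_tensor by (rule twisted_tensor_has_sum[OF \<xi>])
  then have "(norm (twisted_tensor \<omega> \<xi> u))\<^sup>2 = (norm u)\<^sup>2"
    using has_sum_unique norm_ell2_has_sum by blast
  then show ?thesis by simp
qed

lemma twisted_tensor_add: "twisted_tensor \<omega> \<xi> (u + v) = twisted_tensor \<omega> \<xi> u + twisted_tensor \<omega> \<xi> v"
  by (rule ell2_eqI) (simp add: Rep_twisted_tensor Rep_ell2_add algebra_simps)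

lemma twisted_tensor_diff: "twisted_tensor \<omega> \<xi> (u - v) = twisted_tensor \<omega> \<xi> u - twisted_tensor \<omega> \<xi> v"
  by (rule ell2_eqI) (simp add: Rep_twisted_tensor Rep_ell2_diff algebra_simps)

lemma twisted_tensor_scalar: "twisted_tensor \<omega> \<xi> (scalar c u) = scalar c (twisted_tensor \<omega> \<xi> u)"
  by (rule ell2_eqI) (simp add: Rep_twisted_tensor scalar_apply)

lemma left_regular_twisted_tensor_delta:
  assumes inv: "\<And>k. \<bar>\<xi> (k - lamp_shift (- (position w + a)) (lamps w)) - \<xi> k\<bar> \<le> e * \<xi> k"
    and "e \<ge> 0" "\<And>k. \<xi> k \<ge> 0"
  shows "norm (left_regular w (twisted_tensor \<omega> \<xi> (scalar c (delta a)))
      - twisted_tensor \<omega> \<xi> (wreath_rep \<omega> w (scalar c (delta a)))) \<le> e * norm (wreath_rep \<omega> w (scalar c (delta a)))"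
    (is "norm (?A - ?B) \<le> _")
proof -
  define u where "u = scalar c (delta a)"
  have "norm (Rep_ell2 (?A - ?B) v) \<le> e * norm (Rep_ell2 ?B v)" for v
  proof (cases "- position w + position v = a")
    case True
    define h where "h = position v"
    define k where "k = lamp_shift (- h) (lamps v)"
    have h: "h = position w + a" using True by (auto simp: h_def add.assoc[symmetric])
    have pos: "position (- w + v) = a" using True by (simp add: plus_wreath_def uminus_wreath_def)
    have lam: "lamps (- w + v) = lamp_shift (- position w) (lamps v - lamps w)"
      by (rule poly_mapping_eqI)
        (simp add: plus_wreath_def uminus_wreath_def lookup_add lookup_minus lookup_lamp_shift)
    have "lamp_shift (- a) (lamps (- w + v)) = lamp_shift (- h) (lamps v - lamps w)"
      unfolding lam lamp_shift_simps h minus_add ..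
    also have "\<dots> = k - lamp_shift (- h) (lamps w)"
      by (rule poly_mapping_eqI) (simp add: k_def lookup_lamp_shift lookup_minus)
    finally have lk: "lamp_shift (- a) (lamps (- w + v)) = k - lamp_shift (- h) (lamps w)" .
    have "lamp_phase \<omega> (lamps (- w + v)) a = lamp_phase \<omega> (lamps v + - lamps w) (position w + a)"
      unfolding lam lamp_phase_shift by simp
    then have ph: "cnj (lamp_phase \<omega> (lamps (- w + v)) a) = cnj (lamp_phase \<omega> (lamps v) h) * lamp_phase \<omega> (lamps w) h"
      unfolding h by (simp add: lamp_phase_add lamp_phase_uminus del: add_uminus_conv_diff)
    have A: "Rep_ell2 ?A v = of_real (\<xi> (k - lamp_shift (- h) (lamps w))) *
        (cnj (lamp_phase \<omega> (lamps v) h) * lamp_phase \<omega> (lamps w) h) * c"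
      unfolding left_regular_apply Rep_twisted_tensor pos lk ph by (simp add: scalar_apply Rep_delta)
    have B: "Rep_ell2 ?B v = of_real (\<xi> k) * (cnj (lamp_phase \<omega> (lamps v) h) * lamp_phase \<omega> (lamps w) h) * c"
      unfolding Rep_twisted_tensor wreath_rep_apply h_def[symmetric] k_def[symmetric]
      using True by (simp add: h_def scalar_apply Rep_delta)
    have "Rep_ell2 (?A - ?B) v = of_real (\<xi> (k - lamp_shift (- h) (lamps w)) - \<xi> k) *
        (cnj (lamp_phase \<omega> (lamps v) h) * lamp_phase \<omega> (lamps w) h) * c"
      unfolding Rep_ell2_diff A B by (simp add: algebra_simps)
    then have "norm (Rep_ell2 (?A - ?B) v) = \<bar>\<xi> (k - lamp_shift (- h) (lamps w)) - \<xi> k\<bar> * norm c"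
      by (simp only: norm_mult norm_of_real complex_mod_cnj norm_lamp_phase mult_1_right)
    also have "\<dots> \<le> e * \<xi> k * norm c" using inv[of k] by (intro mult_right_mono) (auto simp: h)
    also have "\<dots> = e * norm (Rep_ell2 ?B v)"
      unfolding B using assms(3)[of k] by (simp add: norm_mult)
    finally show ?thesis .
  next
    case False
    have "position (- w + v) = - position w + position v" by (simp add: plus_wreath_def uminus_wreath_def)
    then have "Rep_ell2 ?A v = 0" "Rep_ell2 ?B v = 0"
      using False by (simp_all add: left_regular_apply Rep_twisted_tensor wreath_rep_apply scalar_apply Rep_delta)
    then show ?thesis using assms(2) by (simp add: Rep_ell2_diff)
  qed
  then have "norm (?A - ?B) \<le> e * norm ?B" using assms(2) by (rule norm_ell2_le_cmult)
  then show ?thesis by (simp add: norm_twisted_tensor)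
qed

end

text \<open>
  The approximate intertwiners carry a norm bound from the regular representation to
  every single one of the representations, not only to almost all of them. This uniformity
  in \<open>\<omega>\<close> is what keeps the spectrum of every \<open>H(\<omega>)\<close> inside that of \<open>M\<close>.
\<close>

lemma group_algebra_pair_norm_le:
  fixes S :: "('g::{group_add,countable} \<Rightarrow> real) \<Rightarrow> 'g ell2 \<Rightarrow>\<^sub>L 'g ell2"
  assumes "group_algebra_pair T S"
  shows "norm (S \<omega>) \<le> norm T"
proof -
  obtain \<xi> :: "nat \<Rightarrow> ('g \<Rightarrow>\<^sub>0 int) \<Rightarrow> real"
    where pos: "\<And>j k. \<xi> j k \<ge> 0" and sum: "\<And>j. ((\<lambda>k. (\<xi> j k)\<^sup>2) has_sum 1) UNIV"
      and inv: "\<And>\<kappa> e. e > 0 \<Longrightarrow> \<forall>\<^sub>F j in sequentially. \<forall>k. \<bar>\<xi> j (k - \<kappa>) - \<xi> j k\<bar> \<le> e * \<xi> j k"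
    by (rule lamp_almost_invariant) blast
  define J where "J j = twisted_tensor \<omega> (\<xi> j)" for j
  have nJ: "norm (J j u) = norm u" for j u
    unfolding J_def by (rule norm_twisted_tensor[OF sum])
  have J_add: "J j (u + v) = J j u + J j v" and J_diff: "J j (u - v) = J j u - J j v"
    and J_scalar: "J j (scalar c u) = scalar c (J j u)" for j u v c
    unfolding J_def by (rule twisted_tensor_add[OF sum] twisted_tensor_diff[OF sum] twisted_tensor_scalar[OF sum])+
  have lim: "(\<lambda>j. T (J j u) - J j (S \<omega> u)) \<longlonglongrightarrow> 0" for u
    using assms
  proof (induction arbitrary: u)
    case (add T S T' S')
    show ?case
      using tendsto_add[OF add.IH(1)[of u] add.IH(2)[of u]]
      by (simp add: blinfun.bilinear_simps J_add algebra_simps)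
  next
    case (gen c w)
    define d where "d j u = left_regular w (J j u) - J j (wreath_rep \<omega> w u)" for j u
    have d_add: "d j (u + v) = d j u + d j v" and d_diff: "d j (u - v) = d j u - d j v" for j u v
      by (simp_all add: d_def J_add J_diff blinfun.bilinear_simps)
    have d_bound: "norm (d j u) \<le> (norm (left_regular w) + norm (wreath_rep \<omega> w)) * norm u" for j u
    proof -
      have "norm (d j u) \<le> norm (left_regular w (J j u)) + norm (wreath_rep \<omega> w u)"
        unfolding d_def using norm_triangle_ineq4 nJ by metis
      also have "\<dots> \<le> norm (left_regular w) * norm u + norm (wreath_rep \<omega> w) * norm u"
        using norm_blinfun[of "left_regular w" "J j u"] norm_blinfun[of "wreath_rep \<omega> w" u] by (simp add: nJ)
      finally show ?thesis by (simp add: algebra_simps)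
    qed
    have "(\<lambda>j. d j u) \<longlonglongrightarrow> 0"
    proof (induction u rule: ell2_dense_induct)
      case (delta b a)
      define r where "r = norm (wreath_rep \<omega> w (scalar b (delta a)))"
      show ?case
      proof (rule LIMSEQ_I)
        fix e :: real assume e: "e > 0"
        have r: "r \<ge> 0" by (simp add: r_def)
        have "\<forall>\<^sub>F j in sequentially. norm (d j (scalar b (delta a))) \<le> e / (r + 1) * r"
          using inv[of "e / (r + 1)" "lamp_shift (- (position w + a)) (lamps w)"]
        proof (rule eventually_mono)
          show "e / (r + 1) > 0" using e r by simp
          fix j assume "\<forall>k. \<bar>\<xi> j (k - lamp_shift (- (position w + a)) (lamps w)) - \<xi> j k\<bar> \<le> e / (r + 1) * \<xi> j k"
          then show "norm (d j (scalar b (delta a))) \<le> e / (r + 1) * r"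
            unfolding d_def J_def r_def
            using e r by (intro left_regular_twisted_tensor_delta[OF sum] pos) (auto simp: r_def)
        qed
        moreover have "e / (r + 1) * r < e" using e r by (simp add: field_simps)
        ultimately show "\<exists>N. \<forall>j\<ge>N. norm (d j (scalar b (delta a)) - 0) < e"
          unfolding eventually_sequentially by fastforce
      qed
    next
      case (add u v)
      then show ?case using tendsto_add[OF add] by (simp add: d_add)
    next
      case (closed u)
      define C where "C = norm (left_regular w) + norm (wreath_rep \<omega> w) + 1"
      have C: "C > 0" by (simp add: C_def add_nonneg_pos)
      show ?case
      proof (rule LIMSEQ_I)
        fix e :: real assume e: "e > 0"
        then obtain v where v: "(\<lambda>j. d j v) \<longlonglongrightarrow> 0" "norm (u - v) < e / 2 / C"
          using closed[of "e / 2 / C"] C by auto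
        obtain N where N: "\<And>j. j \<ge> N \<Longrightarrow> norm (d j v) < e / 2"
          using LIMSEQ_D[OF v(1), of "e/2"] e by auto
        have "norm (d j u) < e" if "j \<ge> N" for j
        proof -
          have "norm (d j u) \<le> norm (d j (u - v)) + norm (d j v)"
            using norm_triangle_ineq[of "d j (u - v)" "d j v"] by (simp add: d_diff)
          also have "norm (d j (u - v)) \<le> C * norm (u - v)"
            by (rule order_trans[OF d_bound]) (simp add: C_def mult_right_mono)
          also have "\<dots> \<le> e / 2" using v(2) C by (simp add: field_simps)
          also have "norm (d j v) < e / 2" using N[OF that] .
          finally show ?thesis by simp
        qed
        then show "\<exists>N. \<forall>j\<ge>N. norm (d j u - 0) < e" by auto
      qed
    qed
    from bounded_linear.tendsto[OF blinfun.bounded_linear_right this, of "scalar c"]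
    show ?case by (simp add: d_def blinfun.bilinear_simps J_scalar)
  qed
  have "norm (S \<omega> u) \<le> norm T * norm u" for u
  proof (rule tendsto_lowerbound)
    show "(\<lambda>j. norm (T (J j u) - J j (S \<omega> u)) + norm T * norm u) \<longlonglongrightarrow> norm T * norm u"
      using tendsto_add[OF tendsto_norm[OF lim[of u]] tendsto_const[of "norm T * norm u"]] by simp
    have "norm (S \<omega> u) \<le> norm (T (J j u) - J j (S \<omega> u)) + norm T * norm u" for j
      using norm_triangle_sub[of "J j (S \<omega> u)" "T (J j u)"] norm_blinfun[of T "J j u"]
      by (simp add: nJ norm_minus_commute)
    then show "\<forall>\<^sub>F j in sequentially. norm (S \<omega> u) \<le> norm (T (J j u) - J j (S \<omega> u)) + norm T * norm u"
      by simp
  qed simp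
  then show ?thesis by (intro norm_blinfun_bound) (auto simp: mult.commute)
qed

section \<open>Norm limits of the group algebra\<close>

text \<open>
  One element of the group algebra has to approximate \<open>T\<close> and all the \<open>S(\<omega>)\<close> at once,
  uniformly in \<open>\<omega>\<close>. This makes the matrix elements of \<open>S(\<omega>)\<close> uniform limits of
  trigonometric polynomials.
\<close>

definition group_algebra_limit ::
    "('g::group_add wreath ell2 \<Rightarrow>\<^sub>L 'g wreath ell2) \<Rightarrow> (('g \<Rightarrow> real) \<Rightarrow> 'g ell2 \<Rightarrow>\<^sub>L 'g ell2) \<Rightarrow> bool" where
  "group_algebra_limit T S \<longleftrightarrow> (\<forall>e>0. \<exists>T' S'. group_algebra_pair T' S' \<and>
     norm (T - T') \<le> e \<and> (\<forall>\<omega>. norm (S \<omega> - S' \<omega>) \<le> e))"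

lemma group_algebra_limitE:
  assumes "group_algebra_limit T S" "e > 0"
  obtains T' S' where "group_algebra_pair T' S'" "norm (T - T') \<le> e" "\<And>\<omega>. norm (S \<omega> - S' \<omega>) \<le> e"
  using assms unfolding group_algebra_limit_def by blast

lemma group_algebra_pair_limit: "group_algebra_pair T S \<Longrightarrow> group_algebra_limit T S"
  unfolding group_algebra_limit_def by (intro allI impI exI[of _ T] exI[of _ S]) auto

lemma group_algebra_limit_norm_le:
  fixes S :: "('g::{group_add,countable} \<Rightarrow> real) \<Rightarrow> 'g ell2 \<Rightarrow>\<^sub>L 'g ell2"
  assumes "group_algebra_limit T S"
  shows "norm (S \<omega>) \<le> norm T"
proof (rule field_le_epsilon)
  fix e :: real assume "e > 0"
  then obtain T' S' where T': "group_algebra_pair T' S'" "norm (T - T') \<le> e / 2" "\<And>\<omega>. norm (S \<omega> - S' \<omega>) \<le> e / 2"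
    using group_algebra_limitE[OF assms, of "e / 2"] by auto
  have "norm (S \<omega>) \<le> norm (S' \<omega>) + e / 2" using norm_triangle_sub[of "S \<omega>" "S' \<omega>"] T'(3)[of \<omega>] by linarith
  also have "norm (S' \<omega>) \<le> norm T'" by (rule group_algebra_pair_norm_le[OF T'(1)])
  also have "norm T' \<le> norm T + e / 2" using norm_triangle_sub[of T' T] T'(2) by (simp add: norm_minus_commute)
  finally show "norm (S \<omega>) \<le> norm T + e" by simp
qed

lemma group_algebra_limit_scalar:
  "group_algebra_limit (scalar c :: 'g::group_add wreath ell2 \<Rightarrow>\<^sub>L 'g wreath ell2) (\<lambda>\<omega>. scalar c)"
proof -
  have "scalar c o\<^sub>L left_regular (0 :: 'g wreath) = scalar c"
    by (rule blinfun_eqI, rule ell2_eqI) (simp add: scalar_apply left_regular_apply)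
  moreover have "scalar c o\<^sub>L wreath_rep \<omega> 0 = scalar c" for \<omega> :: "'g \<Rightarrow> real"
    by (rule blinfun_eqI, rule ell2_eqI) (simp add: scalar_apply wreath_rep_apply zero_wreath_def lamp_phase_0)
  ultimately show ?thesis
    using group_algebra_pair_limit[OF group_algebra_pair.gen[of c "0 :: 'g wreath"]] by simp
qed

lemma group_algebra_limit_add:
  assumes "group_algebra_limit T1 S1" "group_algebra_limit T2 S2"
  shows "group_algebra_limit (T1 + T2) (\<lambda>\<omega>. S1 \<omega> + S2 \<omega>)"
  unfolding group_algebra_limit_def
proof (intro allI impI)
  fix e :: real assume "e > 0"
  then obtain T1' S1' T2' S2' where
    1: "group_algebra_pair T1' S1'" "norm (T1 - T1') \<le> e / 2" "\<And>\<omega>. norm (S1 \<omega> - S1' \<omega>) \<le> e / 2" and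
    2: "group_algebra_pair T2' S2'" "norm (T2 - T2') \<le> e / 2" "\<And>\<omega>. norm (S2 \<omega> - S2' \<omega>) \<le> e / 2"
    using group_algebra_limitE[OF assms(1), of "e / 2"] group_algebra_limitE[OF assms(2), of "e / 2"]
    by (metis half_gt_zero)
  have "norm (T1 + T2 - (T1' + T2')) \<le> e"
    using norm_diff_triangle_ineq[of T1 T2 T1' T2'] 1(2) 2(2) by linarith
  moreover have "norm (S1 \<omega> + S2 \<omega> - (S1' \<omega> + S2' \<omega>)) \<le> e" for \<omega>
    using norm_diff_triangle_ineq[of "S1 \<omega>" "S2 \<omega>" "S1' \<omega>" "S2' \<omega>"] 1(3)[of \<omega>] 2(3)[of \<omega>] by linarith
  ultimately show "\<exists>T' S'. group_algebra_pair T' S' \<and> norm (T1 + T2 - T') \<le> e \<and>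
      (\<forall>\<omega>. norm (S1 \<omega> + S2 \<omega> - S' \<omega>) \<le> e)"
    using group_algebra_pair.add[OF 1(1) 2(1)] by blast
qed

lemma norm_compose_diff_le:
  assumes "norm (A - A') \<le> e" "norm (B - B') \<le> e" "norm A \<le> K" "norm B' \<le> K" "e \<ge> 0"
  shows "norm ((A o\<^sub>L B) - (A' o\<^sub>L B')) \<le> 2 * K * e"
proof -
  have "(A o\<^sub>L B) - (A' o\<^sub>L B') = (A o\<^sub>L (B - B')) + ((A - A') o\<^sub>L B')"
    by (rule blinfun_eqI) (simp add: blinfun.bilinear_simps)
  also have "norm \<dots> \<le> norm A * norm (B - B') + norm (A - A') * norm B'"
    by (intro norm_triangle_le add_mono norm_blinfun_compose)
  also have "\<dots> \<le> K * e + e * K"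
    using assms order_trans[OF norm_ge_zero assms(3)] by (intro add_mono mult_mono) auto
  finally show ?thesis by simp
qed

lemma group_algebra_limit_compose:
  fixes T1 T2 :: "'g::{group_add,countable} wreath ell2 \<Rightarrow>\<^sub>L 'g wreath ell2"
  assumes "group_algebra_limit T1 S1" "group_algebra_limit T2 S2"
  shows "group_algebra_limit (T1 o\<^sub>L T2) (\<lambda>\<omega>. S1 \<omega> o\<^sub>L S2 \<omega>)"
  unfolding group_algebra_limit_def
proof (intro allI impI)
  fix e :: real assume e: "e > 0"
  define K where "K = norm T1 + norm T2 + 1"
  have K: "K \<ge> 1" by (simp add: K_def)
  define d where "d = min 1 (e / (2 * K))"
  have d: "0 < d" "d \<le> 1" "2 * K * d \<le> e"
    using e K by (auto simp: d_def min_def field_simps)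
  obtain T1' S1' where 1: "group_algebra_pair T1' S1'" "norm (T1 - T1') \<le> d" "\<And>\<omega>. norm (S1 \<omega> - S1' \<omega>) \<le> d"
    using group_algebra_limitE[OF assms(1) d(1)] by blast
  obtain T2' S2' where 2: "group_algebra_pair T2' S2'" "norm (T2 - T2') \<le> d" "\<And>\<omega>. norm (S2 \<omega> - S2' \<omega>) \<le> d"
    using group_algebra_limitE[OF assms(2) d(1)] by blast
  have T2': "norm T2' \<le> K"
    using norm_triangle_sub[of T2' T2] 2(2) d(2) norm_ge_zero[of T1] unfolding K_def norm_minus_commute[of T2' T2]
    by linarith
  have "norm ((T1 o\<^sub>L T2) - (T1' o\<^sub>L T2')) \<le> e"
    using norm_compose_diff_le[OF 1(2) 2(2) _ T2'] d by (simp add: K_def)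
  moreover have "norm ((S1 \<omega> o\<^sub>L S2 \<omega>) - (S1' \<omega> o\<^sub>L S2' \<omega>)) \<le> e" for \<omega>
  proof -
    have "norm (S1 \<omega>) \<le> K" using group_algebra_limit_norm_le[OF assms(1), of \<omega>] norm_ge_zero[of T2] unfolding K_def by linarith
    moreover have "norm (S2' \<omega>) \<le> K" using group_algebra_pair_norm_le[OF 2(1), of \<omega>] T2' by linarith
    ultimately show ?thesis using norm_compose_diff_le[OF 1(3)[of \<omega>] 2(3)[of \<omega>], of K] d by simp
  qed
  ultimately show "\<exists>T' S'. group_algebra_pair T' S' \<and> norm ((T1 o\<^sub>L T2) - T') \<le> e \<and>
      (\<forall>\<omega>. norm ((S1 \<omega> o\<^sub>L S2 \<omega>) - S' \<omega>) \<le> e)"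
    using group_algebra_pair_compose[OF 1(1) 2(1)] by blast
qed

lemma group_algebra_limit_diff:
  fixes T1 T2 :: "'g::{group_add,countable} wreath ell2 \<Rightarrow>\<^sub>L 'g wreath ell2"
  assumes "group_algebra_limit T1 S1" "group_algebra_limit T2 S2"
  shows "group_algebra_limit (T1 - T2) (\<lambda>\<omega>. S1 \<omega> - S2 \<omega>)"
proof -
  have "T1 - T2 = T1 + (scalar (- 1) o\<^sub>L T2)"
    by (rule blinfun_eqI, rule ell2_eqI) (simp add: blinfun.bilinear_simps scalar_apply Rep_ell2_diff Rep_ell2_add)
  moreover have "S1 \<omega> - S2 \<omega> = S1 \<omega> + (scalar (- 1) o\<^sub>L S2 \<omega>)" for \<omega>
    by (rule blinfun_eqI, rule ell2_eqI) (simp add: blinfun.bilinear_simps scalar_apply Rep_ell2_diff Rep_ell2_add)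
  ultimately show ?thesis
    using group_algebra_limit_add[OF assms(1) group_algebra_limit_compose[OF group_algebra_limit_scalar assms(2)], of "- 1"]
    by (simp only:)
qed

text \<open>
  Pointwise convergence of \<open>Sn i \<omega>\<close> is enough, because the norm bound makes it as fast as
  that of \<open>Tn i\<close>, uniformly in \<open>\<omega>\<close>.
\<close>

lemma group_algebra_limit_closed:
  fixes T :: "'g::{group_add,countable} wreath ell2 \<Rightarrow>\<^sub>L 'g wreath ell2"
  assumes F: "F \<noteq> bot"
    and i: "\<forall>\<^sub>F i in F. group_algebra_limit (Tn i) (Sn i)"
    and T: "(Tn \<longlongrightarrow> T) F" and S: "\<And>\<omega>. ((\<lambda>i. Sn i \<omega>) \<longlongrightarrow> S \<omega>) F"
  shows "group_algebra_limit T S"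
  unfolding group_algebra_limit_def
proof (intro allI impI)
  fix e :: real assume e: "e > 0"
  have ev: "\<forall>\<^sub>F i in F. norm (Tn i - T) < e / 4"
    using tendstoD[OF T, of "e / 4"] e by (simp add: dist_norm)
  then obtain i where i0: "norm (Tn i - T) < e / 4" "group_algebra_limit (Tn i) (Sn i)"
    using eventually_happens'[OF F eventually_conj[OF ev i]] by blast
  have S2: "norm (S \<omega> - Sn i \<omega>) \<le> e / 2" for \<omega>
  proof (rule tendsto_upperbound)
    show "((\<lambda>k. norm (Sn k \<omega> - Sn i \<omega>)) \<longlongrightarrow> norm (S \<omega> - Sn i \<omega>)) F"
      by (intro tendsto_intros S)
    show "\<forall>\<^sub>F k in F. norm (Sn k \<omega> - Sn i \<omega>) \<le> e / 2"
      using ev i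
    proof eventually_elim
      case (elim k)
      have "norm (Sn k \<omega> - Sn i \<omega>) \<le> norm (Tn k - Tn i)"
        using group_algebra_limit_norm_le[OF group_algebra_limit_diff[OF elim(2) i0(2)]] .
      also have "\<dots> \<le> e / 2"
        using elim(1) i0(1) norm_triangle_ineq4[of "Tn k - T" "Tn i - T"] by simp
      finally show ?case .
    qed
  qed (rule F)
  obtain T' S' where T': "group_algebra_pair T' S'" "norm (Tn i - T') \<le> e / 2" "\<And>\<omega>. norm (Sn i \<omega> - S' \<omega>) \<le> e / 2"
    using group_algebra_limitE[OF i0(2), of "e / 2"] e by auto
  have "norm (T - T') \<le> e"
    using norm_triangle_ineq[of "T - Tn i" "Tn i - T'"] i0(1) T'(2) e by (simp add: norm_minus_commute)
  moreover have "norm (S \<omega> - S' \<omega>) \<le> e" for \<omega>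
    using norm_triangle_ineq[of "S \<omega> - Sn i \<omega>" "Sn i \<omega> - S' \<omega>"] S2[of \<omega>] T'(3)[of \<omega>] by simp
  ultimately show "\<exists>T' S'. group_algebra_pair T' S' \<and> norm (T - T') \<le> e \<and> (\<forall>\<omega>. norm (S \<omega> - S' \<omega>) \<le> e)"
    using T'(1) by blast
qed

section \<open>The operators M and H as limits of the group algebra\<close>

lemma bij_left_translation: "bij (\<lambda>y :: 'g::group_add. - x + y)"
  by (rule bij_betw_byWitness[where f' = "\<lambda>y. x + y"]) (auto simp: add.assoc[symmetric])

lemma norm_left_regular_le: "norm (left_regular x) \<le> 1"
proof (rule norm_blinfun_bound)
  fix u
  show "norm (left_regular x u) \<le> 1 * norm u"
    using infsum_reindex_bij_betw[OF bij_left_translation, of "\<lambda>y. (norm (Rep_ell2 u y))\<^sup>2" x]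
    by (simp add: norm_ell2_eq left_regular_apply)
qed simp

lemma norm_wreath_rep_le: "norm (wreath_rep \<omega> w) \<le> 1"
proof (rule norm_blinfun_bound)
  fix u
  have "norm (wreath_rep \<omega> w u) \<le> 1 * norm (left_regular (position w) u)"
    by (rule norm_ell2_le_cmult) (simp_all add: wreath_rep_apply left_regular_apply norm_mult)
  also have "norm (left_regular (position w) u) \<le> 1 * norm u"
    using norm_blinfun[of "left_regular (position w)" u] norm_left_regular_le[of "position w"]
    by (meson mult_right_mono norm_ge_zero order_trans)
  finally show "norm (wreath_rep \<omega> w u) \<le> 1 * norm u" by simp
qed simp

lemma weighted_sum_has_sum:
  fixes U :: "'i \<Rightarrow> 'a ell2 \<Rightarrow>\<^sub>L 'a ell2"
  assumes "(\<lambda>i. norm (c i)) summable_on A" "\<And>i. norm (U i) \<le> 1"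
  shows "((\<lambda>i. scalar (c i) o\<^sub>L U i) has_sum (\<Sum>\<^sub>\<infinity>i\<in>A. scalar (c i) o\<^sub>L U i)) A"
proof -
  have "norm (scalar (c i) o\<^sub>L U i) \<le> norm (c i)" for i
    using norm_blinfun_compose[of "scalar (c i)" "U i"] mult_left_mono[OF assms(2)[of i], of "norm (c i)"]
    by (simp add: norm_scalar)
  then have "(\<lambda>i. norm (scalar (c i) o\<^sub>L U i)) summable_on A"
    by (intro summable_on_comparison_test[OF assms(1)]) auto
  then show ?thesis by (rule has_sum_infsum[OF abs_summable_summable])
qed

lemma has_sum_blinfun_apply:
  fixes T :: "'i \<Rightarrow> 'a::real_normed_vector \<Rightarrow>\<^sub>L 'b::real_normed_vector"
  assumes "(T has_sum S) A"
  shows "((\<lambda>i. T i u) has_sum S u) A"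
  using has_sum_bounded_linear[OF blinfun.bounded_linear_left assms] .

lemma has_sum_Rep_ell2:
  assumes "(T has_sum S) A"
  shows "((\<lambda>i. Rep_ell2 (T i) x) has_sum Rep_ell2 S x) A"
  using has_sum_bounded_linear[OF bounded_linear_Rep_ell2 assms] .

lemma convolution_op_has_sum:
  assumes "(\<lambda>x. norm (m x)) summable_on UNIV"
  shows "((\<lambda>x. scalar (m x) o\<^sub>L left_regular x) has_sum convolution_op m) UNIV"
  unfolding convolution_op_def by (rule weighted_sum_has_sum[OF assms norm_left_regular_le])

lemma convolution_op_delta:
  assumes "(\<lambda>x. norm (m x)) summable_on UNIV"
  shows "Rep_ell2 (convolution_op m (delta a)) x = m (x - a)"
proof -
  have "((\<lambda>y. Rep_ell2 ((scalar (m y) o\<^sub>L left_regular y) (delta a)) x) has_sum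
      Rep_ell2 (convolution_op m (delta a)) x) UNIV"
    by (intro has_sum_Rep_ell2 has_sum_blinfun_apply convolution_op_has_sum assms)
  moreover have "((\<lambda>y. Rep_ell2 ((scalar (m y) o\<^sub>L left_regular y) (delta a)) x) has_sum m (x - a)) UNIV"
  proof (rule has_sum_finite_neutralI[where B = "{x - a}"])
    fix y assume "y \<in> UNIV - {x - a}"
    then have "- y + x \<noteq> a" by (metis DiffD2 add_diff_cancel add_minus_cancel singletonI)
    then show "Rep_ell2 ((scalar (m y) o\<^sub>L left_regular y) (delta a)) x = 0"
      by (simp add: scalar_apply left_regular_apply Rep_delta)
  qed (simp_all add: scalar_apply left_regular_apply Rep_delta minus_diff_eq diff_add_cancel)
  ultimately show ?thesis by (rule has_sum_unique)
qed

text \<open>The matrix elements between \<open>\<delta>\<^sub>0\<close> and \<open>\<delta>\<^sub>x\<close> give back the symmetry of the measure.\<close>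

lemma self_adjoint_convolution_op_imp:
  assumes "(\<lambda>x. norm (m x)) summable_on UNIV" "self_adjoint (convolution_op m)"
  shows "m (- x) = cnj (m x)"
proof -
  have "cip (convolution_op m (delta 0)) (delta x) = cip (delta 0) (convolution_op m (delta x))"
    using assms(2) by (simp add: self_adjoint_def)
  then show ?thesis
    by (simp add: cip_delta_left cip_delta_right convolution_op_delta[OF assms(1)])
qed

lemma left_regular_adjoint: "left_regular x u \<bullet> v = u \<bullet> left_regular (- x) v"
  using infsum_reindex_bij_betw[OF bij_left_translation, of "\<lambda>y. Rep_ell2 u y \<bullet> Rep_ell2 v (x + y)" x]
  by (simp add: inner_ell2.rep_eq left_regular_apply add.assoc[symmetric])

lemma self_adjoint_convolution_op:
  assumes "(\<lambda>x. norm (m x)) summable_on UNIV" "\<And>x. m (- x) = cnj (m x)"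
  shows "self_adjoint (convolution_op m)"
  unfolding self_adjoint_iff complex_linear_def
proof (intro conjI allI)
  fix u v
  have s: "((\<lambda>x. scalar (m x) (left_regular x w)) has_sum convolution_op m w) UNIV" for w
    using has_sum_blinfun_apply[OF convolution_op_has_sum[OF assms(1)]] by simp
  have bij: "bij (uminus :: 'a \<Rightarrow> 'a)" by (rule bij_uminus)
  have "((\<lambda>x. scalar (m x) (left_regular x u) \<bullet> v) has_sum convolution_op m u \<bullet> v) UNIV"
    by (rule has_sum_bounded_linear[OF bounded_linear_inner_left s])
  then have "((\<lambda>x. scalar (m (- x)) (left_regular (- x) u) \<bullet> v) has_sum convolution_op m u \<bullet> v) UNIV"
    using has_sum_reindex_bij_betw[OF bij, of "\<lambda>x. scalar (m x) (left_regular x u) \<bullet> v"] by simp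
  moreover have "scalar (m (- x)) (left_regular (- x) u) \<bullet> v = u \<bullet> scalar (m x) (left_regular x v)" for x
    by (simp add: assms(2) inner_scalar left_regular_adjoint left_regular_scalar)
  ultimately have "((\<lambda>x. u \<bullet> scalar (m x) (left_regular x v)) has_sum convolution_op m u \<bullet> v) UNIV"
    by simp
  moreover have "((\<lambda>x. u \<bullet> scalar (m x) (left_regular x v)) has_sum u \<bullet> convolution_op m v) UNIV"
    by (rule has_sum_bounded_linear[OF bounded_linear_inner_right s])
  ultimately show "convolution_op m u \<bullet> v = u \<bullet> convolution_op m v" by (rule has_sum_unique)
  fix c
  have "((\<lambda>x. scalar c (scalar (m x) (left_regular x u))) has_sum scalar c (convolution_op m u)) UNIV"
    by (rule has_sum_bounded_linear[OF blinfun.bounded_linear_right s])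
  then have "((\<lambda>x. scalar (m x) (left_regular x (scalar c u))) has_sum scalar c (convolution_op m u)) UNIV"
    by (simp add: scalar_mult left_regular_scalar mult.commute)
  then show "convolution_op m (scalar c u) = scalar c (convolution_op m u)"
    using s has_sum_unique by blast
qed

lemma pushforward_image:
  assumes "inj \<iota>"
  shows "pushforward \<iota> m (\<iota> x) = m x"
proof -
  have "\<iota> -` {\<iota> x} = {x}" using assms by (auto simp: inj_def)
  then show ?thesis by (simp add: pushforward_def)
qed

lemma pushforward_outside:
  assumes "w \<notin> range \<iota>"
  shows "pushforward \<iota> m w = 0"
proof -
  have "\<iota> -` {w} = {}" using assms by auto
  then show ?thesis by (simp add: pushforward_def)
qed

text \<open>The weight \<open>\<phi>\<close> allows the same reindexing for norms of the masses and for multiples of operators.\<close>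

lemma has_sum_pushforward:
  assumes "inj \<iota>" "\<And>w. \<phi> 0 w = 0"
  shows "((\<lambda>w. \<phi> (pushforward \<iota> m w) w) has_sum s) UNIV \<longleftrightarrow> ((\<lambda>x. \<phi> (m x) (\<iota> x)) has_sum s) UNIV"
proof -
  have "((\<lambda>w. \<phi> (pushforward \<iota> m w) w) has_sum s) UNIV \<longleftrightarrow> ((\<lambda>w. \<phi> (pushforward \<iota> m w) w) has_sum s) (range \<iota>)"
    by (rule has_sum_cong_neutral) (auto simp: pushforward_outside assms(2))
  also have "\<dots> \<longleftrightarrow> ((\<lambda>x. \<phi> (m x) (\<iota> x)) has_sum s) UNIV"
    unfolding has_sum_reindex[OF assms(1)] by (simp add: o_def pushforward_image[OF assms(1)])
  finally show ?thesis .
qed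

lemma inj_embed_base: "inj embed_base"
  by (simp add: inj_def embed_base_def)

lemma inj_embed_lamp: "inj embed_lamp"
  by (auto simp: inj_def embed_lamp_def dest: arg_cong[where f = "\<lambda>l. Poly_Mapping.lookup l 0"])

lemma uminus_embed: "- embed_base g = embed_base (- g)" "- embed_lamp n = embed_lamp (- n)"
  by (simp_all add: uminus_wreath_def embed_base_def embed_lamp_def lamp_shift_simps single_uminus)

lemma pushforward_adjoint:
  fixes \<iota> :: "'a::group_add \<Rightarrow> 'b::group_add"
  assumes "inj \<iota>" "\<And>x. - \<iota> x = \<iota> (- x)" "\<And>x. m (- x) = cnj (m x)"
  shows "pushforward \<iota> m (- w) = cnj (pushforward \<iota> m w)"
proof (cases "w \<in> range \<iota>")
  case True
  then show ?thesis by (auto simp: assms(2,3) pushforward_image[OF assms(1)])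
next
  case False
  have "- w \<notin> range \<iota>"
  proof
    assume "- w \<in> range \<iota>"
    then obtain x where "- w = \<iota> x" by blast
    then have "w = \<iota> (- x)" using assms(2)[of x] by (metis minus_minus)
    then show False using False by blast
  qed
  then show ?thesis using False by (simp add: pushforward_outside)
qed

context
  fixes m\<^sub>\<Gamma> :: "'g::{group_add,countable} \<Rightarrow> complex" and m\<^sub>Z :: "int \<Rightarrow> complex"
  assumes m\<Gamma>: "(\<lambda>x. norm (m\<^sub>\<Gamma> x)) summable_on UNIV"
    and mZ: "(\<lambda>n. norm (m\<^sub>Z n)) summable_on UNIV"
begin

lemma wreath_measure_summable: "(\<lambda>w :: 'g wreath. norm (wreath_measure m\<^sub>\<Gamma> m\<^sub>Z w)) summable_on UNIV"
proof -
  have "((\<lambda>w :: 'g wreath. norm (pushforward embed_base m\<^sub>\<Gamma> w)) has_sum (\<Sum>\<^sub>\<infinity>x. norm (m\<^sub>\<Gamma> x))) UNIV"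
    by (subst has_sum_pushforward[OF inj_embed_base, where \<phi> = "\<lambda>c _. norm c"]) (use m\<Gamma> in auto)
  moreover have "((\<lambda>w :: 'g wreath. norm (pushforward embed_lamp m\<^sub>Z w)) has_sum (\<Sum>\<^sub>\<infinity>n. norm (m\<^sub>Z n))) UNIV"
    by (subst has_sum_pushforward[OF inj_embed_lamp, where \<phi> = "\<lambda>c _. norm c"]) (use mZ in auto)
  ultimately have "(\<lambda>w :: 'g wreath. norm (pushforward embed_base m\<^sub>\<Gamma> w) + norm (pushforward embed_lamp m\<^sub>Z w)) summable_on UNIV"
    by (intro summable_on_add) (auto intro: has_sum_imp_summable)
  then show ?thesis
    by (rule summable_on_comparison_test) (auto simp: wreath_measure_def norm_triangle_ineq)
qed

lemma convolution_op_wreath_measure: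
  "convolution_op (wreath_measure m\<^sub>\<Gamma> m\<^sub>Z) =
    (\<Sum>\<^sub>\<infinity>g. scalar (m\<^sub>\<Gamma> g) o\<^sub>L left_regular (embed_base g)) + (\<Sum>\<^sub>\<infinity>n. scalar (m\<^sub>Z n) o\<^sub>L left_regular (embed_lamp n))"
proof -
  have "((\<lambda>w :: 'g wreath. scalar (pushforward embed_base m\<^sub>\<Gamma> w) o\<^sub>L left_regular w) has_sum
      (\<Sum>\<^sub>\<infinity>g. scalar (m\<^sub>\<Gamma> g) o\<^sub>L left_regular (embed_base g))) UNIV"
    by (subst has_sum_pushforward[OF inj_embed_base, where \<phi> = "\<lambda>c w. scalar c o\<^sub>L left_regular w"])
      (simp_all add: scalar_0 weighted_sum_has_sum m\<Gamma> norm_left_regular_le)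
  moreover have "((\<lambda>w :: 'g wreath. scalar (pushforward embed_lamp m\<^sub>Z w) o\<^sub>L left_regular w) has_sum
      (\<Sum>\<^sub>\<infinity>n. scalar (m\<^sub>Z n) o\<^sub>L left_regular (embed_lamp n))) UNIV"
    by (subst has_sum_pushforward[OF inj_embed_lamp, where \<phi> = "\<lambda>c w. scalar c o\<^sub>L left_regular w"])
      (simp_all add: scalar_0 weighted_sum_has_sum mZ norm_left_regular_le)
  ultimately have "((\<lambda>w :: 'g wreath. (scalar (pushforward embed_base m\<^sub>\<Gamma> w) o\<^sub>L left_regular w) +
        (scalar (pushforward embed_lamp m\<^sub>Z w) o\<^sub>L left_regular w)) has_sum
      (\<Sum>\<^sub>\<infinity>g. scalar (m\<^sub>\<Gamma> g) o\<^sub>L left_regular (embed_base g)) + (\<Sum>\<^sub>\<infinity>n. scalar (m\<^sub>Z n) o\<^sub>L left_regular (embed_lamp n))) UNIV"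
    by (rule has_sum_add)
  then have "((\<lambda>w :: 'g wreath. scalar (wreath_measure m\<^sub>\<Gamma> m\<^sub>Z w) o\<^sub>L left_regular w) has_sum
      (\<Sum>\<^sub>\<infinity>g. scalar (m\<^sub>\<Gamma> g) o\<^sub>L left_regular (embed_base g)) + (\<Sum>\<^sub>\<infinity>n. scalar (m\<^sub>Z n) o\<^sub>L left_regular (embed_lamp n))) UNIV"
    by (simp add: wreath_measure_def scalar_add bounded_bilinear.add_left[OF bounded_bilinear_blinfun_compose])
  then show ?thesis unfolding convolution_op_def by (rule infsumI)
qed

lemma potential_has_sum:
  "((\<lambda>n. m\<^sub>Z n * exp (2 * of_real pi * \<i> * of_int n * of_real u)) has_sum potential m\<^sub>Z u) UNIV"
proof -
  have "norm (exp (2 * of_real pi * \<i> * of_int n * of_real u)) = 1" for n :: int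
    by (simp add: norm_exp_eq_Re)
  then have "(\<lambda>n. norm (m\<^sub>Z n * exp (2 * of_real pi * \<i> * of_int n * of_real u))) summable_on UNIV"
    using mZ by (simp add: norm_mult)
  then show ?thesis unfolding potential_def by (rule has_sum_infsum[OF abs_summable_summable])
qed

lemma norm_potential_le: "norm (potential m\<^sub>Z u) \<le> (\<Sum>\<^sub>\<infinity>n. norm (m\<^sub>Z n))"
  by (rule norm_infsum_le[OF potential_has_sum has_sum_infsum[OF mZ]])
    (simp add: norm_mult norm_exp_eq_Re)

lemma bounded_potential: "bounded (range (\<lambda>x. potential m\<^sub>Z (\<omega> x)))"
  using norm_potential_le by (auto simp: bounded_iff)

lemma random_hamiltonian_eq:
  "random_hamiltonian m\<^sub>\<Gamma> m\<^sub>Z \<omega> =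
    (\<Sum>\<^sub>\<infinity>g. scalar (m\<^sub>\<Gamma> g) o\<^sub>L wreath_rep \<omega> (embed_base g)) + (\<Sum>\<^sub>\<infinity>n. scalar (m\<^sub>Z n) o\<^sub>L wreath_rep \<omega> (embed_lamp n))"
proof -
  have "wreath_rep \<omega> (embed_base g) = left_regular g" for g
    by (rule blinfun_eqI, rule ell2_eqI)
      (simp add: wreath_rep_apply left_regular_apply embed_base_def lamp_phase_0)
  then have 1: "convolution_op m\<^sub>\<Gamma> = (\<Sum>\<^sub>\<infinity>g. scalar (m\<^sub>\<Gamma> g) o\<^sub>L wreath_rep \<omega> (embed_base g))"
    by (simp add: convolution_op_def)
  have 2: "Diag (\<lambda>x. potential m\<^sub>Z (\<omega> x)) = (\<Sum>\<^sub>\<infinity>n. scalar (m\<^sub>Z n) o\<^sub>L wreath_rep \<omega> (embed_lamp n))" (is "_ = ?S")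
  proof (rule blinfun_eqI, rule ell2_eqI)
    fix u h
    have "((\<lambda>n. Rep_ell2 ((scalar (m\<^sub>Z n) o\<^sub>L wreath_rep \<omega> (embed_lamp n)) u) h) has_sum Rep_ell2 (?S u) h) UNIV"
      by (intro has_sum_Rep_ell2 has_sum_blinfun_apply weighted_sum_has_sum mZ norm_wreath_rep_le)
    moreover have "Rep_ell2 ((scalar (m\<^sub>Z n) o\<^sub>L wreath_rep \<omega> (embed_lamp n)) u) h =
        m\<^sub>Z n * exp (2 * of_real pi * \<i> * of_int n * of_real (\<omega> h)) * Rep_ell2 u h" for n
      by (simp add: scalar_apply wreath_rep_apply embed_lamp_def lamp_phase_def lamp_pairing_single mult.assoc)
    ultimately have "Rep_ell2 (?S u) h = potential m\<^sub>Z (\<omega> h) * Rep_ell2 u h"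
      using has_sum_cmult_left[OF potential_has_sum[of "\<omega> h"], of "Rep_ell2 u h"] has_sum_unique by fastforce
    then show "Rep_ell2 (Diag (\<lambda>x. potential m\<^sub>Z (\<omega> x)) u) h = Rep_ell2 (?S u) h"
      by (simp add: Diag_apply[OF bounded_potential])
  qed
  show ?thesis unfolding random_hamiltonian_def 1 2 ..
qed

lemma group_algebra_limit_infsum:
  fixes w :: "'i \<Rightarrow> 'g wreath"
  assumes c: "(\<lambda>i. norm (c i)) summable_on UNIV"
  shows "group_algebra_limit (\<Sum>\<^sub>\<infinity>i. scalar (c i) o\<^sub>L left_regular (w i))
    (\<lambda>\<omega>. \<Sum>\<^sub>\<infinity>i. scalar (c i) o\<^sub>L wreath_rep \<omega> (w i))"
proof (rule group_algebra_limit_closed[where F = "finite_subsets_at_top UNIV"])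
  show "((\<lambda>I. \<Sum>i\<in>I. scalar (c i) o\<^sub>L left_regular (w i)) \<longlongrightarrow> (\<Sum>\<^sub>\<infinity>i. scalar (c i) o\<^sub>L left_regular (w i)))
      (finite_subsets_at_top UNIV)"
    using weighted_sum_has_sum[OF c norm_left_regular_le, of w] by (simp add: has_sum_def)
  show "((\<lambda>I. \<Sum>i\<in>I. scalar (c i) o\<^sub>L wreath_rep \<omega> (w i)) \<longlongrightarrow> (\<Sum>\<^sub>\<infinity>i. scalar (c i) o\<^sub>L wreath_rep \<omega> (w i)))
      (finite_subsets_at_top UNIV)" for \<omega>
    using weighted_sum_has_sum[OF c norm_wreath_rep_le, of "\<lambda>_. \<omega>" w] by (simp add: has_sum_def)
  have "group_algebra_limit (\<Sum>i\<in>I. scalar (c i) o\<^sub>L left_regular (w i)) (\<lambda>\<omega>. \<Sum>i\<in>I. scalar (c i) o\<^sub>L wreath_rep \<omega> (w i))"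
    if "finite I" for I
    using that
  proof (induction I rule: finite_induct)
    case empty
    then show ?case using group_algebra_limit_scalar[where 'g = 'g, of 0] by (simp add: scalar_0)
  next
    case (insert i I)
    then show ?case
      by (simp add: group_algebra_limit_add group_algebra_pair_limit group_algebra_pair.gen)
  qed
  then show "\<forall>\<^sub>F I in finite_subsets_at_top UNIV. group_algebra_limit (\<Sum>i\<in>I. scalar (c i) o\<^sub>L left_regular (w i))
      (\<lambda>\<omega>. \<Sum>i\<in>I. scalar (c i) o\<^sub>L wreath_rep \<omega> (w i))"
    by (intro eventually_finite_subsets_at_top_weakI)
qed simp

lemma group_algebra_limit_M_H:
  "group_algebra_limit (convolution_op (wreath_measure m\<^sub>\<Gamma> m\<^sub>Z)) (random_hamiltonian m\<^sub>\<Gamma> m\<^sub>Z)"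
  unfolding convolution_op_wreath_measure random_hamiltonian_eq[abs_def]
  by (intro group_algebra_limit_add group_algebra_limit_infsum m\<Gamma> mZ)

context
  assumes sa\<Gamma>: "self_adjoint (convolution_op m\<^sub>\<Gamma>)" and saZ: "self_adjoint (convolution_op m\<^sub>Z)"
begin

lemma self_adjoint_M: "self_adjoint (convolution_op (wreath_measure m\<^sub>\<Gamma> m\<^sub>Z :: 'g wreath \<Rightarrow> complex))"
proof (rule self_adjoint_convolution_op[OF wreath_measure_summable])
  fix w :: "'g wreath"
  show "wreath_measure m\<^sub>\<Gamma> m\<^sub>Z (- w) = cnj (wreath_measure m\<^sub>\<Gamma> m\<^sub>Z w)"
    unfolding wreath_measure_def complex_cnj_add
    by (intro arg_cong2[where f = "(+)"] pushforward_adjoint inj_embed_base inj_embed_lamp uminus_embed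
        self_adjoint_convolution_op_imp m\<Gamma> mZ sa\<Gamma> saZ)
qed

lemma cnj_potential: "cnj (potential m\<^sub>Z u) = potential m\<^sub>Z u"
proof -
  have "((\<lambda>n. cnj (m\<^sub>Z n * exp (2 * of_real pi * \<i> * of_int n * of_real u))) has_sum cnj (potential m\<^sub>Z u)) UNIV"
    by (rule has_sum_bounded_linear[OF bounded_linear_cnj potential_has_sum])
  then have "((\<lambda>n. m\<^sub>Z (- n) * exp (2 * of_real pi * \<i> * of_int (- n) * of_real u)) has_sum cnj (potential m\<^sub>Z u)) UNIV"
    by (simp add: self_adjoint_convolution_op_imp[OF mZ saZ] exp_cnj)
  then have "((\<lambda>n. m\<^sub>Z n * exp (2 * of_real pi * \<i> * of_int n * of_real u)) has_sum cnj (potential m\<^sub>Z u)) UNIV"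
    using has_sum_reindex_bij_betw[OF bij_uminus, of "\<lambda>n. m\<^sub>Z n * exp (2 * of_real pi * \<i> * of_int n * of_real u)"]
    by blast
  then show ?thesis using potential_has_sum has_sum_unique by blast
qed

lemma self_adjoint_H: "self_adjoint (random_hamiltonian m\<^sub>\<Gamma> m\<^sub>Z \<omega>)"
proof -
  define D where "D = Diag (\<lambda>x. potential m\<^sub>Z (\<omega> x))"
  have D: "Rep_ell2 (D u) x = potential m\<^sub>Z (\<omega> x) * Rep_ell2 u x" for u x
    unfolding D_def by (rule Diag_apply[OF bounded_potential])
  have "Im (potential m\<^sub>Z u) = 0" for u
    using arg_cong[OF cnj_potential[of u], of Im] by simp
  then have "D u \<bullet> v = u \<bullet> D v" for u v
    unfolding inner_ell2.rep_eq by (intro infsum_cong) (simp add: D inner_complex_def)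
  moreover have "D (scalar c u) = scalar c (D u)" for c u
    by (rule ell2_eqI) (simp add: D scalar_apply)
  ultimately show ?thesis
    using sa\<Gamma> unfolding random_hamiltonian_def D_def[symmetric] self_adjoint_iff complex_linear_def
    by (simp add: blinfun.bilinear_simps inner_add_left inner_add_right)
qed

lemma group_algebra_limit_poly_op:
  "group_algebra_limit (poly_op p (convolution_op (wreath_measure m\<^sub>\<Gamma> m\<^sub>Z)))
    (\<lambda>\<omega>. poly_op p (random_hamiltonian m\<^sub>\<Gamma> m\<^sub>Z \<omega>))"
proof (induction p)
  case 0
  then show ?case using group_algebra_limit_scalar[where 'g = 'g, of 0] by (simp add: poly_op_0 scalar_0)
next
  case (pCons a p)
  have eq: "poly_op (pCons a p) T = scalar a + (T o\<^sub>L poly_op p T)" if "self_adjoint T" for T :: "'b ell2 \<Rightarrow>\<^sub>L 'b ell2"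
    using that by (intro blinfun_eqI) (simp add: self_adjoint_iff poly_op_pCons blinfun.bilinear_simps)
  show ?case
    unfolding eq[OF self_adjoint_M] eq[OF self_adjoint_H]
    by (intro group_algebra_limit_add group_algebra_limit_scalar group_algebra_limit_compose
        group_algebra_limit_M_H pCons.IH)
qed

text \<open>
  The inclusion for every \<open>\<omega>\<close> makes \<open>f(H(\<omega>))\<close> meaningful everywhere; with exceptional
  \<open>\<omega>\<close>, on which \<open>f\<close> would be arbitrary on part of the spectrum, its matrix elements need
  not be measurable.
\<close>

lemma spectrum_H_subset_spectrum_M:
  "spectrum (random_hamiltonian m\<^sub>\<Gamma> m\<^sub>Z \<omega>) \<subseteq> spectrum (convolution_op (wreath_measure m\<^sub>\<Gamma> m\<^sub>Z :: 'g wreath \<Rightarrow> complex))"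
  by (rule spectrum_mono[OF self_adjoint_M self_adjoint_H group_algebra_limit_norm_le[OF group_algebra_limit_poly_op]])

text \<open>The same polynomials compute \<open>f(M)\<close> and every \<open>f(H(\<omega>))\<close>.\<close>

lemma group_algebra_limit_fun_calc:
  assumes "smooth_on_spectrum f (spectrum (convolution_op (wreath_measure m\<^sub>\<Gamma> m\<^sub>Z :: 'g wreath \<Rightarrow> complex)))"
  shows "group_algebra_limit (fun_calc f (convolution_op (wreath_measure m\<^sub>\<Gamma> m\<^sub>Z)))
    (\<lambda>\<omega>. fun_calc f (random_hamiltonian m\<^sub>\<Gamma> m\<^sub>Z \<omega>))"
proof -
  obtain p where p: "uniform_limit (spectrum (convolution_op (wreath_measure m\<^sub>\<Gamma> m\<^sub>Z :: 'g wreath \<Rightarrow> complex)))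
      (\<lambda>n. poly (p n)) f sequentially"
    using smooth_on_spectrum_approx[OF self_adjoint_M assms] by blast
  show ?thesis
    by (rule group_algebra_limit_closed[OF sequentially_bot always_eventually[OF allI[OF group_algebra_limit_poly_op]]
        fun_calc_tendsto[OF self_adjoint_M p]
        fun_calc_tendsto[OF self_adjoint_H uniform_limit_on_subset[OF p spectrum_H_subset_spectrum_M]]])
qed

end

end

section \<open>Characters of the lamp group as an orthonormal system\<close>

definition unit_uniform :: "real measure" where
  "unit_uniform = restrict_space lborel {0..1}"

lemma prob_space_unit_uniform: "prob_space unit_uniform"
  by (rule prob_spaceI) (simp add: unit_uniform_def emeasure_restrict_space)

lemma measurable_unit_uniform:
  fixes f :: "real \<Rightarrow> 'b::topological_space"
  assumes "f \<in> borel_measurable borel"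
  shows "f \<in> borel_measurable unit_uniform"
  unfolding unit_uniform_def using assms by (intro measurable_restrict_space1) simp

lemma integral_unit_uniform_exp:
  assumes "n \<noteq> 0"
  shows "(\<integral>t. exp (2 * of_real pi * \<i> * of_int n * of_real t) \<partial>unit_uniform) = 0"
proof -
  define a where "a = 2 * of_real pi * \<i> * of_int n"
  have a: "a \<noteq> 0" using assms by (simp add: a_def)
  have "(\<integral>t. indicator {0..1} t *\<^sub>R exp (a * complex_of_real t) \<partial>lborel) =
      exp (a * complex_of_real 1) / a - exp (a * complex_of_real 0) / a"
  proof (rule integral_FTC_Icc)
    fix t :: real
    have "((\<lambda>z. exp (a * z) / a) has_field_derivative exp (a * complex_of_real t)) (at (complex_of_real t))"
      using a by (auto intro!: derivative_eq_intros simp del: times_divide_eq_right)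
    then show "((\<lambda>t. exp (a * complex_of_real t) / a) has_vector_derivative exp (a * complex_of_real t)) (at t within {0..1})"
      by (intro has_vector_derivative_real_field)
  qed (auto intro!: continuous_intros)
  also have "\<dots> = 0"
    using exp_integer_2pi[of "of_int n"] by (simp add: a_def ac_simps)
  finally show ?thesis
    by (simp add: unit_uniform_def integral_restrict_space a_def)
qed

lemma prob_space_uniform_product: "prob_space uniform_product"
  unfolding uniform_product_def using prob_space_unit_uniform
  by (intro prob_space_PiM) (simp add: unit_uniform_def)

lemma measurable_coordinate: "(\<lambda>\<omega>. \<omega> x) \<in> borel_measurable uniform_product"
proof -
  have "(\<lambda>\<omega>. \<omega> x) \<in> measurable uniform_product unit_uniform"
    unfolding uniform_product_def unit_uniform_def by (rule measurable_component_singleton) simp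
  moreover have "(\<lambda>t. t) \<in> borel_measurable unit_uniform" by (rule measurable_unit_uniform) simp
  ultimately show ?thesis using measurable_compose by blast
qed

lemma measurable_lamp_phase: "(\<lambda>\<omega>. lamp_phase \<omega> l g) \<in> borel_measurable uniform_product"
proof -
  have "(\<lambda>\<omega>. lamp_pairing l (\<lambda>x. \<omega> (- x + g))) \<in> borel_measurable uniform_product"
    unfolding lamp_pairing_def
    by (intro borel_measurable_sum borel_measurable_times borel_measurable_const measurable_coordinate)
  moreover have "(\<lambda>t. exp (2 * of_real pi * \<i> * complex_of_real t)) \<in> borel_measurable borel"
    by (intro borel_measurable_continuous_onI continuous_intros)
  ultimately show ?thesis unfolding lamp_phase_def by (rule measurable_compose)
qed

text \<open>The phase is a product of functions of distinct, hence independent, coordinates, each of mean zero.\<close>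

lemma integral_lamp_phase:
  fixes g :: "'g::{group_add,countable}"
  shows "(\<integral>\<omega>. lamp_phase \<omega> l g \<partial>uniform_product) = of_bool (l = 0)"
proof (cases "l = 0")
  case True
  interpret prob_space uniform_product by (rule prob_space_uniform_product)
  show ?thesis using True by (simp add: lamp_phase_0 prob_space)
next
  case False
  interpret U: prob_space unit_uniform by (rule prob_space_unit_uniform)
  interpret P: product_prob_space "\<lambda>_ :: 'g. unit_uniform" UNIV
    by (rule product_prob_spaceI) (rule prob_space_unit_uniform)
  interpret P: product_sigma_finite "\<lambda>_ :: 'g. unit_uniform" ..
  define Y where "Y = (\<lambda>x. - x + g) ` Poly_Mapping.keys l"
  define f where "f y t = exp (2 * of_real pi * \<i> * of_int (Poly_Mapping.lookup l (g - y)) * complex_of_real t)" for y t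
  have finY: "finite Y" by (simp add: Y_def)
  have inj: "inj_on (\<lambda>x. - x + g) A" for A by (simp add: inj_on_def)
  have fm: "f y \<in> borel_measurable unit_uniform" for y
    unfolding f_def by (rule measurable_unit_uniform) (intro borel_measurable_continuous_onI continuous_intros)
  have fint: "integrable unit_uniform (f y)" for y
    by (rule U.integrable_const_bound[where B = 1, OF _ fm]) (simp add: f_def norm_exp_eq_Re)
  have phase: "lamp_phase \<omega> l g = (\<Prod>y\<in>Y. f y (\<omega> y))" for \<omega>
    unfolding lamp_phase_def lamp_pairing_def Y_def prod.reindex[OF inj] o_def f_def
    by (simp add: exp_sum[symmetric] sum_distrib_left minus_add diff_conv_add_uminus[of g]
        del: add_uminus_conv_diff) (simp add: add.assoc[symmetric] mult.assoc)
  have "(\<integral>\<omega>. lamp_phase \<omega> l g \<partial>uniform_product) = (\<integral>\<omega>. (\<Prod>y\<in>Y. f y (restrict \<omega> Y y)) \<partial>PiM UNIV (\<lambda>_. unit_uniform))"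
    by (simp add: phase uniform_product_def unit_uniform_def)
  also have "\<dots> = (\<integral>\<omega>. (\<Prod>y\<in>Y. f y (\<omega> y)) \<partial>distr (PiM UNIV (\<lambda>_. unit_uniform)) (PiM Y (\<lambda>_. unit_uniform)) (\<lambda>\<omega>. restrict \<omega> Y))"
  proof (rule integral_distr[symmetric])
    show "(\<lambda>\<omega>. \<Prod>y\<in>Y. f y (\<omega> y)) \<in> borel_measurable (PiM Y (\<lambda>_. unit_uniform))"
      by (intro borel_measurable_prod) (rule measurable_compose[OF measurable_component_singleton[where M = "\<lambda>_. unit_uniform"] fm], simp)
  qed (rule measurable_restrict_subset, simp)
  also have "\<dots> = (\<integral>\<omega>. (\<Prod>y\<in>Y. f y (\<omega> y)) \<partial>PiM Y (\<lambda>_. unit_uniform))"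
    using P.distr_PiM_restrict_finite[OF finY] by simp
  also have "\<dots> = (\<Prod>y\<in>Y. integral\<^sup>L unit_uniform (f y))"
    by (rule P.product_integral_prod[OF finY fint])
  also have "\<dots> = 0"
  proof -
    obtain x where x: "x \<in> Poly_Mapping.keys l" using False by (metis keys_eq_empty equals0I)
    have "g - (- x + g) = x" by (simp add: diff_conv_add_uminus minus_add add.assoc[symmetric] del: add_uminus_conv_diff)
    then have "integral\<^sup>L unit_uniform (f (- x + g)) = 0"
      unfolding f_def using x by (intro integral_unit_uniform_exp) (simp add: in_keys_iff)
    then show ?thesis using x finY by (auto simp: Y_def prod_zero_iff)
  qed
  finally show ?thesis using False by simp
qed

section \<open>Expansions in an orthonormal system\<close>

text \<open>
  The Fourier coefficients of \<open>X\<close> are the limits of those of the uniformly approximating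
  finite sums. Among the combinations of finitely many elements of the system, the Fourier
  sum is the closest to \<open>X\<close>, so it is at least as close as the approximating sums, and
  Bessel's inequality is an equality.
\<close>

lemma (in prob_space) L2_expansion:
  fixes e :: "'i \<Rightarrow> 'a \<Rightarrow> complex" and X :: "'a \<Rightarrow> complex"
  assumes em: "\<And>i. e i \<in> borel_measurable M" and e1: "\<And>i x. norm (e i x) = 1"
    and ortho: "\<And>i j. (\<integral>x. e i x * cnj (e j x) \<partial>M) = of_bool (i = j)"
    and approx: "\<And>r. r > 0 \<Longrightarrow> \<exists>F c'. finite F \<and> (\<forall>i. i \<notin> F \<longrightarrow> c' i = 0) \<and> (\<forall>i. norm (c i - c' i) \<le> r) \<and>
      (\<forall>x. norm (X x - (\<Sum>i\<in>F. c' i * e i x)) \<le> r)"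
  shows "has_L2_sum M (\<lambda>i x. c i * e i x) X UNIV"
    and "((\<lambda>i. (norm (c i))\<^sup>2) has_sum (\<integral>x. (norm (X x))\<^sup>2 \<partial>M)) UNIV"
proof -
  have int: "integrable M Y" if "Y \<in> borel_measurable M" "\<And>x. norm (Y x) \<le> B" for Y :: "'a \<Rightarrow> complex" and B
    using that by (intro integrable_const_bound[where B = B]) auto
  have intr: "integrable M Y" if "Y \<in> borel_measurable M" "\<And>x. norm (Y x) \<le> B" for Y :: "'a \<Rightarrow> real" and B
    using that by (intro integrable_const_bound[where B = B]) auto
  have Xm: "X \<in> borel_measurable M"
  proof -
    have "\<forall>n. \<exists>Y. Y \<in> borel_measurable M \<and> (\<forall>x. norm (X x - Y x) \<le> 1 / real (Suc n))"
    proof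
      fix n
      obtain F c' where "\<forall>x. norm (X x - (\<Sum>i\<in>F. c' i * e i x)) \<le> 1 / real (Suc n)"
        using approx[of "1 / real (Suc n)"] by auto
      then show "\<exists>Y. Y \<in> borel_measurable M \<and> (\<forall>x. norm (X x - Y x) \<le> 1 / real (Suc n))"
        using em by (intro exI[of _ "\<lambda>x. \<Sum>i\<in>F. c' i * e i x"]) auto
    qed
    then have "\<exists>Y. \<forall>n. Y n \<in> borel_measurable M \<and> (\<forall>x. norm (X x - Y n x) \<le> 1 / real (Suc n))"
      by (rule choice)
    then obtain Y where Y: "\<And>n. Y n \<in> borel_measurable M" "\<And>n x. norm (X x - Y n x) \<le> 1 / real (Suc n)"
      by blast
    have "(\<lambda>n. Y n x) \<longlonglongrightarrow> X x" for x
    proof (rule metric_LIMSEQ_I)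
      fix r :: real assume "r > 0"
      then obtain N where N: "1 / real (Suc N) < r" using nat_approx_posE by blast
      have "dist (Y n x) (X x) < r" if "n \<ge> N" for n
      proof -
        have "1 / real (Suc n) \<le> 1 / real (Suc N)" using that by (simp add: frac_le)
        then have "norm (X x - Y n x) \<le> 1 / real (Suc N)" using Y(2)[of x n] by linarith
        then show ?thesis using N by (simp add: dist_norm norm_minus_commute)
      qed
      then show "\<exists>N. \<forall>n\<ge>N. dist (Y n x) (X x) < r" by blast
    qed
    from borel_measurable_LIMSEQ_metric[OF Y(1) this] show ?thesis .
  qed
  obtain B where B: "\<And>x. norm (X x) \<le> B"
  proof -
    obtain F c' where F: "\<And>x. norm (X x - (\<Sum>i\<in>F. c' i * e i x)) \<le> 1"
      using approx[of 1] by auto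
    have "norm (X x) \<le> 1 + (\<Sum>i\<in>F. norm (c' i))" for x
    proof -
      have "norm (\<Sum>i\<in>F. c' i * e i x) \<le> (\<Sum>i\<in>F. norm (c' i))"
        by (rule sum_norm_le) (simp add: norm_mult e1)
      then show ?thesis using F[of x] norm_triangle_sub[of "X x" "\<Sum>i\<in>F. c' i * e i x"] by linarith
    qed
    then show ?thesis by (rule that)
  qed
  have cm: "(\<lambda>x. cnj (Y x)) \<in> borel_measurable M" if "Y \<in> borel_measurable M" for Y :: "'a \<Rightarrow> complex"
    using that by (rule measurable_compose) (intro borel_measurable_continuous_onI continuous_intros)
  have ei: "integrable M (\<lambda>x. e i x * cnj (e j x))" for i j
    using em cm e1 by (intro int[of _ 1]) (auto simp: norm_mult)
  have Xe: "integrable M (\<lambda>x. X x * cnj (e j x))" for j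
    using em e1 Xm cm B by (intro int[of _ B]) (auto simp: norm_mult)
  have XX: "integrable M (\<lambda>x. X x * cnj (X x))"
    using Xm cm by (intro int[of _ "B * B"]) (auto simp: norm_mult intro!: mult_mono B order_trans[OF norm_ge_zero B])
  have coeff: "(\<integral>x. X x * cnj (e j x) \<partial>M) = c j" for j
  proof -
    have "norm ((\<integral>x. X x * cnj (e j x) \<partial>M) - c j) \<le> 0 + r" if r: "r > 0" for r
    proof -
      obtain F c' where F: "finite F" "\<And>i. i \<notin> F \<Longrightarrow> c' i = 0" "\<And>i. norm (c i - c' i) \<le> r / 2"
        "\<And>x. norm (X x - (\<Sum>i\<in>F. c' i * e i x)) \<le> r / 2"
        using approx[of "r / 2"] r by auto
      have 1: "(\<integral>x. (\<Sum>i\<in>F. c' i * e i x) * cnj (e j x) \<partial>M) = c' j"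
      proof -
        have "(\<integral>x. (\<Sum>i\<in>F. c' i * e i x) * cnj (e j x) \<partial>M) = (\<integral>x. (\<Sum>i\<in>F. c' i * (e i x * cnj (e j x))) \<partial>M)"
          by (simp add: sum_distrib_right mult.assoc)
        also have "\<dots> = (\<Sum>i\<in>F. c' i * of_bool (i = j))"
          using ei by (subst Bochner_Integration.integral_sum) (auto simp: ortho)
        also have "\<dots> = c' j" using F(1,2) by (auto simp: of_bool_def if_distrib[of "\<lambda>t. _ * t"] sum.delta cong: if_cong)
        finally show ?thesis .
      qed
      have i2: "integrable M (\<lambda>x. (\<Sum>i\<in>F. c' i * e i x) * cnj (e j x))"
        using ei by (simp add: sum_distrib_right mult.assoc)
      have "norm ((\<integral>x. X x * cnj (e j x) \<partial>M) - c' j) = norm (\<integral>x. (X x - (\<Sum>i\<in>F. c' i * e i x)) * cnj (e j x) \<partial>M)"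
        unfolding 1[symmetric] using Xe i2 by (simp add: left_diff_distrib)
      also have "\<dots> \<le> (\<integral>x. norm ((X x - (\<Sum>i\<in>F. c' i * e i x)) * cnj (e j x)) \<partial>M)"
        by (rule integral_norm_bound)
      also have "\<dots> \<le> (\<integral>x. r / 2 \<partial>M)"
      proof (rule integral_mono)
        show "integrable M (\<lambda>x. norm ((X x - (\<Sum>i\<in>F. c' i * e i x)) * cnj (e j x)))"
          using Xe i2 by (simp add: left_diff_distrib)
      qed (use F(4) in \<open>auto simp: norm_mult e1\<close>)
      also have "\<dots> = r / 2" by (simp add: prob_space)
      finally have "norm ((\<integral>x. X x * cnj (e j x) \<partial>M) - c' j) \<le> r / 2" .
      then show ?thesis
        using F(3)[of j] norm_triangle_ineq[of "(\<integral>x. X x * cnj (e j x) \<partial>M) - c' j" "c' j - c j"]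
        by (simp add: norm_minus_commute)
    qed
    then have "norm ((\<integral>x. X x * cnj (e j x) \<partial>M) - c j) \<le> 0" by (rule field_le_epsilon)
    then show ?thesis by simp
  qed
  have coeff': "(\<integral>x. e j x * cnj (X x) \<partial>M) = cnj (c j)" for j
    using Bochner_Integration.integral_cnj[of M "\<lambda>x. X x * cnj (e j x)"] by (simp add: coeff mult.commute)
  have eX: "integrable M (\<lambda>x. e j x * cnj (X x))" for j
    using em e1 Xm cm B by (intro int[of _ B]) (auto simp: norm_mult)
  define N where "N = (\<integral>x. (norm (X x))\<^sup>2 \<partial>M)"
  \<comment> \<open>The distance to a linear combination, by completing the square.\<close>
  have dist: "(\<integral>x. (norm (X x - (\<Sum>i\<in>J. b i * e i x)))\<^sup>2 \<partial>M)
      = N - (\<Sum>i\<in>J. (norm (c i))\<^sup>2) + (\<Sum>i\<in>J. (norm (b i - c i))\<^sup>2)" if J: "finite J" for J b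
  proof -
    have "complex_of_real (\<integral>x. (norm (X x - (\<Sum>i\<in>J. b i * e i x)))\<^sup>2 \<partial>M)
        = (\<integral>x. (X x - (\<Sum>i\<in>J. b i * e i x)) * cnj (X x - (\<Sum>i\<in>J. b i * e i x)) \<partial>M)"
      by (simp only: integral_complex_of_real[symmetric] complex_norm_square)
    also have "\<dots> = (\<integral>x. X x * cnj (X x) - (\<Sum>i\<in>J. b i * (e i x * cnj (X x))) - (\<Sum>i\<in>J. cnj (b i) * (X x * cnj (e i x)))
        + (\<Sum>i\<in>J. \<Sum>j\<in>J. b i * cnj (b j) * (e i x * cnj (e j x))) \<partial>M)"
    proof (intro Bochner_Integration.integral_cong refl)
      fix x
      define s where "s = (\<Sum>i\<in>J. b i * e i x)"
      have "s * cnj s = (\<Sum>i\<in>J. \<Sum>j\<in>J. b i * cnj (b j) * (e i x * cnj (e j x)))"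
        unfolding s_def cnj_sum sum_product by (simp add: ac_simps)
      moreover have "s * cnj (X x) = (\<Sum>i\<in>J. b i * (e i x * cnj (X x)))"
        by (simp add: s_def sum_distrib_right mult.assoc)
      moreover have "X x * cnj s = (\<Sum>i\<in>J. cnj (b i) * (X x * cnj (e i x)))"
        by (simp add: s_def sum_distrib_left mult.left_commute)
      moreover have "(X x - s) * cnj (X x - s) = X x * cnj (X x) - s * cnj (X x) - X x * cnj s + s * cnj s"
        by (simp add: algebra_simps)
      ultimately show "(X x - (\<Sum>i\<in>J. b i * e i x)) * cnj (X x - (\<Sum>i\<in>J. b i * e i x)) =
          X x * cnj (X x) - (\<Sum>i\<in>J. b i * (e i x * cnj (X x))) - (\<Sum>i\<in>J. cnj (b i) * (X x * cnj (e i x)))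
          + (\<Sum>i\<in>J. \<Sum>j\<in>J. b i * cnj (b j) * (e i x * cnj (e j x)))"
        unfolding s_def[symmetric] by (simp only:)
    qed
    also have "\<dots> = (\<integral>x. X x * cnj (X x) \<partial>M) - (\<Sum>i\<in>J. b i * cnj (c i)) - (\<Sum>i\<in>J. cnj (b i) * c i)
        + (\<Sum>i\<in>J. \<Sum>j\<in>J. b i * cnj (b j) * of_bool (i = j))"
      by (simp add: XX eX Xe ei coeff coeff' ortho)
    also have "(\<integral>x. X x * cnj (X x) \<partial>M) = of_real N"
      by (simp only: N_def integral_complex_of_real[symmetric] complex_norm_square)
    also have "(\<Sum>i\<in>J. \<Sum>j\<in>J. b i * cnj (b j) * of_bool (i = j)) = (\<Sum>i\<in>J. b i * cnj (b i))"
      using J by (simp add: of_bool_def if_distrib[of "\<lambda>t. _ * t"] sum.delta' cong: if_cong)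
    also have "of_real N - (\<Sum>i\<in>J. b i * cnj (c i)) - (\<Sum>i\<in>J. cnj (b i) * c i) + (\<Sum>i\<in>J. b i * cnj (b i))
        = of_real N - (\<Sum>i\<in>J. c i * cnj (c i)) + (\<Sum>i\<in>J. (b i - c i) * cnj (b i - c i))"
      by (simp add: algebra_simps sum.distrib sum_subtractf)
    also have "\<dots> = complex_of_real (N - (\<Sum>i\<in>J. (norm (c i))\<^sup>2) + (\<Sum>i\<in>J. (norm (b i - c i))\<^sup>2))"
      by (simp only: complex_norm_square[symmetric] of_real_sum[symmetric] of_real_add[symmetric] of_real_diff[symmetric])
    finally show ?thesis by (simp only: of_real_eq_iff)
  qed
  have below: "(\<Sum>i\<in>J. (norm (c i))\<^sup>2) \<le> N" if "finite J" for J
  proof -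
    have "0 \<le> (\<integral>x. (norm (X x - (\<Sum>i\<in>J. c i * e i x)))\<^sup>2 \<partial>M)" by simp
    then show ?thesis using dist[OF that, of c] by simp
  qed
  have "((\<lambda>J. N - (\<Sum>i\<in>J. (norm (c i))\<^sup>2)) \<longlongrightarrow> 0) (finite_subsets_at_top UNIV)"
  proof (rule tendstoI)
    fix r :: real assume r: "r > 0"
    define s where "s = sqrt (r / 2)"
    have s: "s > 0" "s\<^sup>2 < r" using r by (auto simp: s_def)
    obtain F c' where F: "finite F" "\<And>i. i \<notin> F \<Longrightarrow> c' i = 0"
      "\<And>x. norm (X x - (\<Sum>i\<in>F. c' i * e i x)) \<le> s"
      using approx[OF s(1)] by auto
    have "dist (N - (\<Sum>i\<in>J. (norm (c i))\<^sup>2)) 0 < r" if J: "finite J" "F \<subseteq> J" for J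
    proof -
      have "(\<integral>x. (norm (X x - (\<Sum>i\<in>F. c' i * e i x)))\<^sup>2 \<partial>M) \<le> (\<integral>x. s\<^sup>2 \<partial>M)"
      proof (rule integral_mono)
        show "integrable M (\<lambda>x. (norm (X x - (\<Sum>i\<in>F. c' i * e i x)))\<^sup>2)"
          using Xm em F(3) by (intro intr[of _ "s\<^sup>2"]) (auto intro!: power_mono)
      qed (use F(3) in \<open>auto intro!: power_mono\<close>)
      also have "\<dots> = s\<^sup>2" by (simp add: prob_space)
      finally have "N - (\<Sum>i\<in>F. (norm (c i))\<^sup>2) + (\<Sum>i\<in>F. (norm (c' i - c i))\<^sup>2) \<le> s\<^sup>2"
        by (simp only: dist[OF F(1)])
      moreover have "0 \<le> (\<Sum>i\<in>F. (norm (c' i - c i))\<^sup>2)" by (simp add: sum_nonneg)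
      moreover have "(\<Sum>i\<in>F. (norm (c i))\<^sup>2) \<le> (\<Sum>i\<in>J. (norm (c i))\<^sup>2)"
        using J by (intro sum_mono2) auto
      ultimately show ?thesis using below[OF J(1)] s(2) by (simp add: dist_real_def)
    qed
    then show "\<forall>\<^sub>F J in finite_subsets_at_top UNIV. dist (N - (\<Sum>i\<in>J. (norm (c i))\<^sup>2)) 0 < r"
      unfolding eventually_finite_subsets_at_top using F(1) by blast
  qed
  note lim = this
  from tendsto_diff[OF tendsto_const[of N] lim]
  show "((\<lambda>i. (norm (c i))\<^sup>2) has_sum (\<integral>x. (norm (X x))\<^sup>2 \<partial>M)) UNIV"
    by (simp add: has_sum_def N_def)
  have "square_integrable M X"
    unfolding square_integrable_def using Xm
    by (auto intro!: intr[of _ "B\<^sup>2"] power_mono B)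
  moreover have "square_integrable M (\<lambda>x. c i * e i x)" for i
    unfolding square_integrable_def using em
    by (auto intro!: intr[of _ "(norm (c i))\<^sup>2"] simp: norm_mult e1)
  moreover have "((\<lambda>J. \<integral>x. (norm (X x - (\<Sum>i\<in>J. c i * e i x)))\<^sup>2 \<partial>M) \<longlongrightarrow> 0) (finite_subsets_at_top UNIV)"
  proof (rule Lim_transform_eventually[OF lim])
    show "\<forall>\<^sub>F J in finite_subsets_at_top UNIV. N - (\<Sum>i\<in>J. (norm (c i))\<^sup>2)
        = (\<integral>x. (norm (X x - (\<Sum>i\<in>J. c i * e i x)))\<^sup>2 \<partial>M)"
      by (rule eventually_finite_subsets_at_top_weakI) (simp add: dist)
  qed
  ultimately show "has_L2_sum M (\<lambda>i x. c i * e i x) X UNIV" by (simp add: has_L2_sum_def)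
qed

section \<open>The Fourier expansion of matrix elements\<close>

text \<open>
  For a group element \<open>w\<close> the matrix element on the left is nonzero only if \<open>w\<close> is the
  inverse of some \<open>(l, g)\<close>, and then the matrix element of the induced representation is
  the corresponding mode.
\<close>

lemma group_algebra_pair_matrix_element:
  assumes "group_algebra_pair T S"
  shows "\<exists>F. finite F \<and> (\<forall>l. l \<notin> F \<longrightarrow> cip (delta 0) (T (delta (Wr l g))) = 0) \<and>
    (\<forall>\<omega>. cip (delta 0) (S \<omega> (delta g)) = (\<Sum>l\<in>F. cip (delta 0) (T (delta (Wr l g))) * cnj (lamp_phase \<omega> l g)))"
  using assms
proof induction
  case (gen c w)
  define F where "F = (if - position w = g then {lamps (- w)} else {})"
  have T: "cip (delta 0) ((scalar c o\<^sub>L left_regular w) (delta (Wr l g))) = (if l \<in> F then c else 0)" for l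
  proof -
    have "- w + 0 = Wr l g \<longleftrightarrow> l \<in> F"
      by (cases "- w") (auto simp: F_def uminus_wreath_def)
    then show ?thesis by (simp add: cip_delta_left scalar_apply left_regular_apply Rep_delta)
  qed
  have "cip (delta 0) ((scalar c o\<^sub>L wreath_rep \<omega> w) (delta g)) = (\<Sum>l\<in>F. c * cnj (lamp_phase \<omega> l g))" for \<omega>
  proof (cases "- position w = g")
    case True
    have "lamp_phase \<omega> (lamps (- w)) g = lamp_phase \<omega> (- lamps w) (position w + g)"
      by (simp add: uminus_wreath_def lamp_phase_shift)
    also have "position w + g = 0" using True[symmetric] by simp
    finally show ?thesis
      using True by (simp add: F_def cip_delta_left scalar_apply wreath_rep_apply Rep_delta lamp_phase_uminus)
  next
    case False
    then show ?thesis by (simp add: F_def cip_delta_left scalar_apply wreath_rep_apply Rep_delta)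
  qed
  then show ?case by (intro exI[of _ F]) (auto simp: T[unfolded blinfun_apply_blinfun_compose] F_def)
next
  case (add T S T' S')
  obtain F where F: "finite F" "\<And>l. l \<notin> F \<Longrightarrow> cip (delta 0) (T (delta (Wr l g))) = 0"
    "\<And>\<omega>. cip (delta 0) (S \<omega> (delta g)) = (\<Sum>l\<in>F. cip (delta 0) (T (delta (Wr l g))) * cnj (lamp_phase \<omega> l g))"
    using add.IH(1) by auto
  obtain F' where F': "finite F'" "\<And>l. l \<notin> F' \<Longrightarrow> cip (delta 0) (T' (delta (Wr l g))) = 0"
    "\<And>\<omega>. cip (delta 0) (S' \<omega> (delta g)) = (\<Sum>l\<in>F'. cip (delta 0) (T' (delta (Wr l g))) * cnj (lamp_phase \<omega> l g))"
    using add.IH(2) by auto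
  have 1: "cip (delta 0) (S \<omega> (delta g)) = (\<Sum>l\<in>F \<union> F'. cip (delta 0) (T (delta (Wr l g))) * cnj (lamp_phase \<omega> l g))" for \<omega>
    unfolding F(3) by (rule sum.mono_neutral_left) (use F F' in auto)
  have 2: "cip (delta 0) (S' \<omega> (delta g)) = (\<Sum>l\<in>F \<union> F'. cip (delta 0) (T' (delta (Wr l g))) * cnj (lamp_phase \<omega> l g))" for \<omega>
    unfolding F'(3) by (rule sum.mono_neutral_left) (use F F' in auto)
  show ?case
    by (intro exI[of _ "F \<union> F'"])
      (use F F' in \<open>simp add: blinfun.add_left cip_add_right 1 2 sum.distrib algebra_simps\<close>)
qed

lemma norm_matrix_element_diff_le:
  fixes A B :: "'a ell2 \<Rightarrow>\<^sub>L 'b ell2"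
  shows   "norm (cip (delta x) (A (delta y)) - cip (delta x) (B (delta y))) \<le> norm (A - B)"
proof -
  have "norm (Rep_ell2 ((A - B) (delta y)) x) \<le> norm ((A - B) (delta y))" by (rule norm_Rep_ell2_le)
  also have "\<dots> \<le> norm (A - B)" using norm_blinfun[of "A - B" "delta y"] by (simp add: norm_delta)
  finally show ?thesis by (simp add: cip_delta_left blinfun.diff_left Rep_ell2_diff)
qed

lemma group_algebra_limit_expansion:
  fixes S :: "('g::{group_add,countable} \<Rightarrow> real) \<Rightarrow> 'g ell2 \<Rightarrow>\<^sub>L 'g ell2"
  assumes "group_algebra_limit T S"
  shows "has_L2_sum uniform_product (\<lambda>l \<omega>. cip (delta 0) (T (delta (Wr l g))) * cnj (lamp_phase \<omega> l g))
      (\<lambda>\<omega>. cip (delta 0) (S \<omega> (delta g))) UNIV"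
    and "((\<lambda>l. (norm (cip (delta 0) (T (delta (Wr l g)))))\<^sup>2) has_sum
      (\<integral>\<omega>. (norm (cip (delta 0) (S \<omega> (delta g))))\<^sup>2 \<partial>uniform_product)) UNIV"
proof -
  interpret prob_space "uniform_product :: ('g \<Rightarrow> real) measure" by (rule prob_space_uniform_product)
  have m: "(\<lambda>\<omega>. cnj (lamp_phase \<omega> l g)) \<in> borel_measurable uniform_product" for l
    using measurable_lamp_phase[of "- l" g] by (simp add: lamp_phase_uminus)
  have ortho: "(\<integral>\<omega>. cnj (lamp_phase \<omega> l g) * cnj (cnj (lamp_phase \<omega> k g)) \<partial>uniform_product) = of_bool (l = k)" for l k
  proof -
    have "cnj (lamp_phase \<omega> l g) * cnj (cnj (lamp_phase \<omega> k g)) = lamp_phase \<omega> (- l + k) g" for \<omega>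
      by (simp only: lamp_phase_add lamp_phase_uminus complex_cnj_cnj)
    then show ?thesis by (simp add: integral_lamp_phase eq_neg_iff_add_eq_0 add_eq_0_iff) 
  qed
  have approx: "\<exists>F c'. finite F \<and> (\<forall>l. l \<notin> F \<longrightarrow> c' l = 0) \<and> (\<forall>l. norm (cip (delta 0) (T (delta (Wr l g))) - c' l) \<le> r) \<and>
      (\<forall>\<omega>. norm (cip (delta 0) (S \<omega> (delta g)) - (\<Sum>l\<in>F. c' l * cnj (lamp_phase \<omega> l g))) \<le> r)" if "r > 0" for r
  proof -
    obtain T' S' where T': "group_algebra_pair T' S'" "norm (T - T') \<le> r" "\<And>\<omega>. norm (S \<omega> - S' \<omega>) \<le> r"
      using group_algebra_limitE[OF assms \<open>r > 0\<close>] by blast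
    obtain F where F: "finite F" "\<forall>l. l \<notin> F \<longrightarrow> cip (delta 0) (T' (delta (Wr l g))) = 0"
      "\<And>\<omega>. cip (delta 0) (S' \<omega> (delta g)) = (\<Sum>l\<in>F. cip (delta 0) (T' (delta (Wr l g))) * cnj (lamp_phase \<omega> l g))"
      using group_algebra_pair_matrix_element[OF T'(1), of g] by auto
    show ?thesis
      by (rule exI[of _ F], rule exI[of _ "\<lambda>l. cip (delta 0) (T' (delta (Wr l g)))"])
        (use F T' in \<open>auto simp flip: F(3) intro: order_trans[OF norm_matrix_element_diff_le]\<close>)
  qed
  show "has_L2_sum uniform_product (\<lambda>l \<omega>. cip (delta 0) (T (delta (Wr l g))) * cnj (lamp_phase \<omega> l g))
      (\<lambda>\<omega>. cip (delta 0) (S \<omega> (delta g))) UNIV"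
    by (rule L2_expansion(1)[OF m _ ortho approx]) simp_all
  show "((\<lambda>l. (norm (cip (delta 0) (T (delta (Wr l g)))))\<^sup>2) has_sum
      (\<integral>\<omega>. (norm (cip (delta 0) (S \<omega> (delta g))))\<^sup>2 \<partial>uniform_product)) UNIV"
    by (rule L2_expansion(2)[OF m _ ortho approx]) simp_all
qed

theorem proposition2p5:
  fixes m\<^sub>\<Gamma> :: "'g::{group_add,countable} \<Rightarrow> complex"
    and m\<^sub>Z :: "int \<Rightarrow> complex"
    and f :: "complex \<Rightarrow> complex"
    and g :: 'g
    and M :: "'g wreath ell2 \<Rightarrow>\<^sub>L 'g wreath ell2"
    and H :: "('g \<Rightarrow> real) \<Rightarrow> ('g ell2 \<Rightarrow>\<^sub>L 'g ell2)"
  defines "M \<equiv> convolution_op (wreath_measure m\<^sub>\<Gamma> m\<^sub>Z)"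
    and "H \<equiv> random_hamiltonian m\<^sub>\<Gamma> m\<^sub>Z"
  assumes "(\<lambda>x. norm (m\<^sub>\<Gamma> x)) summable_on UNIV"
    and "(\<lambda>n. norm (m\<^sub>Z n)) summable_on UNIV"
    and "self_adjoint (convolution_op m\<^sub>\<Gamma>)"
    and "self_adjoint (convolution_op m\<^sub>Z)"
    and "smooth_on_spectrum f (spectrum M)"
    and "bounded (f ` spectrum M)"
  shows "has_L2_sum uniform_product
      (\<lambda>l \<omega>. cip (delta 0) (fun_calc f M (delta (Wr l g))) *
        exp (- (2 * of_real pi * \<i> * of_real (lamp_pairing l (\<lambda>x. \<omega> (- x + g))))))
      (\<lambda>\<omega>. cip (delta 0) (fun_calc f (H \<omega>) (delta g)))
      UNIV
    \<and> ((\<lambda>l. (norm (cip (delta 0) (fun_calc f M (delta (Wr l g)))))\<^sup>2) has_sum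
      (\<integral>\<omega>. (norm (cip (delta 0) (fun_calc f (H \<omega>) (delta g))))\<^sup>2 \<partial>uniform_product)) UNIV"
proof -
  have lim: "group_algebra_limit (fun_calc f M) (\<lambda>\<omega>. fun_calc f (H \<omega>))"
    unfolding M_def H_def
    using group_algebra_limit_fun_calc[OF assms(3-6) assms(7)[unfolded M_def]] .
  have "exp (- (2 * of_real pi * \<i> * of_real (lamp_pairing l (\<lambda>x. \<omega> (- x + g))))) = cnj (lamp_phase \<omega> l g)"
    for l and \<omega> :: "'g \<Rightarrow> real"
    by (simp add: lamp_phase_def exp_cnj)
  then show ?thesis using group_algebra_limit_expansion[OF lim, of g] by simp
qed

end
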